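(* Let $N$ be a non-negative integer. (a) For every integer $n\ge 0$, \[ d_{2n}=\frac{1}{(2n)!}\left[\frac{d^{2n}}{dt^{2n}}\left(\frac{t^3}{\sinh t-t}\right)^{\frac{2n+1}{3}}\right]_{t=0}=\frac{(-1)^n}{\Gamma\left(\frac{2n+1}{3}\right)}\int_0^{+\infty}t^{\frac{2n-2}{3}}e^{-2\pi t}\,iH^{(1)}_{it}(it)\,dt . \] (b) For a complex number $w$ with $-\frac{\pi}{2}<\arg w<\frac{3\pi}{2}$ define \[ R_N^{(H)}(w)=\frac{(-1)^N}{3\pi w^{\frac{2N+1}{3}}}\int_0^{+\infty}t^{\frac{2N-2}{3}}e^{-2\pi t}\left(\frac{e^{\frac{(2N+1)\pi i}{3}}}{1+(t/w)^{\frac23}e^{\frac{2\pi i}{3}}}+\frac{1}{1+(t/w)^{\frac23}}\right)H^{(1)}_{it}(it)\,dt . \] Then \[ H^{(1)}_\nu(\nu)=-\frac{2}{3\pi}\sum_{n=0}^{N-1}d_{2n}e^{\frac{2(2n+1)\pi i}{3}}\sin\left(\frac{(2n+1)\pi}{3}\right)\frac{\Gamma\left(\frac{2n+1}{3}\right)}{\nu^{\frac{2n+1}{3}}}+R_N^{(H)}(\nu)\quad\text{for }-\tfrac{\pi}{2}<\arg\nu<\tfrac{3\pi}{2}, \] \[ H^{(2)}_\nu(\nu)=-\frac{2}{3\pi}\sum_{n=0}^{N-1}d_{2n}e^{-\frac{2(2n+1)\pi i}{3}}\sin\left(\frac{(2n+1)\pi}{3}\right)\frac{\Gamma\left(\frac{2n+1}{3}\right)}{\nu^{\frac{2n+1}{3}}}-R_N^{(H)}(\nu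 e^{\pi i})\quad\text{for }-\tfrac{3\pi}{2}<\arg\nu<\tfrac{\pi}{2}. \] (c) For $|\arg\nu|<\frac{\pi}{2}$, \[ J_\nu(\nu)=\frac{1}{3\pi}\sum_{n=0}^{N-1}d_{2n}\sin\left(\frac{(2n+1)\pi}{3}\right)\frac{\Gamma\left(\frac{2n+1}{3}\right)}{\nu^{\frac{2n+1}{3}}}+R_N^{(J)}(\nu),\qquad Y_\nu(\nu)=-\frac{2}{3\pi}\sum_{n=0}^{N-1}d_{2n}\sin^2\left(\frac{(2n+1)\pi}{3}\right)\frac{\Gamma\left(\frac{2n+1}{3}\right)}{\nu^{\frac{2n+1}{3}}}+R_N^{(Y)}(\nu), \] where \[ R_N^{(J)}(\nu)=\frac{(-1)^N}{6\pi\nu^{\frac{2N+1}{3}}}\int_0^{+\infty}t^{\frac{2N-2}{3}}e^{-2\pi t}\left(\frac{e^{\frac{(2N+1)\pi i}{3}}}{1+(t/\nu)^{\frac23}e^{\frac{2\pi i}{3}}}-\frac{e^{-\frac{(2N+1)\pi i}{3}}}{1+(t/\nu)^{\frac23}e^{-\frac{2\pi i}{3}}}\right)H^{(1)}_{it}(it)\,dt, \] \[ R_N^{(Y)}(\nu)=\frac{(-1)^N}{6\pi i\,\nu^{\frac{2N+1}{3}}}\int_0^{+\infty}t^{\frac{2N-2}{3}}e^{-2\pi t}\left(\frac{e^{\frac{(2N+1)\pi i}{3}}}{1+(t/\nu)^{\frac23}e^{\frac{2\pi i}{3}}}+\frac{e^{-\frac{(2N+1)\pi i}{3}}}{1+(t/\nu)^{\frac23}e^{-\frac{2\pi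 i}{3}}}+\frac{2}{1+(t/\nu)^{\frac23}}\right)H^{(1)}_{it}(it)\,dt . \]
   Context: $H^{(1)}_\nu$, $H^{(2)}_\nu$ are the Hankel functions and $J_\nu$, $Y_\nu$ the Bessel functions of the first and second kind. The functions $\nu\mapsto H^{(1)}_\nu(\nu)$, $H^{(2)}_\nu(\nu)$ are understood as analytic continuations in $\nu$ (on the Riemann surface of $\log\nu$) from $\nu>0$. All fractional powers (cube roots and their powers, e.g. $\nu^{(2n+1)/3}$, $(t/\nu)^{2/3}$) are positive on the positive real line and defined by analytic continuation elsewhere. For $t>0$, $iH^{(1)}_{it}(it)$ denotes the standard value $\frac{2}{\pi}e^{\pi t/2}K_{it}(t)$. Empty sums are zero. *)

theory Defs
  imports "HOL-Analysis.Analysis"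
begin

text \<open>Points nu of the Riemann surface of log are represented by a logarithmic
coordinate zeta with nu = exp zeta, arg nu = Im zeta.  All fractional powers
nu^a are exp (a * zeta).\<close>

text \<open>Bessel function of the first kind J_mu(z), with z = exp zeta on the Riemann
surface of log: sum_k (-1)^k (z/2)^(2k+mu) / (k! Gamma(k+mu+1)).\<close>
definition besselJ_log :: "complex \<Rightarrow> complex \<Rightarrow> complex" where
  "besselJ_log \<mu> \<zeta> =
     (\<Sum>k. (-1) ^ k * exp ((2 * of_nat k + \<mu>) * (\<zeta> - of_real (ln 2)))
            * rGamma (of_nat k + \<mu> + 1) / of_nat (fact k))"

definition J_diag :: "complex \<Rightarrow> complex" where
  "J_diag \<zeta> = besselJ_log (exp \<zeta>) \<zeta>"

text \<open>(J_nu(nu) cos(nu pi) - J_{-nu}(nu)) / sin(nu pi); removable singularities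
where nu is an integer.\<close>
definition Y_raw :: "complex \<Rightarrow> complex" where
  "Y_raw \<zeta> = (besselJ_log (exp \<zeta>) \<zeta> * cos (exp \<zeta> * of_real pi)
                - besselJ_log (- exp \<zeta>) \<zeta>) / sin (exp \<zeta> * of_real pi)"

text \<open>nu |-> Y_nu(nu) (limit fills in the removable singularities).\<close>
definition Y_diag :: "complex \<Rightarrow> complex" where
  "Y_diag \<zeta> = Lim (at \<zeta>) Y_raw"

definition H1_diag :: "complex \<Rightarrow> complex" where
  "H1_diag \<zeta> = J_diag \<zeta> + \<i> * Y_diag \<zeta>"

definition H2_diag :: "complex \<Rightarrow> complex" where
  "H2_diag \<zeta> = J_diag \<zeta> - \<i> * Y_diag \<zeta>"

text \<open>H^(1)_{it}(it) for t > 0: it = exp (ln t + i pi/2).\<close>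
definition H1_it :: "real \<Rightarrow> complex" where
  "H1_it t = H1_diag (of_real (ln t) + \<i> * of_real (pi / 2))"

text \<open>t^3/(sinh t - t), extended continuously by 6 at t = 0.\<close>
definition sinh_ratio :: "real \<Rightarrow> real" where
  "sinh_ratio t = (if t = 0 then 6 else t ^ 3 / (sinh t - t))"

definition dcoef :: "nat \<Rightarrow> real" where
  "dcoef n = (deriv ^^ (2 * n)) (\<lambda>t. sinh_ratio t powr ((2 * real n + 1) / 3)) 0
             / fact (2 * n)"

definition wt :: "nat \<Rightarrow> real \<Rightarrow> complex" where
  "wt N t = of_real (t powr ((2 * real N - 2) / 3) * exp (- 2 * pi * t))"

definition tw23 :: "real \<Rightarrow> complex \<Rightarrow> complex" where
  "tw23 t \<zeta> = of_real (t powr (2 / 3)) * exp (- (2 / 3) * \<zeta>)"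

definition R_H :: "nat \<Rightarrow> complex \<Rightarrow> complex" where
  "R_H N \<zeta> = (-1) ^ N / (3 * of_real pi * exp ((2 * of_nat N + 1) / 3 * \<zeta>)) *
     integral {0<..} (\<lambda>t. wt N t *
        (exp ((2 * of_nat N + 1) * of_real pi * \<i> / 3)
            / (1 + tw23 t \<zeta> * exp (2 * of_real pi * \<i> / 3))
         + 1 / (1 + tw23 t \<zeta>)) * H1_it t)"

definition R_J :: "nat \<Rightarrow> complex \<Rightarrow> complex" where
  "R_J N \<zeta> = (-1) ^ N / (6 * of_real pi * exp ((2 * of_nat N + 1) / 3 * \<zeta>)) *
     integral {0<..} (\<lambda>t. wt N t *
        (exp ((2 * of_nat N + 1) * of_real pi * \<i> / 3)
            / (1 + tw23 t \<zeta> * exp (2 * of_real pi * \<i> / 3))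
         - exp (- (2 * of_nat N + 1) * of_real pi * \<i> / 3)
            / (1 + tw23 t \<zeta> * exp (- 2 * of_real pi * \<i> / 3))) * H1_it t)"

definition R_Y :: "nat \<Rightarrow> complex \<Rightarrow> complex" where
  "R_Y N \<zeta> = (-1) ^ N / (6 * of_real pi * \<i> * exp ((2 * of_nat N + 1) / 3 * \<zeta>)) *
     integral {0<..} (\<lambda>t. wt N t *
        (exp ((2 * of_nat N + 1) * of_real pi * \<i> / 3)
            / (1 + tw23 t \<zeta> * exp (2 * of_real pi * \<i> / 3))
         + exp (- (2 * of_nat N + 1) * of_real pi * \<i> / 3)
            / (1 + tw23 t \<zeta> * exp (- 2 * of_real pi * \<i> / 3))
         + 2 / (1 + tw23 t \<zeta>)) * H1_it t)"

definition gterm :: "nat \<Rightarrow> complex \<Rightarrow> complex" where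
  "gterm n \<zeta> = of_real (Gamma ((2 * real n + 1) / 3)) / exp ((2 * of_nat n + 1) / 3 * \<zeta>)"

definition s3 :: "nat \<Rightarrow> real" where
  "s3 n = sin ((2 * real n + 1) * pi / 3)"

end

theory Submission
  imports Defs
    "HOL-Complex_Analysis.Complex_Analysis"
    "HOL-Probability.Levy"
    "HOL-Probability.Distributions"
    "HOL-Probability.Sinc_Integral"
    "HOL-Real_Asymp.Real_Asymp"
begin

text \<open>On the positive imaginary axis, \<open>h(t) = i H\<^sup>(\<^sup>1\<^sup>)\<^bsub>it\<^esub>(it)\<close> is \<open>1/\<pi>\<close> times the integral of
  \<open>exp (- t q(z))\<close> with \<open>q(z) = i (sinh z - z)\<close> over a horizontal line just below the real axis;
  since \<open>q(z + 2\<pi>i) = q(z) + 2\<pi>\<close>, the weighted function \<open>exp (- 2\<pi>t) h(t)\<close> is the same integral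
  over a line with \<open>\<pi> < Im z < 2\<pi>\<close>. Mellin transforms turn \<open>exp (- t q)\<close> into \<open>\<Gamma>(a) q\<^sup>-\<^sup>a\<close>, whose
  only branch point in the strip is the double saddle at 0. At \<open>a = (2n+1)/3\<close> the branch
  point becomes a pole and its residue is the coefficient \<open>d\<^sub>2\<^sub>n\<close>. For \<open>0 < a < 1/3\<close> both lines can
  be moved to the real axis, which shows that the Mellin transforms of \<open>h(t)\<close> and
  \<open>exp (- 2\<pi>t) h(t)\<close> have the ratio \<open>cos (\<pi>a/2) / cos (3\<pi>a/2)\<close>. This ratio is the Mellin
  transform of the kernel of the remainder \<open>R\<^sub>0\<close>, so \<open>H\<^sup>(\<^sup>1\<^sup>) = R\<^sub>0\<close> on the imaginary axis by
  uniqueness of Fourier transforms, and everywhere by analytic continuation. Expanding the kernel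
  as a geometric series gives the truncated expansions.\<close>

section \<open>Parameter integrals and the logarithmic substitution\<close>

text \<open>On the scale t = exp \<theta> Mellin integrals become integrals over the whole line,
  multiplicative convolutions become ordinary ones and fractional powers become exponentials; hence
  the logarithmic substitution everywhere. Two obstacles shape the rest. The phase has a triple zero
  at the double saddle, so its power -a behaves like |u| to the power -3a on the real axis: both
  functions can be compared there only for a < 1/3, the range in which the decay of order 1/3 of h
  at infinity also lets its own Mellin integral converge. The coefficients need a = (2n+1)/3 \<ge>
  1/3 and are therefore read off from the damped function alone, whose line Im z = 3\<pi>/2 keeps
  away from the saddle and admits every a > 0. The second obstacle is that H1 is given by power
  series in which order and argument vary together. The integral for h is found by freezing the
  order at \<nu> = it and varying only the argument: a linear system with a singular point at 0
  identifies the series with a Macdonald integral. Straight horizontal lines replace paths of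
  steepest descent, so the phase is never inverted.\<close>

lemma integrable_lborel_iff_absolutely_integrable:
  fixes g :: "real \<Rightarrow> complex"
  assumes "g \<in> borel_measurable borel"
  shows "integrable lborel g \<longleftrightarrow> g absolutely_integrable_on UNIV"
  using assms by (auto simp: set_integrable_def integrable_completion)

text \<open>Bridge between the two kinds of integral in use: the theorem speaks of gauge integrals
  over the half-line, while Fubini, dominated convergence and Fourier uniqueness are applied to
  Lebesgue integrals over the whole line.\<close>

lemma log_substitution:
  fixes f :: "real \<Rightarrow> complex"
  assumes meas: "(\<lambda>\<theta>. exp \<theta> *\<^sub>R f (exp \<theta>)) \<in> borel_measurable borel"
  shows "f absolutely_integrable_on {0<..} \<longleftrightarrow> integrable lborel (\<lambda>\<theta>. exp \<theta> *\<^sub>R f (exp \<theta>))"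
    and "integrable lborel (\<lambda>\<theta>. exp \<theta> *\<^sub>R f (exp \<theta>)) \<Longrightarrow>
      integral {0<..} f = (\<integral>\<theta>. exp \<theta> *\<^sub>R f (exp \<theta>) \<partial>lborel)"
proof -
  have img: "exp ` (UNIV :: real set) = {0<..}"
    by (auto simp: image_iff) (metis exp_ln)
  have iff: "(\<lambda>\<theta>. \<bar>exp \<theta>\<bar> *\<^sub>R f (exp \<theta>)) absolutely_integrable_on UNIV \<and>
          integral UNIV (\<lambda>\<theta>. \<bar>exp \<theta>\<bar> *\<^sub>R f (exp \<theta>)) = b
      \<longleftrightarrow> f absolutely_integrable_on exp ` UNIV \<and> integral (exp ` UNIV) f = b" for b
    by (rule has_absolute_integral_change_of_variables_real)
       (auto intro!: derivative_eq_intros inj_onI)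
  show *: "f absolutely_integrable_on {0<..} \<longleftrightarrow> integrable lborel (\<lambda>\<theta>. exp \<theta> *\<^sub>R f (exp \<theta>))"
    using iff integrable_lborel_iff_absolutely_integrable[OF meas] by (auto simp: img)
  assume int: "integrable lborel (\<lambda>\<theta>. exp \<theta> *\<^sub>R f (exp \<theta>))"
  hence "integral UNIV (\<lambda>\<theta>. exp \<theta> *\<^sub>R f (exp \<theta>)) = integral {0<..} f"
    using iff[of "integral UNIV (\<lambda>\<theta>. exp \<theta> *\<^sub>R f (exp \<theta>))"]
      integrable_lborel_iff_absolutely_integrable[OF meas] by (auto simp: img)
  thus "integral {0<..} f = (\<integral>\<theta>. exp \<theta> *\<^sub>R f (exp \<theta>) \<partial>lborel)"
    using integral_lborel[OF int] by simp
qed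

text \<open>Dominated convergence asks for a majorant of the difference quotients. Cauchy's
  inequality on circles of radius r/4 about points of the ball of radius r/2 turns the majorant
  \<open>B\<close> of \<open>f\<close> into the majorant 4 B / r of its derivative, so it is enough
  to dominate \<open>f\<close> itself.\<close>

lemma has_field_derivative_integral:
  fixes f :: "'a \<Rightarrow> complex \<Rightarrow> complex"
  assumes r: "r > 0"
    and meas [measurable]: "\<And>z. z \<in> ball z0 r \<Longrightarrow> (\<lambda>t. f t z) \<in> borel_measurable M"
    and holo: "\<And>t. f t holomorphic_on ball z0 r"
    and bound: "\<And>t z. z \<in> ball z0 r \<Longrightarrow> norm (f t z) \<le> B t"
    and B: "integrable M B"
  shows "((\<lambda>z. \<integral>t. f t z \<partial>M) has_field_derivative (\<integral>t. deriv (f t) z0 \<partial>M)) (at z0)"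
proof -
  have lip: "norm ((f t z - f t z0) / (z - z0)) \<le> 4 * B t / r"
    if z: "z \<in> ball z0 (r/2)" "z \<noteq> z0" for t z
  proof -
    have d: "norm (deriv (f t) w) \<le> 4 * B t / r" if w: "w \<in> ball z0 (r/2)" for w
    proof -
      have sub: "cball w (r/4) \<subseteq> ball z0 r"
      proof
        fix v assume "v \<in> cball w (r/4)"
        hence "dist z0 v \<le> dist z0 w + r / 4" using dist_triangle[of z0 v w] by auto
        thus "v \<in> ball z0 r" using w r by auto
      qed
      have "norm ((deriv ^^ 1) (f t) w) \<le> fact 1 * B t / (r/4) ^ 1"
      proof (rule Cauchy_inequality)
        show "f t holomorphic_on ball w (r/4)"
          by (rule holomorphic_on_subset[OF holo]) (use sub in auto)
        show "continuous_on (cball w (r/4)) (f t)"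
          using holomorphic_on_imp_continuous_on[OF holo[of t]] sub continuous_on_subset by blast
        show "norm (f t x) \<le> B t" if "norm (w - x) = r/4" for x
          by (rule bound) (use that sub in \<open>auto simp: dist_norm subset_iff\<close>)
      qed (use r in auto)
      thus ?thesis by (simp add: mult.commute)
    qed
    have "norm (f t z - f t z0) \<le> 4 * B t / r * norm (z - z0)"
    proof (rule field_differentiable_bound[of "ball z0 (r/2)" "f t" "deriv (f t)"])
      fix w assume w: "w \<in> ball z0 (r/2)"
      show "norm (deriv (f t) w) \<le> 4 * B t / r" by (rule d[OF w])
      have "w \<in> ball z0 r" using w r by auto
      thus "(f t has_field_derivative deriv (f t) w) (at w within ball z0 (r/2))"
        using holomorphic_derivI[OF holo[of t]] by (auto intro: has_field_derivative_at_within)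
    qed (use z r in auto)
    thus ?thesis using z(2) by (simp add: norm_divide field_simps)
  qed
  have int: "integrable M (\<lambda>t. f t z)" if "z \<in> ball z0 r" for z
    by (rule Bochner_Integration.integrable_bound[OF B])
       (use bound[OF that] meas[OF that] in \<open>auto intro!: AE_I2 order.trans[OF _ abs_ge_self]\<close>)
  show ?thesis
    unfolding has_field_derivative_iff
  proof (subst tendsto_at_iff_sequentially, safe)
    fix X :: "nat \<Rightarrow> complex"
    assume X: "\<forall>i. X i \<in> UNIV - {z0}" "X \<longlonglongrightarrow> z0"
    hence "eventually (\<lambda>i. dist (X i) z0 < r/2) sequentially"
      by (intro tendstoD) (use r in auto)
    then obtain N where N: "\<And>i. i \<ge> N \<Longrightarrow> X i \<in> ball z0 (r/2)"
      by (auto simp: eventually_sequentially dist_commute)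
    \<comment> \<open>The majorant must hold for every index, so the finitely many terms outside the
      ball of radius r/2 are cut off.\<close>
    define Y where "Y i = X (i + N)" for i
    have Y: "Y i \<in> ball z0 (r/2)" "Y i \<in> ball z0 r" "Y i \<noteq> z0" for i
      using N[of "i+N"] X(1) r by (auto simp: Y_def)
    have Ylim: "Y \<longlonglongrightarrow> z0" unfolding Y_def using X(2) by (rule LIMSEQ_ignore_initial_segment)
    have z0in: "z0 \<in> ball z0 r" using r by auto
    have lim: "(\<lambda>i. (f t (Y i) - f t z0) / (Y i - z0)) \<longlonglongrightarrow> deriv (f t) z0" for t
    proof -
      have "(f t has_field_derivative deriv (f t) z0) (at z0)"
        using holomorphic_derivI[OF holo[of t] _ z0in] by auto
      hence "((\<lambda>z. (f t z - f t z0) / (z - z0)) \<longlongrightarrow> deriv (f t) z0) (at z0)"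
        by (simp add: has_field_derivative_iff)
      thus ?thesis using Y(3) Ylim by (auto simp: tendsto_at_iff_sequentially o_def)
    qed
    have m: "(\<lambda>t. (f t (Y i) - f t z0) / (Y i - z0)) \<in> borel_measurable M" for i
      using meas[OF Y(2)] meas[OF z0in] by measurable
    have "(\<lambda>i. \<integral>t. (f t (Y i) - f t z0) / (Y i - z0) \<partial>M) \<longlonglongrightarrow> (\<integral>t. deriv (f t) z0 \<partial>M)"
    proof (rule integral_dominated_convergence)
      show "(\<lambda>t. deriv (f t) z0) \<in> borel_measurable M"
        by (rule borel_measurable_LIMSEQ_metric[OF m lim])
      show "integrable M (\<lambda>t. 4 * B t / r)" using B by auto
      show "AE t in M. norm ((f t (Y i) - f t z0) / (Y i - z0)) \<le> 4 * B t / r" for i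
        using lip[OF Y(1) Y(3)] by auto
    qed (use m lim in auto)
    also have "(\<lambda>i. \<integral>t. (f t (Y i) - f t z0) / (Y i - z0) \<partial>M) =
        (\<lambda>i. ((\<integral>t. f t (Y i) \<partial>M) - (\<integral>t. f t z0 \<partial>M)) / (Y i - z0))"
      using int[OF Y(2)] int[OF z0in] by auto
    finally have "(\<lambda>i. ((\<lambda>z. ((\<integral>t. f t z \<partial>M) - (\<integral>t. f t z0 \<partial>M)) / (z - z0)) \<circ> X) (i + N))
        \<longlonglongrightarrow> (\<integral>t. deriv (f t) z0 \<partial>M)"
      by (simp add: Y_def o_def)
    thus "((\<lambda>z. ((\<integral>t. f t z \<partial>M) - (\<integral>t. f t z0 \<partial>M)) / (z - z0)) \<circ> X)
        \<longlonglongrightarrow> (\<integral>t. deriv (f t) z0 \<partial>M)"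
      by (rule LIMSEQ_offset)
  qed
qed

section \<open>The Gamma integral on the logarithmic scale\<close>

lemma complex_Gamma_log_integral_1:
  fixes a :: complex
  assumes a: "Re a > 0"
  shows "integrable lborel (\<lambda>\<theta>. exp (a * of_real \<theta> - of_real (exp \<theta>)))"
    and "(\<integral>\<theta>. exp (a * of_real \<theta> - of_real (exp \<theta>)) \<partial>lborel) = Gamma a"
proof -
  let ?f = "\<lambda>t. complex_of_real t powr (a - 1) / complex_of_real (exp t)"
  have eq: "exp \<theta> *\<^sub>R ?f (exp \<theta>) = exp (a * of_real \<theta> - of_real (exp \<theta>))" for \<theta> :: real
  proof -
    have "complex_of_real (exp \<theta>) powr (a - 1) = exp ((a - 1) * of_real \<theta>)"
      using Ln_of_real[of "exp \<theta>"] by (simp add: powr_def)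
    thus ?thesis
      by (simp add: scaleR_conv_of_real exp_diff exp_of_real ring_distribs exp_add)
  qed
  have meas: "(\<lambda>\<theta>. exp \<theta> *\<^sub>R ?f (exp \<theta>)) \<in> borel_measurable borel"
    unfolding eq by (intro borel_measurable_continuous_onI continuous_intros)
  have int: "integrable lborel (\<lambda>\<theta>. exp \<theta> *\<^sub>R ?f (exp \<theta>))"
    using log_substitution(1)[of ?f, OF meas] absolutely_integrable_Gamma_integral'[OF a] by simp
  from int show "integrable lborel (\<lambda>\<theta>. exp (a * of_real \<theta> - of_real (exp \<theta>)))"
    unfolding eq .
  show "(\<integral>\<theta>. exp (a * of_real \<theta> - of_real (exp \<theta>)) \<partial>lborel) = Gamma a"
    using log_substitution(2)[of ?f, OF meas int] Gamma_integral_complex'[OF a]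
    unfolding eq by (simp add: integral_unique)
qed

lemma real_Gamma_log_integral:
  fixes a :: real
  assumes a: "a > 0" and q: "q > 0"
  shows "integrable lborel (\<lambda>\<theta>. exp (a * \<theta> - q * exp \<theta>))"
    and "(\<integral>\<theta>. exp (a * \<theta> - q * exp \<theta>) \<partial>lborel) = Gamma a * q powr (-a)"
proof -
  let ?g = "\<lambda>\<theta>. exp (of_real a * of_real \<theta> - of_real (exp \<theta>) :: complex)"
  have g: "?g \<theta> = of_real (exp (a * \<theta> - exp \<theta>))" for \<theta>
    by (simp add: exp_of_real flip: of_real_diff of_real_mult)
  have i1: "integrable lborel (\<lambda>\<theta>. exp (a * \<theta> - exp \<theta>))"
    using complex_Gamma_log_integral_1(1)[of "of_real a"] a by (simp add: g complex_of_real_integrable_eq)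
  have "complex_of_real (\<integral>\<theta>. exp (a * \<theta> - exp \<theta>) \<partial>lborel) = of_real (Gamma a)"
    using complex_Gamma_log_integral_1(2)[of "of_real a"] a by (simp add: g Gamma_complex_of_real)
  hence i2: "(\<integral>\<theta>. exp (a * \<theta> - exp \<theta>) \<partial>lborel) = Gamma a"
    by (simp only: of_real_eq_iff)
  have shift: "exp (a * (ln q + 1 * \<theta>) - exp (ln q + 1 * \<theta>)) = q powr a * exp (a * \<theta> - q * exp \<theta>)" for \<theta>
    using q by (simp add: exp_add powr_def exp_diff ring_distribs mult.commute)
  show "integrable lborel (\<lambda>\<theta>. exp (a * \<theta> - q * exp \<theta>))"
    using lborel_integrable_real_affine[OF i1, of 1 "ln q"] q unfolding shift by simp
  have "Gamma a = q powr a * (\<integral>\<theta>. exp (a * \<theta> - q * exp \<theta>) \<partial>lborel)"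
    using lborel_integral_real_affine[of 1 "\<lambda>\<theta>. exp (a * \<theta> - exp \<theta>)" "ln q"]
    unfolding shift i2 by simp
  thus "(\<integral>\<theta>. exp (a * \<theta> - q * exp \<theta>) \<partial>lborel) = Gamma a * q powr (-a)"
    using q by (simp add: powr_minus field_simps)
qed

text \<open>For real Q > 0 this is the translation of \<theta> by ln Q. Both sides are holomorphic
  in the right half-plane and agree on the positive real axis, so the identity theorem replaces a
  rotation of the path of integration.\<close>

lemma Gamma_log_integral:
  fixes a :: real and Q :: complex
  assumes a: "a > 0" and Q: "Re Q > 0"
  shows "integrable lborel (\<lambda>\<theta>. exp (of_real (a * \<theta>) - of_real (exp \<theta>) * Q))"
    and "(\<integral>\<theta>. exp (of_real (a * \<theta>) - of_real (exp \<theta>) * Q) \<partial>lborel)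
           = of_real (Gamma a) * Q powr (- of_real a)"
proof -
  have meas: "(\<lambda>\<theta>. exp (of_real (a * \<theta>) - of_real (exp \<theta>) * Q)) \<in> borel_measurable lborel" for Q :: complex
    unfolding measurable_lborel1 measurable_lborel2 by (intro borel_measurable_continuous_onI continuous_intros)
  have int: "integrable lborel (\<lambda>\<theta>. exp (of_real (a * \<theta>) - of_real (exp \<theta>) * Q))"
    if "Re Q > 0" for Q :: complex
    by (rule Bochner_Integration.integrable_bound[OF real_Gamma_log_integral(1)[OF a that] meas])
       (auto simp: mult.commute)
  show "integrable lborel (\<lambda>\<theta>. exp (of_real (a * \<theta>) - of_real (exp \<theta>) * Q))"
    by (rule int[OF Q])
  let ?H = "{z. Re z > 0}"
  define D where "D Q = (\<integral>\<theta>. exp (of_real (a * \<theta>) - of_real (exp \<theta>) * Q) \<partial>lborel)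
           - of_real (Gamma a) * Q powr (- of_real a)" for Q :: complex
  have "(\<lambda>Q. \<integral>\<theta>. exp (of_real (a * \<theta>) - of_real (exp \<theta>) * Q) \<partial>lborel) field_differentiable (at z0)"
    if z0: "Re z0 > 0" for z0 :: complex
  proof -
    have re: "Re z \<ge> Re z0 / 2" if "z \<in> ball z0 (Re z0 / 2)" for z
      using abs_Re_le_cmod[of "z0 - z"] that by (auto simp: dist_norm)
    show ?thesis
      unfolding field_differentiable_def
      by (rule exI, rule has_field_derivative_integral
            [where r = "Re z0 / 2" and B = "\<lambda>\<theta>. exp (a * \<theta> - Re z0 / 2 * exp \<theta>)"])
         (use z0 re real_Gamma_log_integral(1)[OF a, of "Re z0/2"] meas in
          \<open>auto intro!: holomorphic_intros simp: mult.commute\<close>)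
  qed
  hence holo: "D holomorphic_on ?H"
    unfolding D_def
    by (intro holomorphic_intros)
       (auto simp: holomorphic_on_def field_differentiable_at_within complex_nonpos_Reals_iff)
  have "D Q = 0"
  proof (rule analytic_continuation[OF holo, where U = "complex_of_real ` {0<..}" and \<xi> = 1])
    show "open ?H" by (rule open_halfspace_Re_gt)
    show "connected ?H" by (intro convex_connected convex_halfspace_Re_gt)
    show "1 islimpt complex_of_real ` {0<..}"
      unfolding islimpt_sequential
    proof (intro exI[of _ "\<lambda>n. complex_of_real (1 + 1 / real (Suc n))"] conjI allI)
      show "(\<lambda>n. complex_of_real (1 + 1 / real (Suc n))) \<longlonglongrightarrow> 1"
        using tendsto_of_real[OF tendsto_add[OF tendsto_const[of 1] LIMSEQ_inverse_real_of_nat], where ?'a = complex]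
        by (simp add: inverse_eq_divide)
      show "complex_of_real (1 + 1 / real (Suc n)) \<in> complex_of_real ` {0<..} - {1}" for n
        by (intro DiffI imageI) (auto simp: add_pos_nonneg simp flip: of_real_add)
    qed
    fix z assume "z \<in> complex_of_real ` {0<..}"
    then obtain q where q: "z = of_real q" "q > 0" by auto
    have "exp (of_real (a * \<theta>) - of_real (exp \<theta>) * z) = complex_of_real (exp (a * \<theta> - q * exp \<theta>))" for \<theta>
      by (simp add: q exp_of_real mult.commute flip: of_real_diff of_real_mult)
    thus "D z = 0"
      using real_Gamma_log_integral(2)[OF a q(2)] q
      by (simp add: D_def powr_of_real flip: of_real_minus)
  qed (use Q in auto)
  thus "(\<integral>\<theta>. exp (of_real (a * \<theta>) - of_real (exp \<theta>) * Q) \<partial>lborel)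
           = of_real (Gamma a) * Q powr (- of_real a)"
    by (simp add: D_def)
qed

lemma contour_integral_linepath_same_Im:
  assumes "x1 < x2"
  shows "contour_integral (linepath (Complex x1 y) (Complex x2 y)) f = integral {x1..x2} (\<lambda>x. f (Complex x y))"
proof -
  have "contour_integral (linepath (Complex x1 y) (Complex x2 y)) f =
      (Complex x2 y - Complex x1 y) * integral {0..1} (\<lambda>x. f (linepath (Complex x1 y) (Complex x2 y) x))"
    by (simp add: contour_integral_integral)
  also have "Complex x2 y - Complex x1 y = of_real (x2 - x1)"
    by (simp add: complex_eq_iff)
  also have "integral {0..1} (\<lambda>x. f (linepath (Complex x1 y) (Complex x2 y) x)) =
      integral {0..(x2 - x1) / (x2 - x1)} (\<lambda>x. f (Complex (x1 + (x2 - x1) * x) y))"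
    using assms by (intro arg_cong2[where f = integral] ext arg_cong[where f = f])
      (auto simp: linepath_def complex_eq_iff algebra_simps)
  also have "{0..(x2 - x1) / (x2 - x1)} = (\<lambda>x. x / (x2 - x1)) ` {0..x2 - x1}"
    using assms by simp
  also have "integral \<dots> (\<lambda>x. f (Complex (x1 + (x2 - x1) * x) y)) =
      integral {x1 - x1..x2 - x1} (\<lambda>x. f (Complex (x + x1) y)) / of_real (x2 - x1)"
    using assms by (subst integral_stretch_real) (auto simp: scaleR_conv_of_real add_ac)
  also have "\<dots> = integral {x1..x2} (\<lambda>x. f (Complex x y)) / of_real (x2 - x1)"
    by (subst integral_shift_real_ivl) (rule refl)
  finally show ?thesis using assms by simp
qed

lemma integral_expanding_intervals:
  fixes f :: "real \<Rightarrow> complex"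
  assumes "integrable lborel f"
  shows "((\<lambda>X. integral {-X..X} f) \<longlongrightarrow> integral\<^sup>L lborel f) at_top"
proof -
  have m[measurable]: "f \<in> borel_measurable borel" using assms by auto
  have eq: "integral {-X..X} f = (\<integral>x. indicator {-X..X} x *\<^sub>R f x \<partial>lborel)" for X
  proof -
    have "set_integrable lborel {-X..X} f"
      unfolding set_integrable_def by (rule integrable_mult_indicator[OF _ assms]) auto
    from set_borel_integral_eq_integral(2)[OF this] show ?thesis
      by (simp add: set_lebesgue_integral_def)
  qed
  show ?thesis unfolding eq
  proof (rule integral_dominated_convergence_at_top[where w = "\<lambda>x. norm (f x)"])
    show "AE x in lborel. ((\<lambda>X. indicator {-X..X} x *\<^sub>R f x) \<longlongrightarrow> f x) at_top"
    proof (rule AE_I2)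
      fix x :: real
      have "eventually (\<lambda>X. indicator {-X..X} x *\<^sub>R f x = f x) at_top"
        using eventually_ge_at_top[of "\<bar>x\<bar>"] by eventually_elim (auto simp: indicator_def)
      thus "((\<lambda>X. indicator {-X..X} x *\<^sub>R f x) \<longlongrightarrow> f x) at_top" by (rule tendsto_eventually)
    qed
    show "integrable lborel (\<lambda>x. norm (f x))" using assms by auto
    show "\<forall>\<^sub>F X in at_top. AE x in lborel. norm (indicator {-X..X} x *\<^sub>R f x) \<le> norm (f x)"
      by (intro always_eventually allI AE_I2) (auto simp: indicator_def)
  qed auto
qed

section \<open>Contour shifts in strips and uniqueness of Fourier transforms\<close>

text \<open>The residue theorem is applied to the rectangle with vertical sides at -X and X. These
  sides have the fixed length y2 - y1, so together they contribute at most 2 (y2 - y1) B X, which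
  tends to 0. The margins between a, y1 and between y2, b keep the closed rectangle inside the open
  strip.\<close>

lemma strip_residue:
  fixes f :: "complex \<Rightarrow> complex"
  assumes y: "a < y1" "y1 < Im p" "Im p < y2" "y2 < b"
    and holo: "f holomorphic_on {z. a < Im z \<and> Im z < b} - {p}"
    and int: "integrable lborel (\<lambda>x. f (Complex x y1))" "integrable lborel (\<lambda>x. f (Complex x y2))"
    and bound: "\<And>x y. R \<le> \<bar>x\<bar> \<Longrightarrow> y1 \<le> y \<Longrightarrow> y \<le> y2 \<Longrightarrow> norm (f (Complex x y)) \<le> B \<bar>x\<bar>"
    and B: "(B \<longlongrightarrow> 0) at_top"
  shows "(\<integral>x. f (Complex x y1) \<partial>lborel) - (\<integral>x. f (Complex x y2) \<partial>lborel)
           = 2 * pi * \<i> * residue f p"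
proof -
  let ?S = "{z. a < Im z \<and> Im z < b}"
  define H where "H X y = integral {-X..X} (\<lambda>x. f (Complex x y))" for X y
  have oS: "open ?S"
    by (intro open_Collect_conj open_halfspace_Im_gt open_halfspace_Im_lt)
  have cS: "convex ?S"
    using convex_Int[OF convex_halfspace_Im_gt[of a] convex_halfspace_Im_lt[of b]]
    by (simp add: Collect_conj_eq)
  have main: "norm (H X y1 - H X y2 - 2 * pi * \<i> * residue f p) \<le> 2 * (y2 - y1) * B X"
    if X: "X > \<bar>Re p\<bar>" "X \<ge> R" "X > 0" for X
  proof -
    define c1 c2 c3 c4 where "c1 = Complex (-X) y1" and "c2 = Complex X y1"
      and "c3 = Complex X y2" and "c4 = Complex (-X) y2"
    note cs = c1_def c2_def c3_def c4_def
    have rp: "rectpath c1 c3 = linepath c1 c2 +++ linepath c2 c3 +++ linepath c3 c4 +++ linepath c4 c1"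
      by (simp add: rectpath_def Let_def cs)
    have sub: "path_image (rectpath c1 c3) \<subseteq> ?S - {p}"
      using y X by (subst path_image_rectpath) (auto simp: cs)
    have pim: "path_image (rectpath c1 c3) = closed_segment c1 c2 \<union> closed_segment c2 c3 \<union>
        closed_segment c3 c4 \<union> closed_segment c4 c1"
      by (auto simp: rp path_image_join)
    have o: "open (?S - {p})" using oS by auto
    have ci: "f contour_integrable_on linepath u v" if "closed_segment u v \<subseteq> ?S - {p}" for u v
      by (rule contour_integrable_holomorphic_simple[OF holo o]) (use that in auto)
    have cis: "f contour_integrable_on linepath c1 c2" "f contour_integrable_on linepath c2 c3"
      "f contour_integrable_on linepath c3 c4" "f contour_integrable_on linepath c4 c1"
      using sub pim by (auto intro!: ci)
    have "contour_integral (rectpath c1 c3) f =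
        2 * pi * \<i> * (\<Sum>p\<in>{p}. winding_number (rectpath c1 c3) p * residue f p)"
    proof (rule Residue_theorem[OF oS convex_connected[OF cS] _ holo _ _ sub])
      show "\<forall>z. z \<notin> ?S \<longrightarrow> winding_number (rectpath c1 c3) z = 0"
      proof (intro allI impI)
        fix z assume "z \<notin> ?S"
        thus "winding_number (rectpath c1 c3) z = 0"
          by (intro winding_number_zero_outside[OF _ cS]) (use sub in auto)
      qed
    qed auto
    moreover have "winding_number (rectpath c1 c3) p = 1"
      by (rule winding_number_rectpath) (use y X in \<open>auto simp: cs in_box_complex_iff\<close>)
    ultimately have 1: "contour_integral (rectpath c1 c3) f = 2 * pi * \<i> * residue f p" by simp
    have 2: "contour_integral (rectpath c1 c3) f = contour_integral (linepath c1 c2) f +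
       contour_integral (linepath c2 c3) f + contour_integral (linepath c3 c4) f +
       contour_integral (linepath c4 c1) f"
      unfolding rp using cis by (simp add: contour_integrable_join)
    have 3: "contour_integral (linepath c1 c2) f = H X y1"
      unfolding cs H_def by (rule contour_integral_linepath_same_Im) (use X in auto)
    have cont: "continuous_on (closed_segment c3 c4) f"
      by (rule holomorphic_on_imp_continuous_on, rule holomorphic_on_subset[OF holo])
         (use sub pim in blast)
    have 4: "contour_integral (linepath c3 c4) f = - H X y2"
      unfolding contour_integral_reverse_linepath[OF cont] unfolding cs H_def
      by (subst contour_integral_linepath_same_Im) (use X in auto)
    have "norm (f (Complex X y1)) \<le> B \<bar>X\<bar>" by (rule bound) (use X y in auto)
    hence Bnn: "0 \<le> B X" using X norm_ge_zero[of "f (Complex X y1)"] by linarith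
    have seg: "norm (contour_integral (linepath u v) f) \<le> B X * (y2 - y1)"
      if "(u = c2 \<and> v = c3) \<or> (u = c4 \<and> v = c1)" for u v
    proof -
      have hc: "(f has_contour_integral contour_integral (linepath u v) f) (linepath u v)"
        using that cis by (auto intro: has_contour_integral_integral)
      have "norm (contour_integral (linepath u v) f) \<le> B X * norm (v - u)"
      proof (rule has_contour_integral_bound_linepath[OF hc Bnn])
        fix z assume z: "z \<in> closed_segment u v"
        have "\<bar>Re z\<bar> = X \<and> Im z \<in> {y1..y2}"
          using z that y X by (auto simp: closed_segment_same_Re cs closed_segment_eq_real_ivl split: if_splits)
        thus "norm (f z) \<le> B X" using bound[of "Re z" "Im z"] X by auto
      qed
      also have "norm (v - u) = y2 - y1"
        using that y by (auto simp: cs cmod_def)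
      finally show ?thesis .
    qed
    have "H X y1 - H X y2 - 2 * pi * \<i> * residue f p =
        - (contour_integral (linepath c2 c3) f + contour_integral (linepath c4 c1) f)"
      using 1 2 3 4 by (simp add: algebra_simps)
    also have "norm \<dots> \<le> B X * (y2 - y1) + B X * (y2 - y1)"
      unfolding norm_minus_cancel by (intro order.trans[OF norm_triangle_ineq] add_mono seg) auto
    finally show ?thesis by (simp add: algebra_simps)
  qed
  have "((\<lambda>X. H X y1 - H X y2 - 2 * pi * \<i> * residue f p) \<longlongrightarrow> 0) at_top"
  proof (rule Lim_null_comparison)
    show "eventually (\<lambda>X. norm (H X y1 - H X y2 - 2 * pi * \<i> * residue f p) \<le> 2 * (y2 - y1) * B X) at_top"
      using eventually_gt_at_top[of "\<bar>Re p\<bar>"] eventually_ge_at_top[of R] eventually_gt_at_top[of 0]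
      by eventually_elim (rule main)
    show "((\<lambda>X. 2 * (y2 - y1) * B X) \<longlongrightarrow> 0) at_top"
      using tendsto_mult[OF tendsto_const B] by simp
  qed
  moreover have "((\<lambda>X. H X y1 - H X y2 - 2 * pi * \<i> * residue f p) \<longlongrightarrow>
      (\<integral>x. f (Complex x y1) \<partial>lborel) - (\<integral>x. f (Complex x y2) \<partial>lborel) - 2 * pi * \<i> * residue f p) at_top"
    unfolding H_def by (intro tendsto_diff tendsto_const integral_expanding_intervals int)
  ultimately show ?thesis
    using tendsto_unique[OF trivial_limit_at_top_linorder] by fastforce
qed

text \<open>Any point between the lines may play the part of the singularity, since a holomorphic
  function has residue 0 there; the midpoint on the imaginary axis is taken.\<close>

corollary strip_shift:
  fixes f :: "complex \<Rightarrow> complex"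
  assumes y: "a < y1" "y1 < y2" "y2 < b"
    and holo: "f holomorphic_on {z. a < Im z \<and> Im z < b}"
    and int: "integrable lborel (\<lambda>x. f (Complex x y1))" "integrable lborel (\<lambda>x. f (Complex x y2))"
    and bound: "\<And>x y. R \<le> \<bar>x\<bar> \<Longrightarrow> y1 \<le> y \<Longrightarrow> y \<le> y2 \<Longrightarrow> norm (f (Complex x y)) \<le> B \<bar>x\<bar>"
    and B: "(B \<longlongrightarrow> 0) at_top"
  shows "(\<integral>x. f (Complex x y1) \<partial>lborel) = (\<integral>x. f (Complex x y2) \<partial>lborel)"
proof -
  let ?p = "Complex 0 ((y1 + y2) / 2)"
  have "open {z. a < Im z \<and> Im z < b}"
    by (intro open_Collect_conj open_halfspace_Im_gt open_halfspace_Im_lt)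
  hence "residue f ?p = 0"
    by (intro residue_holo[OF _ _ holo]) (use y in auto)
  moreover have "(\<integral>x. f (Complex x y1) \<partial>lborel) - (\<integral>x. f (Complex x y2) \<partial>lborel)
           = 2 * pi * \<i> * residue f ?p"
    by (rule strip_residue[OF _ _ _ _ _ int bound B])
       (use y holo in \<open>auto intro: holomorphic_on_subset\<close>)
  ultimately show ?thesis by simp
qed

text \<open>Levy's uniqueness theorem is about probability measures. The positive and negative parts
  of f have equal transforms, and at frequency 0 this says that they have the same mass c. If c > 0,
  dividing by c gives two distributions with the same characteristic function, hence with densities
  equal almost everywhere; if c = 0, both parts vanish almost everywhere.\<close>

lemma Fourier_unique_real:
  fixes f :: "real \<Rightarrow> real"
  assumes f: "integrable lborel f"
    and zero: "\<And>y. (\<integral>x. iexp (y * x) * of_real (f x) \<partial>lborel) = 0"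
  shows "AE x in lborel. f x = 0"
proof -
  have [measurable]: "f \<in> borel_measurable borel" using f by auto
  define g where "g s x = max (s * f x) 0" for s x
  have gm [measurable]: "g s \<in> borel_measurable borel" for s unfolding g_def by measurable
  have gn: "g s x \<ge> 0" for s x by (simp add: g_def)
  have gi: "integrable lborel (g s)" for s
    unfolding g_def using f by (intro integrable_max) auto
  have fg: "f x = g 1 x - g (-1) x" for x by (simp add: g_def max_def)
  have iexp_int: "integrable lborel (\<lambda>x. iexp (y * x) * of_real (g s x))" for y s
    by (rule Bochner_Integration.integrable_bound[OF gi[of s]])
       (auto simp: norm_mult gn intro!: AE_I2)
  have eq: "(\<integral>x. iexp (y * x) * of_real (g 1 x) \<partial>lborel) = (\<integral>x. iexp (y * x) * of_real (g (-1) x) \<partial>lborel)" for y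
    using zero[of y] iexp_int[of y 1] iexp_int[of y "-1"] by (simp add: fg ring_distribs)
  define c where "c = (\<integral>x. g 1 x \<partial>lborel)"
  have c': "(\<integral>x. g s x \<partial>lborel) = c" if "s \<in> {1,-1}" for s
    using eq[of 0] that by (auto simp: c_def)
  show ?thesis
  proof (cases "c = 0")
    case True
    have "AE x in lborel. g s x = 0" if "s \<in> {1,-1}" for s
      using integral_nonneg_eq_0_iff_AE[OF gi[of s]] gn c'[OF that] True by auto
    from this[of 1] this[of "-1"] show ?thesis by (auto simp: fg)
  next
    case False
    have c: "c > 0" using False integral_nonneg_AE[of "g 1" lborel] gn by (auto simp: c_def less_le)
    define M where "M s = density lborel (\<lambda>x. ennreal (g s x / c))" for s
    have M: "real_distribution (M s)" if "s \<in> {1,-1}" for s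
    proof (intro real_distribution.intro real_distribution_axioms.intro prob_spaceI)
      have "emeasure (M s) (space (M s)) = (\<integral>\<^sup>+x. ennreal (g s x / c) \<partial>lborel)"
        by (simp add: M_def emeasure_density)
      also have "\<dots> = ennreal (\<integral>x. g s x / c \<partial>lborel)"
        by (rule nn_integral_eq_integral) (use gi gn c in auto)
      also have "\<dots> = 1" using c'[OF that] c by simp
      finally show "emeasure (M s) (space (M s)) = 1" .
    qed (simp add: M_def)
    have ch: "char (M s) y = (\<integral>x. iexp (y * x) * of_real (g s x) \<partial>lborel) / c" for s y
    proof -
      have "char (M s) y = (\<integral>x. (g s x / c) *\<^sub>R iexp (y * x) \<partial>lborel)"
        unfolding char_def M_def by (rule integral_density) (use gn c in auto)
      also have "\<dots> = (\<integral>x. iexp (y * x) * of_real (g s x) / c \<partial>lborel)"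
        by (intro Bochner_Integration.integral_cong) (auto simp: scaleR_conv_of_real)
      finally show ?thesis by simp
    qed
    have "char (M 1) = char (M (-1))"
      by (rule ext) (simp only: ch eq)
    hence "M 1 = M (-1)"
      by (intro Levy_uniqueness M) auto
    hence "AE x in lborel. ennreal (g 1 x / c) = ennreal (g (-1) x / c)"
      unfolding M_def by (subst (asm) sigma_finite_measure.density_unique_iff[OF sigma_finite_lborel]) auto
    thus ?thesis
      by eventually_elim (use gn c in \<open>auto simp: fg ennreal_inj\<close>)
  qed
qed

text \<open>Conjugating the hypothesis at frequency -y shows that the transform of
  \<open>cnj f\<close> vanishes as well, which reduces the claim to real and imaginary parts.
  Continuity removes the exceptional null set: the set where f is nonzero is open, and a nonempty
  open set is not negligible.\<close>

lemma Fourier_unique: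
  fixes f :: "real \<Rightarrow> complex"
  assumes f: "integrable lborel f" and cont: "continuous_on UNIV f"
    and zero: "\<And>y. (\<integral>x. iexp (y * x) * f x \<partial>lborel) = 0"
  shows "f x = 0"
proof -
  have i: "integrable lborel (\<lambda>x. iexp (y * x) * f x)" for y
    by (rule Bochner_Integration.integrable_bound[OF f])
       (use f in \<open>auto simp: norm_mult intro!: AE_I2 borel_measurable_times borel_measurable_continuous_onI continuous_intros\<close>)
  have i': "integrable lborel (\<lambda>x. iexp (y * x) * cnj (f x))" for y
    using i[of "-y"] integrable_cnj[of lborel "\<lambda>x. iexp (-y * x) * f x"] by (simp add: exp_cnj)
  have z': "(\<integral>x. iexp (y * x) * cnj (f x) \<partial>lborel) = 0" for y
    using zero[of "-y"] Bochner_Integration.integral_cnj[of lborel "\<lambda>x. iexp (-y * x) * f x"] by (simp add: exp_cnj)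
  have "(\<integral>x. iexp (y * x) * of_real (Re (f x)) \<partial>lborel) = 0" for y
  proof -
    have "(\<integral>x. iexp (y * x) * of_real (Re (f x)) \<partial>lborel) =
       (\<integral>x. (iexp (y * x) * f x + iexp (y * x) * cnj (f x)) / 2 \<partial>lborel)"
      by (intro Bochner_Integration.integral_cong) (auto simp: complex_eq_iff)
    thus ?thesis using i[of y] i'[of y] zero z' by simp
  qed
  hence "AE x in lborel. Re (f x) = 0"
    by (rule Fourier_unique_real[OF integrable_Re[OF f]])
  moreover have "(\<integral>x. iexp (y * x) * of_real (Im (f x)) \<partial>lborel) = 0" for y
  proof -
    have "(\<integral>x. iexp (y * x) * of_real (Im (f x)) \<partial>lborel) =
       (\<integral>x. (iexp (y * x) * f x - iexp (y * x) * cnj (f x)) / (2 * \<i>) \<partial>lborel)"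
    proof (rule Bochner_Integration.integral_cong[OF refl])
      fix x
      have "f x - cnj (f x) = of_real (Im (f x)) * (2 * \<i>)"
        by (auto simp: complex_eq_iff)
      thus "iexp (y * x) * of_real (Im (f x)) = (iexp (y * x) * f x - iexp (y * x) * cnj (f x)) / (2 * \<i>)"
        by (simp flip: right_diff_distrib) (simp add: mult_ac)
    qed
    thus ?thesis using i[of y] i'[of y] zero z' by simp
  qed
  hence "AE x in lborel. Im (f x) = 0"
    by (rule Fourier_unique_real[OF integrable_Im[OF f]])
  ultimately have "AE x in lborel. f x = 0"
    by eventually_elim (auto simp: complex_eq_iff)
  hence "AE x in lebesgue. f x = 0" by (rule AE_completion)
  hence neg: "negligible {x. f x \<noteq> 0}" by (simp add: negligible_iff_null_sets AE_iff_null_sets completion.AE_iff_null_sets)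
  have "open {x. f x \<noteq> 0}"
    using cont by (intro open_Collect_neq continuous_on_const) auto
  hence "{x. f x \<noteq> 0} = {}" using neg open_not_negligible by blast
  thus ?thesis by auto
qed

section \<open>Bessel functions on the logarithmic surface\<close>

text \<open>From w * rGamma (w + 1) = rGamma w the norm cannot grow once |w| \<ge> 1. For k \<ge> K
  this holds at w = k + \<mu> + 1; the indices up to K stay in a fixed disk. Uniformity in \<mu> is
  essential because the order will vary with the argument.\<close>

lemma rGamma_shift_bounded:
  fixes M :: real
  obtains C where "\<And>k \<mu>. norm (\<mu> :: complex) \<le> M \<Longrightarrow> norm (rGamma (of_nat k + \<mu> + 1)) \<le> C"
proof -
  define K where "K = nat \<lceil>\<bar>M\<bar> + 1\<rceil>"
  have K: "real K \<ge> \<bar>M\<bar> + 1" unfolding K_def by linarith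
  have "compact (rGamma ` cball (0::complex) (real K + M + 1))"
    by (intro compact_continuous_image holomorphic_on_imp_continuous_on holomorphic_rGamma compact_cball)
  then obtain C where C: "\<And>w::complex. norm w \<le> real K + M + 1 \<Longrightarrow> norm (rGamma w) \<le> C"
    unfolding bounded_iff using compact_imp_bounded by (fastforce simp: bounded_iff)
  have small: "norm (rGamma (of_nat k + \<mu> + 1)) \<le> C" if "norm \<mu> \<le> M" "k \<le> K" for k and \<mu> :: complex
  proof (rule C)
    have "norm (of_nat k + \<mu> + 1) \<le> real k + norm \<mu> + 1"
      using norm_triangle_ineq[of "of_nat k + \<mu>" 1] norm_triangle_ineq[of "of_nat k" \<mu>] by simp
    thus "norm (of_nat k + \<mu> + 1) \<le> real K + M + 1" using that by linarith
  qed
  have "norm (rGamma (of_nat k + \<mu> + 1)) \<le> C" if \<mu>: "norm \<mu> \<le> M" for k and \<mu> :: complex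
  proof (induction k)
    case 0
    show ?case by (rule small[OF \<mu>]) simp
  next
    case (Suc k)
    show ?case
    proof (cases "k < K")
      case True
      thus ?thesis by (intro small[OF \<mu>]) simp
    next
      case False
      let ?w = "of_nat k + \<mu> + 1"
      have "norm ?w \<ge> Re ?w" by (rule complex_Re_le_cmod)
      moreover have "Re ?w \<ge> real k - norm \<mu> + 1" using abs_Re_le_cmod[of \<mu>] by simp
      moreover have "real k \<ge> real K" using False by simp
      ultimately have w: "norm ?w \<ge> 1" using K \<mu> by linarith
      have "norm (rGamma (?w + 1)) * 1 \<le> norm (rGamma (?w + 1)) * norm ?w"
        by (intro mult_left_mono w) auto
      also have "\<dots> = norm (rGamma ?w)"
        using rGamma_plus1[of ?w] by (metis norm_mult mult.commute)
      finally show ?thesis using Suc.IH by (simp add: add_ac)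
    qed
  qed
  thus ?thesis by (rule that)
qed

definition besselJ_term :: "complex \<Rightarrow> complex \<Rightarrow> nat \<Rightarrow> complex" where
  "besselJ_term \<mu> \<zeta> k = (-1) ^ k * exp ((2 * of_nat k + \<mu>) * (\<zeta> - of_real (ln 2)))
            * rGamma (of_nat k + \<mu> + 1) / of_nat (fact k)"

lemma besselJ_log_eq: "besselJ_log \<mu> \<zeta> = (\<Sum>k. besselJ_term \<mu> \<zeta> k)"
  by (simp add: besselJ_log_def besselJ_term_def)

lemma besselJ_term_bound:
  fixes M R :: real
  obtains C A where "\<And>k \<mu> \<zeta>. norm \<mu> \<le> M \<Longrightarrow> norm \<zeta> \<le> R \<Longrightarrow> norm (besselJ_term \<mu> \<zeta> k) \<le> C * (A ^ k / fact k)"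
proof -
  obtain C where C: "\<And>k \<mu>. norm (\<mu> :: complex) \<le> M \<Longrightarrow> norm (rGamma (of_nat k + \<mu> + 1)) \<le> C"
    using rGamma_shift_bounded by blast
  have "norm (besselJ_term \<mu> \<zeta> k) \<le> (exp (M * (R + 1)) * C) * (exp (2 * (R + 1)) ^ k / fact k)"
    if "norm \<mu> \<le> M" "norm \<zeta> \<le> R" for \<mu> \<zeta> k
  proof -
    have "norm (\<zeta> - of_real (ln 2)) \<le> norm \<zeta> + ln 2"
      using norm_triangle_ineq4[of \<zeta> "of_real (ln 2)"] by (simp add: abs_of_nonneg)
    also have "\<dots> \<le> R + 1" using that ln_2_less_1 by linarith
    finally have 1: "norm (\<zeta> - of_real (ln 2)) \<le> R + 1" .
    have M: "0 \<le> M" using that(1) norm_ge_zero[of \<mu>] by linarith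
    have 2: "norm (2 * of_nat k + \<mu>) \<le> 2 * real k + M"
      using norm_triangle_ineq[of "2 * of_nat k" \<mu>] that by (simp add: norm_mult)
    have "norm (exp ((2 * of_nat k + \<mu>) * (\<zeta> - of_real (ln 2)))) \<le>
        exp (norm ((2 * of_nat k + \<mu>) * (\<zeta> - of_real (ln 2))))"
      by (rule norm_exp)
    also have "\<dots> \<le> exp ((2 * real k + M) * (R + 1))"
      unfolding norm_mult exp_le_cancel_iff by (intro mult_mono 1 2) (use M in auto)
    also have "\<dots> = exp (M * (R + 1)) * exp (2 * (R + 1)) ^ k"
      by (simp add: exp_of_nat_mult[symmetric] exp_add[symmetric] algebra_simps)
    finally have 3: "norm (exp ((2 * of_nat k + \<mu>) * (\<zeta> - of_real (ln 2)))) \<le>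
        exp (M * (R + 1)) * exp (2 * (R + 1)) ^ k" .
    have "norm (besselJ_term \<mu> \<zeta> k) =
       norm (exp ((2 * of_nat k + \<mu>) * (\<zeta> - of_real (ln 2)))) * norm (rGamma (of_nat k + \<mu> + 1)) / fact k"
      by (simp add: besselJ_term_def norm_mult norm_divide norm_power)
    also have "\<dots> \<le> (exp (M * (R + 1)) * exp (2 * (R + 1)) ^ k) * C / fact k"
      by (intro divide_right_mono mult_mono 3 C that) auto
    finally show ?thesis by (simp add: mult_ac)
  qed
  thus ?thesis by (rule that)
qed

lemma summable_exp_series: "summable (\<lambda>k. C * (A ^ k / fact k :: real))"
  by (intro summable_mult) (use summable_exp[of A] in \<open>simp add: field_simps\<close>)

lemma summable_besselJ_term: "summable (besselJ_term \<mu> \<zeta>)"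
proof -
  obtain C A where "\<And>k \<mu>' \<zeta>'. norm \<mu>' \<le> norm \<mu> \<Longrightarrow> norm \<zeta>' \<le> norm \<zeta> \<Longrightarrow>
      norm (besselJ_term \<mu>' \<zeta>' k) \<le> C * (A ^ k / fact k)"
    using besselJ_term_bound[of "norm \<mu>" "norm \<zeta>"] by metis
  thus ?thesis
    by (intro summable_comparison_test'[OF summable_exp_series, where N = 0]) auto
qed

text \<open>The order is an arbitrary entire function of the logarithmic coordinate so that the
  diagonal cases m = exp and m = - exp are both covered. The term bounds are uniform for bounded
  order and coordinate, which gives locally uniform convergence.\<close>

lemma holomorphic_besselJ_log:
  assumes m: "m holomorphic_on UNIV"
  shows "(\<lambda>\<zeta>. besselJ_log (m \<zeta>) \<zeta>) holomorphic_on UNIV"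
proof (rule holomorphic_uniform_sequence[where f = "\<lambda>n \<zeta>. \<Sum>k<n. besselJ_term (m \<zeta>) \<zeta> k"])
  show "(\<lambda>\<zeta>. \<Sum>k<n. besselJ_term (m \<zeta>) \<zeta> k) holomorphic_on UNIV" for n
    unfolding besselJ_term_def by (intro holomorphic_intros m) auto
  show "\<exists>d>0. cball x d \<subseteq> UNIV \<and>
      uniform_limit (cball x d) (\<lambda>n \<zeta>. \<Sum>k<n. besselJ_term (m \<zeta>) \<zeta> k) (\<lambda>\<zeta>. besselJ_log (m \<zeta>) \<zeta>) sequentially" for x
  proof (intro exI[of _ 1] conjI)
    have "compact (m ` cball x 1)"
      by (intro compact_continuous_image compact_cball continuous_on_subset[OF holomorphic_on_imp_continuous_on[OF m]]) auto
    then obtain M where M: "\<And>\<zeta>. \<zeta> \<in> cball x 1 \<Longrightarrow> norm (m \<zeta>) \<le> M"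
      using compact_imp_bounded by (fastforce simp: bounded_iff)
    have R: "norm \<zeta> \<le> norm x + 1" if "\<zeta> \<in> cball x 1" for \<zeta>
      using norm_triangle_ineq2[of \<zeta> x] that by (simp add: dist_norm norm_minus_commute)
    obtain C A where CA: "\<And>k \<mu>' \<zeta>'. norm \<mu>' \<le> M \<Longrightarrow> norm \<zeta>' \<le> norm x + 1 \<Longrightarrow>
        norm (besselJ_term \<mu>' \<zeta>' k) \<le> C * (A ^ k / fact k)"
      using besselJ_term_bound[of M "norm x + 1"] by metis
    show "uniform_limit (cball x 1) (\<lambda>n \<zeta>. \<Sum>k<n. besselJ_term (m \<zeta>) \<zeta> k) (\<lambda>\<zeta>. besselJ_log (m \<zeta>) \<zeta>) sequentially"
      unfolding besselJ_log_eq
    proof (rule Weierstrass_m_test[where M = "\<lambda>k. C * (A ^ k / fact k)"])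
      show "summable (\<lambda>k. C * (A ^ k / fact k))"
        by (rule summable_exp_series)
    qed (use CA M R in auto)
  qed auto
qed auto

lemma besselJ_log_add_i_pi:
  "besselJ_log \<mu> (\<zeta> + \<i> * of_real pi) = exp (\<i> * of_real pi * \<mu>) * besselJ_log \<mu> \<zeta>"
proof -
  have "besselJ_term \<mu> (\<zeta> + \<i> * of_real pi) k = exp (\<i> * of_real pi * \<mu>) * besselJ_term \<mu> \<zeta> k" for k
  proof -
    have "exp ((2 * of_nat k + \<mu>) * (\<zeta> + \<i> * of_real pi - of_real (ln 2))) =
        exp ((2 * of_nat k + \<mu>) * (\<zeta> - of_real (ln 2)) + \<i> * of_real pi * \<mu> + of_int (int k) * (of_real (2 * pi) * \<i>))"
      by (rule arg_cong[where f = exp]) (simp add: algebra_simps)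
    also have "\<dots> = exp (\<i> * of_real pi * \<mu>) * exp ((2 * of_nat k + \<mu>) * (\<zeta> - of_real (ln 2)))"
    proof -
      have "exp (of_int (int k) * (of_real (2 * pi) * \<i>)) = 1"
        by (subst exp_eq_1) (auto intro!: exI[of _ "int k"])
      thus ?thesis unfolding exp_add by simp
    qed
    finally show ?thesis by (simp add: besselJ_term_def mult_ac)
  qed
  hence "besselJ_term \<mu> (\<zeta> + \<i> * of_real pi) = (\<lambda>k. exp (\<i> * of_real pi * \<mu>) * besselJ_term \<mu> \<zeta> k)"
    by (rule ext)
  thus ?thesis unfolding besselJ_log_eq by (simp add: suminf_mult summable_besselJ_term)
qed

text \<open>At order -m the first m terms vanish, because \<open>rGamma\<close> is zero at the
  nonpositive integers; the remaining terms are those of order m moved by m places, each with the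
  sign (-1)^m.\<close>

lemma besselJ_log_minus_nat: "besselJ_log (- of_nat m) \<zeta> = (-1) ^ m * besselJ_log (of_nat m) \<zeta>"
proof -
  have 0: "besselJ_term (- of_nat m) \<zeta> k = 0" if "k < m" for k
  proof -
    have "of_nat k + - of_nat m + 1 = (- of_nat (m - 1 - k) :: complex)"
      using that by (simp add: of_nat_diff Suc_leI)
    thus ?thesis by (simp add: besselJ_term_def rGamma_eq_zero_iff)
  qed
  have 1: "besselJ_term (- of_nat m) \<zeta> (k + m) = (-1) ^ m * besselJ_term (of_nat m) \<zeta> k" for k
  proof -
    have a: "rGamma (of_nat n + 1 :: complex) = 1 / fact n" for n
      using Gamma_fact[of n, where 'a = complex] by (simp add: rGamma_inverse_Gamma add_ac inverse_eq_divide)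
    have "of_nat (k + m) + - of_nat m + 1 = (of_nat k + 1 :: complex)" by simp
    moreover have "of_nat k + of_nat m + 1 = (of_nat (k + m) + 1 :: complex)" by simp
    moreover have "2 * of_nat (k + m) + - of_nat m = (2 * of_nat k + of_nat m :: complex)" by simp
    ultimately show ?thesis
      unfolding besselJ_term_def by (simp only: a power_add) (simp add: mult_ac)
  qed
  have "besselJ_log (- of_nat m) \<zeta> = (\<Sum>k. besselJ_term (- of_nat m) \<zeta> (k + m))"
    unfolding besselJ_log_eq
    using suminf_split_initial_segment[OF summable_besselJ_term[of "- of_nat m" \<zeta>], of m] 0 by simp
  thus ?thesis by (simp add: 1 besselJ_log_eq suminf_mult summable_besselJ_term)
qed

definition Y_num :: "complex \<Rightarrow> complex" where
  "Y_num \<zeta> = besselJ_log (exp \<zeta>) \<zeta> * cos (exp \<zeta> * of_real pi) - besselJ_log (- exp \<zeta>) \<zeta>"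

lemma Y_num_holomorphic: "Y_num holomorphic_on UNIV"
  unfolding Y_num_def by (intro holomorphic_intros holomorphic_besselJ_log)

text \<open>At an integer order the cosine is (-1)^m and \<open>besselJ_log_minus_nat\<close>
  supplies the same sign, so the two terms cancel. Negative integers also occur, since exp \<zeta>
  runs through all nonzero numbers.\<close>

lemma Y_num_eq_0:
  assumes "sin (exp \<zeta> * of_real pi) = 0"
  shows "Y_num \<zeta> = 0"
proof -
  obtain i :: int where i: "exp \<zeta> * of_real pi = of_real (of_int i * pi)"
    using assms by (auto simp: sin_eq_0)
  hence e: "exp \<zeta> = of_int i" by simp
  define m where "m = nat \<bar>i\<bar>"
  have c: "cos (exp \<zeta> * of_real pi) = (-1) ^ m"
  proof -
    have "exp \<zeta> * of_real pi = of_real (of_int i * pi)" by (rule i)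
    also have "cos \<dots> = of_real (cos (of_int i * pi))" by (rule cos_of_real)
    also have "cos (of_int i * pi) = cos (real m * pi)"
      by (cases "i \<ge> 0") (auto simp: m_def)
    also have "\<dots> = (-1) ^ m" by simp
    finally show ?thesis by simp
  qed
  have pm: "(-1) ^ m * ((-1) ^ m :: complex) = 1" by (simp flip: power_mult_distrib)
  show ?thesis
  proof (cases "i \<ge> 0")
    case True
    hence "exp \<zeta> = of_nat m" by (simp add: e m_def)
    thus ?thesis by (simp add: Y_num_def c[unfolded \<open>exp \<zeta> = of_nat m\<close>] besselJ_log_minus_nat)
  next
    case False
    hence "exp \<zeta> = - of_nat m" by (simp add: e m_def)
    thus ?thesis using c pm by (simp add: Y_num_def besselJ_log_minus_nat mult_ac)
  qed
qed

lemma Y_diag_regular: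
  assumes "sin (exp \<zeta> * of_real pi) \<noteq> 0"
  shows "Y_diag \<zeta> = Y_num \<zeta> / sin (exp \<zeta> * of_real pi)"
proof -
  have "isCont Y_num \<zeta>"
    using holomorphic_on_imp_continuous_on[OF Y_num_holomorphic] by (simp add: continuous_on_eq_continuous_at)
  hence "isCont (\<lambda>\<zeta>. Y_num \<zeta> / sin (exp \<zeta> * of_real pi)) \<zeta>"
    using assms by (intro continuous_intros) auto
  hence "((\<lambda>\<zeta>. Y_num \<zeta> / sin (exp \<zeta> * of_real pi)) \<longlongrightarrow> Y_num \<zeta> / sin (exp \<zeta> * of_real pi)) (at \<zeta>)"
    by (rule isContD)
  hence "(Y_raw \<longlongrightarrow> Y_num \<zeta> / sin (exp \<zeta> * of_real pi)) (at \<zeta>)"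
    by (simp add: Y_raw_def[abs_def] Y_num_def)
  thus ?thesis unfolding Y_diag_def by (intro tendsto_Lim) auto
qed

text \<open>All zeros of the denominator are simple: its derivative is \<pi> exp z cos (\<pi> exp
  z), where exp z never vanishes and the cosine is nonzero wherever the sine is zero. As the
  numerator vanishes there too, the quotient has a finite limit at every point, and the pointwise
  limits in \<open>Y_diag\<close> are exactly the values given by
  \<open>remove_sings\<close>.\<close>

lemma Y_diag_holomorphic: "Y_diag holomorphic_on UNIV"
proof -
  define s where "s \<zeta> = sin (exp \<zeta> * complex_of_real pi)" for \<zeta>
  have sh: "s holomorphic_on UNIV" unfolding s_def by (intro holomorphic_intros)
  have raw: "Y_raw = (\<lambda>\<zeta>. Y_num \<zeta> / s \<zeta>)"
    by (simp add: fun_eq_iff Y_raw_def Y_num_def s_def)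
  have "\<exists>c. isolated_singularity_at Y_raw z \<and> Y_raw \<midarrow>z\<rightarrow> c" for z
  proof -
    have nd: "(Y_num has_field_derivative deriv Y_num z) (at z)"
      using holomorphic_derivI[OF Y_num_holomorphic] by auto
    have sd: "(s has_field_derivative (cos (exp z * of_real pi) * (exp z * of_real pi))) (at z)"
      unfolding s_def by (auto intro!: derivative_eq_intros)
    have ev: "\<exists>c. eventually (\<lambda>w. s w \<noteq> 0) (at z) \<and> Y_raw \<midarrow>z\<rightarrow> c"
    proof (cases "s z = 0")
      case True
      hence n0: "Y_num z = 0" using Y_num_eq_0 by (simp add: s_def)
      have d0: "cos (exp z * of_real pi) * (exp z * of_real pi) \<noteq> 0"
        using True sin_cos_squared_add[of "exp z * complex_of_real pi"] by (auto simp: s_def)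
      have l1: "((\<lambda>w. Y_num w / (w - z)) \<longlongrightarrow> deriv Y_num z) (at z)"
        using nd by (simp add: has_field_derivative_iff n0)
      have l2: "((\<lambda>w. s w / (w - z)) \<longlongrightarrow> cos (exp z * of_real pi) * (exp z * of_real pi)) (at z)"
        using sd by (simp add: has_field_derivative_iff True)
      have ne: "eventually (\<lambda>w. s w \<noteq> 0) (at z)"
        using tendsto_imp_eventually_ne[OF l2 d0] by eventually_elim auto
      have "((\<lambda>w. (Y_num w / (w - z)) / (s w / (w - z))) \<longlongrightarrow>
          deriv Y_num z / (cos (exp z * of_real pi) * (exp z * of_real pi))) (at z)"
        by (intro tendsto_divide l1 l2 d0)
      moreover have "eventually (\<lambda>w. (Y_num w / (w - z)) / (s w / (w - z)) = Y_raw w) (at z)"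
        using eventually_neq_at_within[of z z UNIV] by eventually_elim (auto simp: raw)
      ultimately have "(Y_raw \<longlongrightarrow> deriv Y_num z / (cos (exp z * of_real pi) * (exp z * of_real pi))) (at z)"
        using Lim_transform_eventually by blast
      with ne show ?thesis by blast
    next
      case False
      have cs: "(s \<longlongrightarrow> s z) (at z)" using DERIV_isCont[OF sd] by (simp add: isCont_def)
      have cn: "(Y_num \<longlongrightarrow> Y_num z) (at z)" using DERIV_isCont[OF nd] by (simp add: isCont_def)
      have "(Y_raw \<longlongrightarrow> Y_num z / s z) (at z)"
        unfolding raw by (intro tendsto_divide cs cn False)
      moreover have "eventually (\<lambda>w. s w \<noteq> 0) (at z)"
        by (rule tendsto_imp_eventually_ne[OF cs False])
      ultimately show ?thesis by blast
    qed
    then obtain c where c: "eventually (\<lambda>w. s w \<noteq> 0) (at z)" "Y_raw \<midarrow>z\<rightarrow> c" by blast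
    obtain r where r: "r > 0" "\<And>w. w \<in> ball z r - {z} \<Longrightarrow> s w \<noteq> 0"
      using c(1) by (auto simp: eventually_at dist_commute)
    have "Y_raw holomorphic_on ball z r - {z}"
      unfolding raw using r(2)
      by (intro holomorphic_intros holomorphic_on_subset[OF Y_num_holomorphic] holomorphic_on_subset[OF sh]) auto
    hence "Y_raw analytic_on ball z r - {z}"
      by (subst analytic_on_open) auto
    with r(1) c(2) show ?thesis unfolding isolated_singularity_at_def by blast
  qed
  then obtain c where c: "\<And>z. isolated_singularity_at Y_raw z" "\<And>z. Y_raw \<midarrow>z\<rightarrow> c z" by metis
  have "Y_diag = remove_sings Y_raw"
    using c(2) by (auto simp: fun_eq_iff Y_diag_def remove_sings_def)
  moreover have "remove_sings Y_raw analytic_on {z}" for z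
    by (rule remove_sings_analytic_at[OF c])
  ultimately have "Y_diag analytic_on UNIV"
    using analytic_on_analytic_at by metis
  thus ?thesis by (rule analytic_imp_holomorphic)
qed

lemma J_diag_holomorphic: "J_diag holomorphic_on UNIV"
  unfolding J_diag_def by (intro holomorphic_besselJ_log holomorphic_intros)

lemma H1_diag_holomorphic: "H1_diag holomorphic_on UNIV"
  unfolding H1_diag_def by (intro holomorphic_intros J_diag_holomorphic Y_diag_holomorphic)

lemma H2_diag_holomorphic: "H2_diag holomorphic_on UNIV"
  unfolding H2_diag_def by (intro holomorphic_intros J_diag_holomorphic Y_diag_holomorphic)

lemma H1_diag_regular:
  assumes "sin (exp \<zeta> * of_real pi) \<noteq> 0"
  shows "\<i> * H1_diag \<zeta> = (besselJ_log (- exp \<zeta>) \<zeta> - exp (- \<i> * of_real pi * exp \<zeta>) * besselJ_log (exp \<zeta>) \<zeta>)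
           / sin (exp \<zeta> * of_real pi)"
proof -
  let ?x = "exp \<zeta> * complex_of_real pi"
  have "exp (- \<i> * of_real pi * exp \<zeta>) = exp (\<i> * (- ?x))" by (simp add: mult_ac)
  also have "\<dots> = cos ?x - \<i> * sin ?x" by (subst exp_Euler) simp
  finally have e: "exp (- \<i> * of_real pi * exp \<zeta>) = cos ?x - \<i> * sin ?x" .
  show ?thesis
    unfolding e H1_diag_def J_diag_def Y_diag_regular[OF assms] Y_num_def
    using assms by (simp add: field_simps)
qed

text \<open>Adding i \<pi> to \<zeta> turns \<nu> into -\<nu> both as order and as argument, which
  exchanges the two series in the formula for H1; \<open>besselJ_log_add_i_pi\<close> supplies the
  exponential factors. The points with vanishing sine follow from the identity theorem, as both
  sides are entire.\<close>

lemma H2_diag_eq: "H2_diag \<zeta> = - H1_diag (\<zeta> + \<i> * of_real pi)"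
proof -
  let ?s = "\<lambda>\<zeta>. sin (exp \<zeta> * complex_of_real pi)"
  have ex: "exp (\<zeta> + \<i> * of_real pi) = - exp \<zeta>" for \<zeta> by (simp add: exp_add)
  have reg: "H2_diag \<zeta> + H1_diag (\<zeta> + \<i> * of_real pi) = 0" if s: "?s \<zeta> \<noteq> 0" for \<zeta>
  proof -
    let ?x = "exp \<zeta> * complex_of_real pi"
    have s': "?s (\<zeta> + \<i> * of_real pi) \<noteq> 0" using s by (simp add: ex)
    have p: "exp (\<i> * of_real pi * exp \<zeta>) = cos ?x + \<i> * sin ?x"
      using exp_Euler[of ?x] by (simp add: mult_ac)
    have "exp (\<i> * of_real pi * - exp \<zeta>) = exp (\<i> * (- ?x))" by (simp add: mult_ac)
    also have "\<dots> = cos ?x - \<i> * sin ?x" by (subst exp_Euler) simp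
    finally have m: "exp (\<i> * of_real pi * - exp \<zeta>) = cos ?x - \<i> * sin ?x" .
    have "\<i> * H1_diag (\<zeta> + \<i> * of_real pi) =
        (exp (\<i> * of_real pi * exp \<zeta>) * besselJ_log (exp \<zeta>) \<zeta> -
         exp (\<i> * of_real pi * exp \<zeta>) * (exp (\<i> * of_real pi * - exp \<zeta>) * besselJ_log (- exp \<zeta>) \<zeta>)) / (- ?s \<zeta>)"
      unfolding H1_diag_regular[OF s'] unfolding ex besselJ_log_add_i_pi by simp
    also have "\<dots> = - \<i> * H2_diag \<zeta>"
    proof -
      have "(cos ?x + \<i> * sin ?x) * (cos ?x - \<i> * sin ?x) = 1"
        using sin_cos_squared_add[of ?x] by (simp add: algebra_simps power2_eq_square)
      hence "exp (\<i> * of_real pi * exp \<zeta>) * (exp (\<i> * of_real pi * - exp \<zeta>) * besselJ_log (- exp \<zeta>) \<zeta>)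
          = besselJ_log (- exp \<zeta>) \<zeta>"
        unfolding p m by (simp add: mult.assoc[symmetric])
      thus ?thesis
        unfolding p H2_diag_def J_diag_def Y_diag_regular[OF s] Y_num_def
        using s by (simp add: field_simps)
    qed
    finally have "\<i> * (H2_diag \<zeta> + H1_diag (\<zeta> + \<i> * of_real pi)) = 0" by (simp add: distrib_left)
    thus ?thesis by simp
  qed
  have holo: "(\<lambda>\<zeta>. H2_diag \<zeta> + H1_diag (\<zeta> + \<i> * of_real pi)) holomorphic_on UNIV"
    by (intro holomorphic_intros H2_diag_holomorphic
          holomorphic_on_compose_gen[OF _ H1_diag_holomorphic, unfolded o_def]) auto
  have op: "open {\<zeta>. ?s \<zeta> \<noteq> 0}"
    by (intro open_Collect_neq continuous_intros)
  \<comment> \<open>This is \<nu> = 1/2, where the sine equals 1; it shows that the open set of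
    regular points is not empty.\<close>
  have ne: "?s (of_real (- ln 2)) \<noteq> 0"
  proof -
    have "?s (of_real (- ln 2)) = of_real (sin (pi / 2))"
      by (simp add: exp_minus exp_of_real inverse_eq_divide flip: sin_of_real)
    thus ?thesis by simp
  qed
  have "H2_diag \<zeta> + H1_diag (\<zeta> + \<i> * of_real pi) = 0"
    by (rule analytic_continuation_open[OF op, of UNIV _ "\<lambda>_. 0"])
       (use ne holo reg in \<open>auto intro!: holomorphic_intros\<close>)
  thus ?thesis by (simp add: add_eq_0_iff)
qed

section \<open>The Macdonald function of imaginary order\<close>

text \<open>In terms of the Macdonald function \<open>K\<close> this is \<open>2 z\<^bsup>\<nu>/2\<^esup> K\<^sub>\<nu>(2 \<surd>z)\<close>.\<close>
definition macdonald :: "complex \<Rightarrow> complex \<Rightarrow> complex" where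
  "macdonald \<nu> z = (\<integral>\<tau>. exp (\<nu> * of_real \<tau> - of_real (exp \<tau>) - z * of_real (exp (- \<tau>))) \<partial>lborel)"

text \<open>Each summand keeps only one of the two decaying exponentials and is a Gamma integrand in
  \<tau> or in -\<tau>. The first is the majorant for \<tau> \<ge> 0, the second for \<tau> < 0; the
  exponent |s| + 1 makes both converge for every s.\<close>

definition macdonald_bound :: "real \<Rightarrow> real \<Rightarrow> real \<Rightarrow> real" where
  "macdonald_bound s x \<tau> = exp ((\<bar>s\<bar> + 1) * \<tau> - exp \<tau>) + exp (- (\<bar>s\<bar> + 1) * \<tau> - x * exp (- \<tau>))"

lemma macdonald_bound_integrable:
  assumes "x > 0"
  shows "integrable lborel (macdonald_bound s x)"
proof -
  have 1: "integrable lborel (\<lambda>\<tau>. exp ((\<bar>s\<bar> + 1) * \<tau> - 1 * exp \<tau>))"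
    by (rule real_Gamma_log_integral) auto
  have "integrable lborel (\<lambda>\<tau>. exp ((\<bar>s\<bar> + 1) * \<tau> - x * exp \<tau>))"
    by (rule real_Gamma_log_integral) (use assms in auto)
  from lborel_integrable_real_affine[OF this, of "-1" 0]
  have 2: "integrable lborel (\<lambda>\<tau>. exp (- (\<bar>s\<bar> + 1) * \<tau> - x * exp (- \<tau>)))"
    by (simp add: algebra_simps)
  show ?thesis unfolding macdonald_bound_def using 1 2 by (intro Bochner_Integration.integrable_add) auto
qed

lemma macdonald_integrand_le:
  assumes "x > 0" "Re z \<ge> x"
  shows "norm (exp (\<nu> * of_real \<tau> - of_real (exp \<tau>) - z * of_real (exp (- \<tau>)))) \<le> macdonald_bound (Re \<nu>) x \<tau>"
proof -
  have "Re \<nu> * \<tau> - exp \<tau> - Re z * exp (- \<tau>) \<le> Re \<nu> * \<tau> - exp \<tau> - x * exp (- \<tau>)"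
    using assms by (auto intro: mult_right_mono)
  hence "norm (exp (\<nu> * of_real \<tau> - of_real (exp \<tau>) - z * of_real (exp (- \<tau>)))) \<le> exp (Re \<nu> * \<tau> - exp \<tau> - x * exp (- \<tau>))"
    by simp
  also have "\<dots> \<le> macdonald_bound (Re \<nu>) x \<tau>"
  proof (cases "\<tau> \<ge> 0")
    case True
    have "Re \<nu> * \<tau> \<le> (\<bar>Re \<nu>\<bar> + 1) * \<tau>" using True by (intro mult_right_mono) auto
    moreover have "x * exp (-\<tau>) \<ge> 0" using assms by simp
    ultimately have "exp (Re \<nu> * \<tau> - exp \<tau> - x * exp (- \<tau>)) \<le> exp ((\<bar>Re \<nu>\<bar> + 1) * \<tau> - exp \<tau>)" by simp
    thus ?thesis unfolding macdonald_bound_def using exp_ge_zero[of "- (\<bar>Re \<nu>\<bar> + 1) * \<tau> - x * exp (- \<tau>)"] by linarith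
  next
    case False
    have "Re \<nu> * \<tau> \<le> (- (\<bar>Re \<nu>\<bar> + 1)) * \<tau>" using False by (intro mult_right_mono_neg) auto
    moreover have "exp \<tau> \<ge> 0" by simp
    ultimately have "exp (Re \<nu> * \<tau> - exp \<tau> - x * exp (- \<tau>)) \<le> exp ((- (\<bar>Re \<nu>\<bar> + 1)) * \<tau> - x * exp (- \<tau>))"
      unfolding exp_le_cancel_iff by linarith
    thus ?thesis unfolding macdonald_bound_def using exp_ge_zero[of "(\<bar>Re \<nu>\<bar> + 1) * \<tau> - exp \<tau>"] by linarith
  qed
  finally show ?thesis .
qed

lemma macdonald_integrable:
  assumes "Re z > 0"
  shows "integrable lborel (\<lambda>\<tau>. exp (\<nu> * of_real \<tau> - of_real (exp \<tau>) - z * of_real (exp (- \<tau>))))"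
  by (rule Bochner_Integration.integrable_bound[OF macdonald_bound_integrable[OF assms]])
     (use macdonald_integrand_le[OF assms order.refl] in
      \<open>auto intro!: borel_measurable_continuous_onI continuous_intros AE_I2 order.trans[OF _ abs_ge_self]\<close>)

lemma macdonald_has_field_derivative:
  assumes z0: "Re z0 > 0"
  shows "(macdonald \<nu> has_field_derivative - macdonald (\<nu> - 1) z0) (at z0)"
proof -
  define f where "f \<tau> z = exp (\<nu> * of_real \<tau> - of_real (exp \<tau>) - z * of_real (exp (- \<tau>)))" for \<tau> :: real and z :: complex
  have re: "Re z \<ge> Re z0 / 2" if "z \<in> ball z0 (Re z0 / 2)" for z
    using abs_Re_le_cmod[of "z0 - z"] that by (auto simp: dist_norm)
  have "((\<lambda>z. \<integral>\<tau>. f \<tau> z \<partial>lborel) has_field_derivative (\<integral>\<tau>. deriv (f \<tau>) z0 \<partial>lborel)) (at z0)"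
  proof (rule has_field_derivative_integral)
    show "0 < Re z0 / 2" using z0 by simp
    show "integrable lborel (macdonald_bound (Re \<nu>) (Re z0 / 2))"
      by (rule macdonald_bound_integrable) (use z0 in simp)
    show "norm (f \<tau> z) \<le> macdonald_bound (Re \<nu>) (Re z0 / 2) \<tau>" if "z \<in> ball z0 (Re z0 / 2)" for \<tau> z
      unfolding f_def by (rule macdonald_integrand_le) (use z0 re[OF that] in auto)
    show "f \<tau> holomorphic_on ball z0 (Re z0 / 2)" for \<tau>
      unfolding f_def by (intro holomorphic_intros)
    show "(\<lambda>\<tau>. f \<tau> z) \<in> borel_measurable lborel" for z
      unfolding f_def measurable_lborel2 by (intro borel_measurable_continuous_onI continuous_intros)
  qed
  moreover have "deriv (f \<tau>) z0 = - exp ((\<nu> - 1) * of_real \<tau> - of_real (exp \<tau>) - z0 * of_real (exp (- \<tau>)))" for \<tau>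
  proof -
    have "(f \<tau> has_field_derivative (- of_real (exp (- \<tau>)) * f \<tau> z0)) (at z0)"
      unfolding f_def by (auto intro!: derivative_eq_intros)
    hence "deriv (f \<tau>) z0 = - (of_real (exp (- \<tau>)) * f \<tau> z0)" by (simp add: DERIV_imp_deriv)
    also have "of_real (exp (- \<tau>)) * f \<tau> z0 = exp ((\<nu> - 1) * of_real \<tau> - of_real (exp \<tau>) - z0 * of_real (exp (- \<tau>)))"
      unfolding f_def exp_of_real[symmetric] exp_add[symmetric] by (simp add: algebra_simps)
    finally show ?thesis by simp
  qed
  ultimately show ?thesis by (simp add: macdonald_def[abs_def] f_def)
qed

text \<open>Integration by parts: the integrand tends to 0 at both ends of the line, so its
  \<tau>-derivative has integral 0, and that derivative combines the integrands of orders \<nu>,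
  \<nu> + 1 and \<nu> - 1.\<close>

lemma macdonald_recurrence:
  assumes x: "x > 0"
  shows "macdonald (\<nu> + 1) (of_real x) = \<nu> * macdonald \<nu> (of_real x) + of_real x * macdonald (\<nu> - 1) (of_real x)"
proof -
  define h where "h \<mu> \<tau> = exp (\<mu> * of_real \<tau> - of_real (exp \<tau>) - of_real x * of_real (exp (- \<tau>)))" for \<mu> :: complex and \<tau> :: real
  define h' where "h' \<tau> = \<nu> * h \<nu> \<tau> - h (\<nu> + 1) \<tau> + of_real x * h (\<nu> - 1) \<tau>" for \<tau>
  have hi: "integrable lborel (h \<mu>)" for \<mu>
    unfolding h_def by (rule macdonald_integrable) (use x in auto)
  have h'i: "integrable lborel h'"
    unfolding h'_def using hi by auto
  have d: "(h \<nu> has_vector_derivative h' \<tau>) (at \<tau> within A)" for \<tau> A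
  proof -
    have e1: "h (\<nu> + 1) \<tau> = of_real (exp \<tau>) * h \<nu> \<tau>"
      unfolding h_def exp_of_real[symmetric] exp_add[symmetric] by (simp add: algebra_simps)
    have e2: "h (\<nu> - 1) \<tau> = of_real (exp (- \<tau>)) * h \<nu> \<tau>"
      unfolding h_def exp_of_real[symmetric] exp_add[symmetric] by (simp add: algebra_simps)
    have "((\<lambda>w. exp (\<nu> * w - exp w - of_real x * exp (- w))) has_field_derivative
        (\<nu> - exp (of_real \<tau>) + of_real x * exp (- of_real \<tau>)) * h \<nu> \<tau>) (at (of_real \<tau>))"
      unfolding h_def by (auto intro!: derivative_eq_intros simp: exp_of_real[symmetric])
    from has_vector_derivative_real_field[OF this]
    have "((\<lambda>\<tau>. exp (\<nu> * of_real \<tau> - exp (of_real \<tau>) - of_real x * exp (- of_real \<tau>))) has_vector_derivative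
        (\<nu> - exp (of_real \<tau>) + of_real x * exp (- of_real \<tau>)) * h \<nu> \<tau>) (at \<tau> within A)" .
    moreover have "(\<lambda>\<tau>. exp (\<nu> * of_real \<tau> - exp (of_real \<tau>) - of_real x * exp (- of_real \<tau>))) = h \<nu>"
      by (simp add: h_def fun_eq_iff exp_of_real[symmetric])
    moreover have "(\<nu> - exp (of_real \<tau>) + of_real x * exp (- of_real \<tau>)) * h \<nu> \<tau> = h' \<tau>"
      unfolding h'_def e1 e2 by (simp add: algebra_simps exp_of_real[symmetric])
    ultimately show ?thesis by simp
  qed
  have "((\<lambda>X. integral {-X..X} h') \<longlongrightarrow> integral\<^sup>L lborel h') at_top"
    by (rule integral_expanding_intervals[OF h'i])
  moreover have "((\<lambda>X. integral {-X..X} h') \<longlongrightarrow> 0) at_top"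
  proof (rule Lim_transform_eventually)
    show "eventually (\<lambda>X. h \<nu> X - h \<nu> (- X) = integral {-X..X} h') at_top"
      using eventually_ge_at_top[of 0]
    proof eventually_elim
      case (elim X)
      have "(h' has_integral (h \<nu> X - h \<nu> (-X))) {-X..X}"
        by (rule fundamental_theorem_of_calculus) (use elim d in auto)
      thus ?case by (simp add: integral_unique)
    qed
    have n: "norm (h \<nu> \<tau>) = exp (Re \<nu> * \<tau> - exp \<tau> - x * exp (- \<tau>))" for \<tau>
      by (simp add: h_def)
    have "((\<lambda>X. h \<nu> X) \<longlongrightarrow> 0) at_top"
      by (rule tendsto_norm_zero_cancel, unfold n) (use x in real_asymp)
    moreover have "((\<lambda>X. h \<nu> (-X)) \<longlongrightarrow> 0) at_top"
      by (rule tendsto_norm_zero_cancel, unfold n) (use x in real_asymp)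
    ultimately show "((\<lambda>X. h \<nu> X - h \<nu> (- X)) \<longlongrightarrow> 0) at_top"
      using tendsto_diff by fastforce
  qed
  ultimately have "integral\<^sup>L lborel h' = 0"
    using tendsto_unique[OF trivial_limit_at_top_linorder] by blast
  moreover have "integral\<^sup>L lborel h' = \<nu> * macdonald \<nu> (of_real x) - macdonald (\<nu> + 1) (of_real x)
      + of_real x * macdonald (\<nu> - 1) (of_real x)"
  proof -
    have "macdonald \<mu> (of_real x) = (\<integral>\<tau>. h \<mu> \<tau> \<partial>lborel)" for \<mu>
      by (simp add: macdonald_def h_def)
    thus ?thesis unfolding h'_def using hi by simp
  qed
  ultimately show ?thesis by (simp add: algebra_simps add_eq_0_iff)
qed

text \<open>The substitution of ln x - \<tau> for \<tau> exchanges exp \<tau> and x exp (-\<tau>).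
  In classical terms this is the evenness of K in its order.\<close>

lemma macdonald_reflect:
  assumes x: "x > 0"
  shows "macdonald \<nu> (of_real x) = exp (\<nu> * of_real (ln x)) * macdonald (- \<nu>) (of_real x)"
proof -
  have "macdonald \<nu> (of_real x) = (\<integral>\<tau>. exp (\<nu> * of_real (ln x + (-1) * \<tau>) - of_real (exp (ln x + (-1) * \<tau>))
      - of_real x * of_real (exp (- (ln x + (-1) * \<tau>)))) \<partial>lborel)"
    unfolding macdonald_def by (subst lborel_integral_real_affine[where c = "-1" and t = "ln x"]) auto
  also have "\<dots> = (\<integral>\<tau>. exp (\<nu> * of_real (ln x)) * exp (- \<nu> * of_real \<tau> - of_real (exp \<tau>) - of_real x * of_real (exp (- \<tau>))) \<partial>lborel)"
  proof (intro Bochner_Integration.integral_cong refl)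
    fix \<tau> :: real
    have "exp (ln x + (-1) * \<tau>) = x * exp (- \<tau>)" "x * exp (- (ln x + (-1) * \<tau>)) = exp \<tau>"
      using x by (simp_all add: exp_diff exp_add exp_minus field_simps)
    thus "exp (\<nu> * of_real (ln x + (-1) * \<tau>) - of_real (exp (ln x + (-1) * \<tau>))
        - of_real x * of_real (exp (- (ln x + (-1) * \<tau>)))) = exp (\<nu> * of_real (ln x)) * exp (- \<nu> * of_real \<tau> - of_real (exp \<tau>) - of_real x * of_real (exp (- \<tau>)))"
      unfolding exp_add[symmetric] of_real_mult[symmetric] by (simp add: algebra_simps)
  qed
  finally show ?thesis by (simp add: macdonald_def)
qed

lemma macdonald_tendsto_Gamma:
  assumes \<nu>: "Re \<nu> > 0"
  shows "((\<lambda>x. macdonald \<nu> (of_real x)) \<longlongrightarrow> Gamma \<nu>) (at_right 0)"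
proof (subst tendsto_at_iff_sequentially, intro allI impI)
  fix X :: "nat \<Rightarrow> real"
  assume X: "\<forall>i. X i \<in> {0<..} - {0}" "X \<longlonglongrightarrow> 0"
  have m: "(\<lambda>\<tau>. exp (\<nu> * of_real \<tau> - of_real (exp \<tau>) - z * of_real (exp (- \<tau>)))) \<in> borel_measurable lborel" for z
    unfolding measurable_lborel2 by (intro borel_measurable_continuous_onI continuous_intros)
  have "(\<lambda>i. \<integral>\<tau>. exp (\<nu> * of_real \<tau> - of_real (exp \<tau>) - of_real (X i) * of_real (exp (- \<tau>))) \<partial>lborel)
     \<longlonglongrightarrow> (\<integral>\<tau>. exp (\<nu> * of_real \<tau> - of_real (exp \<tau>)) \<partial>lborel)"
  proof (rule integral_dominated_convergence[where w = "\<lambda>\<tau>. exp (Re \<nu> * \<tau> - 1 * exp \<tau>)"])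
    show "integrable lborel (\<lambda>\<tau>. exp (Re \<nu> * \<tau> - 1 * exp \<tau>))"
      by (rule real_Gamma_log_integral) (use \<nu> in auto)
    show "AE \<tau> in lborel. (\<lambda>i. exp (\<nu> * of_real \<tau> - of_real (exp \<tau>) - of_real (X i) * of_real (exp (- \<tau>))))
       \<longlonglongrightarrow> exp (\<nu> * of_real \<tau> - of_real (exp \<tau>))"
    proof (rule AE_I2)
      fix \<tau> :: real
      have "(\<lambda>i. exp (\<nu> * of_real \<tau> - of_real (exp \<tau>) - complex_of_real (X i) * of_real (exp (- \<tau>))))
       \<longlonglongrightarrow> exp (\<nu> * of_real \<tau> - of_real (exp \<tau>) - complex_of_real 0 * of_real (exp (- \<tau>)))"
        by (intro tendsto_intros X)
      thus "(\<lambda>i. exp (\<nu> * of_real \<tau> - of_real (exp \<tau>) - of_real (X i) * of_real (exp (- \<tau>))))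
       \<longlonglongrightarrow> exp (\<nu> * of_real \<tau> - of_real (exp \<tau>))" by simp
    qed
    show "AE \<tau> in lborel. norm (exp (\<nu> * of_real \<tau> - of_real (exp \<tau>) - of_real (X i) * of_real (exp (- \<tau>)))) \<le>
        exp (Re \<nu> * \<tau> - 1 * exp \<tau>)" for i
      using X(1) by (intro AE_I2) (auto intro!: mult_nonneg_nonneg less_imp_le)
    show "(\<lambda>\<tau>. exp (\<nu> * of_real \<tau> - of_real (exp \<tau>))) \<in> borel_measurable lborel"
      using m[of 0] by simp
  qed (use m in auto)
  thus "((\<lambda>x. macdonald \<nu> (of_real x)) \<circ> X) \<longlonglongrightarrow> Gamma \<nu>"
    by (simp add: macdonald_def o_def complex_Gamma_log_integral_1(2)[OF \<nu>])
qed

text \<open>The function \<open>|a|\<^sup>2 + |b|\<^sup>2 / x\<close> grows at most like \<open>exp (4 x)\<close> along the system and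
  vanishes at the singular point.\<close>
lemma singular_system_unique:
  fixes a b :: "real \<Rightarrow> complex"
  assumes \<nu>: "Re \<nu> = 0"
    and da: "\<And>x. x > 0 \<Longrightarrow> (a has_vector_derivative ((\<nu> * a x - b x) / of_real x)) (at x)"
    and db: "\<And>x. x > 0 \<Longrightarrow> (b has_vector_derivative (- a x)) (at x)"
    and la: "(a \<longlongrightarrow> 0) (at_right 0)" and lb: "(b \<longlongrightarrow> 0) (at_right 0)"
    and x: "x > 0"
  shows "a x = 0"
proof -
  define V where "V x = (a x \<bullet> a x) + (b x \<bullet> b x) / x" for x
  define W where "W x = exp (- 4 * x) * V x" for x
  have Wd: "\<exists>y. (W has_real_derivative y) (at x) \<and> y \<le> 0" if x: "x > 0" for x
  proof -
    let ?a' = "(\<nu> * a x - b x) / of_real x"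
    let ?V' = "2 * (a x \<bullet> ?a') + (2 * (b x \<bullet> (- a x)) * x - (b x \<bullet> b x)) / x\<^sup>2"
    have "((\<lambda>x. a x \<bullet> a x) has_vector_derivative (a x \<bullet> ?a' + ?a' \<bullet> a x)) (at x)"
      by (rule bounded_bilinear.has_vector_derivative[OF bounded_bilinear_inner da[OF x] da[OF x]])
    hence 1: "((\<lambda>x. a x \<bullet> a x) has_real_derivative (2 * (a x \<bullet> ?a'))) (at x)"
      by (simp add: has_real_derivative_iff_has_vector_derivative inner_commute)
    have "((\<lambda>x. b x \<bullet> b x) has_vector_derivative (b x \<bullet> (- a x) + (- a x) \<bullet> b x)) (at x)"
      by (rule bounded_bilinear.has_vector_derivative[OF bounded_bilinear_inner db[OF x] db[OF x]])
    hence 2: "((\<lambda>x. b x \<bullet> b x) has_real_derivative (2 * (b x \<bullet> (- a x)))) (at x)"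
      by (simp add: has_real_derivative_iff_has_vector_derivative inner_commute)
    have Vd: "(V has_real_derivative ?V') (at x)"
      unfolding V_def using x by (auto intro!: derivative_eq_intros 1 2 simp: power2_eq_square)
    \<comment> \<open>Multiplication by an imaginary number turns a vector by a right angle, so the
      term with \<nu> does not contribute to the derivative of |a|^2.\<close>
    have i0: "a x \<bullet> (\<nu> * a x) = 0"
      using \<nu> by (simp add: inner_complex_def algebra_simps)
    have ia: "a x \<bullet> ?a' = - (a x \<bullet> b x) / x"
    proof -
      have "?a' = (1 / x) *\<^sub>R (\<nu> * a x - b x)" by (simp add: scaleR_conv_of_real)
      thus ?thesis by (simp only: inner_scaleR_right inner_diff_right i0) simp
    qed
    have "?V' = - 4 * (a x \<bullet> b x) / x - (norm (b x))\<^sup>2 / x\<^sup>2"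
      unfolding ia using x by (simp add: field_simps power2_eq_square inner_commute flip: power2_norm_eq_inner)
    also have "\<dots> \<le> 4 * (norm (a x) * norm (b x)) / x - (norm (b x))\<^sup>2 / x\<^sup>2"
      using Cauchy_Schwarz_ineq2[of "a x" "b x"] x by (intro diff_right_mono divide_right_mono) auto
    \<comment> \<open>Completing the square. The singular cross term of size |a| |b| / x is absorbed
      by -|b|^2 / x^2, which comes from differentiating the weight 1/x; this is the reason for that
      weight in \<open>V\<close>.\<close>
    also have "\<dots> = 4 * (norm (a x))\<^sup>2 - (2 * norm (a x) - norm (b x) / x)\<^sup>2"
      using x by (simp add: power2_eq_square field_simps)
    also have "\<dots> \<le> 4 * (norm (a x))\<^sup>2" by simp
    also have "\<dots> \<le> 4 * V x" using x by (simp add: V_def power2_norm_eq_inner)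
    finally have V': "?V' \<le> 4 * V x" .
    have "(W has_real_derivative (exp (- 4 * x) * ?V' + (- 4 * exp (- 4 * x)) * V x)) (at x)"
      unfolding W_def by (rule derivative_eq_intros Vd refl | simp)+
    moreover have "exp (- 4 * x) * ?V' + (- 4 * exp (- 4 * x)) * V x = exp (- 4 * x) * (?V' - 4 * V x)"
      by (simp add: algebra_simps)
    moreover have "\<dots> \<le> 0" using V' by (intro mult_nonneg_nonpos) auto
    ultimately show ?thesis by metis
  qed
  obtain d where d: "d > 0" "\<And>y. 0 < y \<Longrightarrow> y < d \<Longrightarrow> norm (a y) \<le> 1"
  proof -
    have "eventually (\<lambda>y. dist (a y) 0 < 1) (at_right 0)" using la by (rule tendstoD) simp
    then obtain d where "d > 0" "\<And>y. 0 < y \<Longrightarrow> y < d \<Longrightarrow> dist (a y) 0 < 1"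
      by (auto simp: eventually_at_right_field)
    thus ?thesis by (intro that[of d]) (auto intro: less_imp_le)
  qed
  \<comment> \<open>Convergence of b to 0 does not by itself control |b|^2 / y. Near 0, however, b
    has derivative -a of norm at most 1, so the mean value inequality from the limit at 0 gives |b
    y| \<le> y.\<close>
  have bb: "norm (b y) \<le> y" if y: "0 < y" "y < d" for y
  proof -
    have "norm (b y - b z) \<le> y" if z: "0 < z" "z < y" for z
    proof -
      have "norm (b y - b z) \<le> 1 * norm (y - z)"
      proof (rule differentiable_bound[of "{0<..<d}" b "\<lambda>w h. h *\<^sub>R (- a w)"])
        fix w assume w: "w \<in> {0<..<d}"
        show "(b has_derivative (\<lambda>h. h *\<^sub>R (- a w))) (at w within {0<..<d})"
          using db[of w] w by (auto simp: has_vector_derivative_def intro: has_derivative_at_withinI)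
        show "onorm (\<lambda>h. h *\<^sub>R (- a w)) \<le> 1"
          by (rule onorm_le) (use d(2)[of w] w in \<open>auto intro: mult_left_le\<close>)
      qed (use y z in auto)
      thus ?thesis using z by simp
    qed
    hence "eventually (\<lambda>z. norm (b y - b z) \<le> y) (at_right 0)"
      using y by (auto simp: eventually_at_right_field)
    moreover have "((\<lambda>z. norm (b y - b z)) \<longlongrightarrow> norm (b y - 0)) (at_right 0)"
      by (intro tendsto_intros lb)
    ultimately have "norm (b y - 0) \<le> y"
      by (intro tendsto_upperbound) auto
    thus ?thesis by simp
  qed
  have Wb: "W x \<le> (norm (a y))\<^sup>2 + y" if y: "0 < y" "y < min d x" for y
  proof -
    have "W x \<le> W y"
      by (rule DERIV_nonpos_imp_nonincreasing) (use y Wd in auto)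
    also have "W y \<le> V y"
    proof -
      have "V y \<ge> 0" using y by (simp add: V_def)
      thus ?thesis using y mult_right_mono[of "exp (- 4 * y)" 1 "V y"] by (simp add: W_def)
    qed
    also have "V y \<le> (norm (a y))\<^sup>2 + y"
    proof -
      have "(norm (b y))\<^sup>2 \<le> y\<^sup>2" using bb[of y] y by (intro power_mono) auto
      hence "(norm (b y))\<^sup>2 / y \<le> y" using y by (simp add: field_simps power2_eq_square)
      thus ?thesis by (simp add: V_def power2_norm_eq_inner)
    qed
    finally show ?thesis .
  qed
  have "((\<lambda>y. (norm (a y))\<^sup>2 + y) \<longlongrightarrow> (norm (0::complex))\<^sup>2 + 0) (at_right 0)"
    by (intro tendsto_intros la)
  hence "W x \<le> (norm (0::complex))\<^sup>2 + 0"
  proof (rule tendsto_lowerbound)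
    show "eventually (\<lambda>y. W x \<le> (norm (a y))\<^sup>2 + y) (at_right 0)"
      using Wb d(1) x by (auto simp: eventually_at_right_field intro!: exI[of _ "min d x"])
  qed auto
  hence "V x \<le> 0" by (simp add: W_def mult_le_0_iff)
  hence "a x \<bullet> a x \<le> 0" using x by (simp add: V_def) (smt (verit) inner_ge_zero divide_nonneg_pos)
  thus ?thesis by (metis inner_eq_zero_iff inner_ge_zero order_antisym)
qed

text \<open>The Bessel-Clifford function: \<open>J\<^sub>\<mu>(z) = (z/2)\<^bsup>\<mu>\<^esup> clifford \<mu> (- z\<^sup>2/4)\<close>.\<close>
definition clifford :: "complex \<Rightarrow> complex \<Rightarrow> complex" where
  "clifford \<mu> z = (\<Sum>k. rGamma (of_nat k + \<mu> + 1) / fact k * z ^ k)"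

lemma summable_clifford:
  fixes \<mu> z :: complex
  shows "summable (\<lambda>k. rGamma (of_nat k + \<mu> + 1) / fact k * z ^ k)"
proof -
  obtain C where C: "\<And>k \<mu>'. norm (\<mu>' :: complex) \<le> norm \<mu> \<Longrightarrow> norm (rGamma (of_nat k + \<mu>' + 1)) \<le> C"
    using rGamma_shift_bounded by blast
  have "norm (rGamma (of_nat k + \<mu> + 1) / fact k * z ^ k) \<le> C * (norm z ^ k / fact k)" for k
    using mult_right_mono[OF C[of \<mu> k], of "norm z ^ k / fact k"]
    by (simp add: norm_mult norm_divide norm_power)
  thus ?thesis by (intro summable_comparison_test'[OF summable_exp_series, where N = 0]) auto
qed

lemma clifford_has_field_derivative: "(clifford \<mu> has_field_derivative clifford (\<mu> + 1) z) (at z)"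
proof -
  have "((\<lambda>z. \<Sum>k. rGamma (of_nat k + \<mu> + 1) / fact k * z ^ k) has_field_derivative
      (\<Sum>k. diffs (\<lambda>k. rGamma (of_nat k + \<mu> + 1) / fact k) k * z ^ k)) (at z)"
    by (rule termdiffs_strong_converges_everywhere) (rule summable_clifford)
  moreover have "diffs (\<lambda>k. rGamma (of_nat k + \<mu> + 1) / fact k) k = rGamma (of_nat k + (\<mu> + 1) + 1) / fact k" for k
    by (simp add: diffs_def field_simps del: of_nat_Suc) (simp add: add_ac)
  ultimately show ?thesis by (simp add: clifford_def[abs_def])
qed

text \<open>In the k-th term the functional equation of \<open>rGamma\<close> leaves the factor k,
  which shortens the factorial, and a shift of the index produces the factor z and the order \<mu> +
  1.\<close>

lemma clifford_recurrence: "clifford (\<mu> - 1) z - \<mu> * clifford \<mu> z = z * clifford (\<mu> + 1) z"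
proof -
  let ?c = "\<lambda>k. rGamma (of_nat k + \<mu> + 1) / fact k"
  have "clifford (\<mu> - 1) z - \<mu> * clifford \<mu> z =
      (\<Sum>k. rGamma (of_nat k + (\<mu> - 1) + 1) / fact k * z ^ k - \<mu> * (?c k * z ^ k))"
    unfolding clifford_def
    by (simp only: suminf_mult[OF summable_clifford, symmetric] suminf_diff[OF summable_clifford summable_mult[OF summable_clifford]])
  also have "\<dots> = (\<Sum>k. of_nat k * ?c k * z ^ k)"
  proof (rule suminf_cong)
    fix k
    have "rGamma (of_nat k + (\<mu> - 1) + 1) = (of_nat k + \<mu>) * rGamma (of_nat k + \<mu> + 1)"
      using rGamma_plus1[of "of_nat k + \<mu>"] by (simp add: add_ac)
    thus "rGamma (of_nat k + (\<mu> - 1) + 1) / fact k * z ^ k - \<mu> * (?c k * z ^ k) = of_nat k * ?c k * z ^ k"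
      by (simp add: field_simps)
  qed
  also have "\<dots> = (\<Sum>k. z * (rGamma (of_nat k + (\<mu> + 1) + 1) / fact k * z ^ k))"
  proof -
    have eq: "of_nat (Suc k) * ?c (Suc k) * z ^ Suc k = z * (rGamma (of_nat k + (\<mu> + 1) + 1) / fact k * z ^ k)" for k
    proof -
      have "of_nat (Suc k) * ?c (Suc k) = rGamma (of_nat (Suc k) + \<mu> + 1) / fact k"
        by (simp del: of_nat_Suc add: fact_Suc)
      moreover have "of_nat (Suc k) + \<mu> + 1 = of_nat k + (\<mu> + 1) + 1" by simp
      ultimately show ?thesis by (simp only: power_Suc) (simp add: mult_ac)
    qed
    have "summable (\<lambda>k. of_nat (Suc k) * ?c (Suc k) * z ^ Suc k)"
      unfolding eq by (intro summable_mult summable_clifford)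
    hence "summable (\<lambda>k. of_nat k * ?c k * z ^ k)"
      using summable_Suc_iff[of "\<lambda>k. of_nat k * ?c k * z ^ k"] by simp
    from suminf_split_head[OF this] show ?thesis by (simp only: eq) simp
  qed
  also have "\<dots> = z * clifford (\<mu> + 1) z"
    unfolding clifford_def by (rule suminf_mult[OF summable_clifford])
  finally show ?thesis .
qed

lemma clifford_tendsto: "((\<lambda>x. clifford \<mu> (of_real x)) \<longlongrightarrow> rGamma (\<mu> + 1)) (at_right 0)"
proof -
  have "clifford \<mu> 0 = rGamma (\<mu> + 1)"
    unfolding clifford_def by (subst suminf_finite[where N = "{0}"]) auto
  moreover have "isCont (clifford \<mu>) (of_real 0)"
    by (rule DERIV_isCont[OF clifford_has_field_derivative])
  hence "((\<lambda>x. clifford \<mu> (of_real x)) \<longlongrightarrow> clifford \<mu> (of_real 0)) (at_right (0::real))"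
    by (rule isCont_tendsto_compose) (intro tendsto_intros)
  ultimately show ?thesis by simp
qed

text \<open>The classical formula of K as a difference of two modified Bessel functions I of
  opposite order. The differences \<open>A\<close> and \<open>B\<close> between the two sides, at
  orders \<nu> and \<nu> + 1, satisfy x A' = \<nu> A - B and B' = - A and tend to 0 at the origin,
  so \<open>singular_system_unique\<close> makes A vanish.\<close>

lemma macdonald_eq_clifford:
  assumes re: "Re \<nu> = 0" and nz: "\<nu> \<noteq> 0" and x: "x > 0"
  shows "macdonald \<nu> (of_real x) = of_real pi / sin (of_real pi * \<nu>) *
           (clifford (- \<nu>) (of_real x) - exp (\<nu> * of_real (ln x)) * clifford \<nu> (of_real x))"
proof -
  define c where "c = of_real pi / sin (of_real pi * \<nu>)"
  define e where "e x = exp (\<nu> * of_real (ln x))" for x :: real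
  have nint: "\<nu> \<notin> \<int>" using re nz by (auto elim!: Ints_cases simp: complex_eq_iff)
  have c: "c = Gamma \<nu> * Gamma (1 - \<nu>)"
    unfolding c_def by (rule Gamma_reflection_complex[symmetric])
  have nint': "1 - \<nu> \<notin> \<int>" using nint by (metis Ints_1 Ints_diff diff_diff_eq2 add_diff_cancel_left')
  have g1: "Gamma \<nu> * rGamma \<nu> = 1" and g2: "Gamma (1 - \<nu>) * rGamma (1 - \<nu>) = 1"
  proof -
    have "Gamma \<nu> \<noteq> 0" "Gamma (1 - \<nu>) \<noteq> 0"
      using nint nint' nonpos_Ints_Int by (auto intro!: Gamma_nonzero)
    thus "Gamma \<nu> * rGamma \<nu> = 1" "Gamma (1 - \<nu>) * rGamma (1 - \<nu>) = 1"
      by (simp_all add: rGamma_inverse_Gamma)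
  qed
  have G1: "Gamma (\<nu> + 1) = \<nu> * c * rGamma (1 - \<nu>)"
    using Gamma_plus1[of \<nu>] nint nonpos_Ints_Int g2 by (auto simp: c mult.assoc)
  have G2: "Gamma (1 - \<nu>) = \<nu> * c * rGamma (\<nu> + 1)"
  proof -
    have "\<nu> * c * rGamma (\<nu> + 1) = Gamma (1 - \<nu>) * (Gamma \<nu> * (\<nu> * rGamma (\<nu> + 1)))"
      by (simp add: c mult_ac)
    thus ?thesis by (simp add: rGamma_plus1 g1)
  qed
  define A where "A x = macdonald \<nu> (of_real x) - c * (clifford (- \<nu>) (of_real x) - e x * clifford \<nu> (of_real x))" for x :: real
  \<comment> \<open>The same difference at order \<nu> + 1. The sine changes sign there, which
    explains the signs inside the bracket.\<close>
  define B where "B x = macdonald (\<nu> + 1) (of_real x) - c * (- clifford (- \<nu> - 1) (of_real x) + e x * of_real x * clifford (\<nu> + 1) (of_real x))" for x :: real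
  have ed: "(e has_vector_derivative (\<nu> / of_real x * e x)) (at x)" if "x > 0" for x
  proof -
    have "((\<lambda>x. \<nu> * of_real (ln x)) has_vector_derivative (\<nu> * of_real (1 / x))) (at x)"
      using that by (auto intro!: derivative_eq_intros simp: has_real_derivative_iff_has_vector_derivative[symmetric])
    from field_vector_diff_chain_at[OF this DERIV_exp]
    show ?thesis by (simp add: e_def[abs_def] o_def mult.commute)
  qed
  have cd: "((\<lambda>x. clifford \<mu> (of_real x)) has_vector_derivative clifford (\<mu> + 1) (of_real x)) (at x)" for \<mu> x
    by (rule has_vector_derivative_real_field[OF clifford_has_field_derivative])
  have md: "((\<lambda>x. macdonald \<mu> (of_real x)) has_vector_derivative - macdonald (\<mu> - 1) (of_real x)) (at x)" if "x > 0" for \<mu> x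
    by (rule has_vector_derivative_real_field[OF macdonald_has_field_derivative]) (use that in auto)
  have ne: "norm (e x) = 1" for x using re by (simp add: e_def)
  have "A x = 0"
  proof (rule singular_system_unique[OF re])
    fix x :: real assume x: "x > 0"
    have xn: "complex_of_real x \<noteq> 0" using x by simp
    have r1: "of_real x * clifford (- \<nu> + 1) (of_real x) = clifford (- \<nu> - 1) (of_real x) + \<nu> * clifford (- \<nu>) (of_real x)"
      using clifford_recurrence[of "- \<nu>" "of_real x"] by simp
    have r2: "of_real x * clifford (\<nu> + 1 + 1) (of_real x) = clifford \<nu> (of_real x) - (\<nu> + 1) * clifford (\<nu> + 1) (of_real x)"
      using clifford_recurrence[of "\<nu> + 1" "of_real x"] by simp
    have r3: "of_real x * macdonald (\<nu> - 1) (of_real x) = macdonald (\<nu> + 1) (of_real x) - \<nu> * macdonald \<nu> (of_real x)"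
      using macdonald_recurrence[OF x, of \<nu>] by simp
    have "(A has_vector_derivative (- macdonald (\<nu> - 1) (of_real x) - c * (clifford (- \<nu> + 1) (of_real x) -
        (e x * clifford (\<nu> + 1) (of_real x) + \<nu> / of_real x * e x * clifford \<nu> (of_real x))))) (at x)"
      unfolding A_def[abs_def] by (rule derivative_intros md cd ed x)+
    moreover have "- macdonald (\<nu> - 1) (of_real x) - c * (clifford (- \<nu> + 1) (of_real x) -
        (e x * clifford (\<nu> + 1) (of_real x) + \<nu> / of_real x * e x * clifford \<nu> (of_real x))) = (\<nu> * A x - B x) / of_real x"
    proof -
      have "(- macdonald (\<nu> - 1) (of_real x) - c * (clifford (- \<nu> + 1) (of_real x) -
        (e x * clifford (\<nu> + 1) (of_real x) + \<nu> / of_real x * e x * clifford \<nu> (of_real x)))) * of_real x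
        = - (of_real x * macdonald (\<nu> - 1) (of_real x)) - c * (of_real x * clifford (- \<nu> + 1) (of_real x) -
        (e x * of_real x * clifford (\<nu> + 1) (of_real x) + \<nu> * e x * clifford \<nu> (of_real x)))"
        using xn by (simp add: field_simps)
      also have "\<dots> = \<nu> * A x - B x"
        unfolding r1 r3 A_def B_def by (simp add: algebra_simps)
      finally show ?thesis using xn by (simp add: field_simps)
    qed
    ultimately show "(A has_vector_derivative ((\<nu> * A x - B x) / of_real x)) (at x)" by simp
    have c1: "((\<lambda>x. clifford (- \<nu> - 1) (of_real x)) has_vector_derivative clifford (- \<nu>) (of_real x)) (at x)"
      using cd[of "- \<nu> - 1" x] by simp
    have m1: "((\<lambda>x. macdonald (\<nu> + 1) (of_real x)) has_vector_derivative - macdonald \<nu> (of_real x)) (at x)"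
      using md[OF x, of "\<nu> + 1"] by simp
    have o1: "((\<lambda>x. complex_of_real x) has_vector_derivative 1) (at x)"
      by (rule has_vector_derivative_real_field[OF DERIV_ident])
    have "(B has_vector_derivative (- macdonald \<nu> (of_real x) - c * (- clifford (- \<nu>) (of_real x) +
        (e x * of_real x * clifford (\<nu> + 1 + 1) (of_real x) + (e x * 1 + \<nu> / of_real x * e x * of_real x) * clifford (\<nu> + 1) (of_real x))))) (at x)"
      unfolding B_def[abs_def] by (rule derivative_intros m1 c1 cd ed x o1)+
    moreover have "(- macdonald \<nu> (of_real x) - c * (- clifford (- \<nu>) (of_real x) +
        (e x * of_real x * clifford (\<nu> + 1 + 1) (of_real x) + (e x * 1 + \<nu> / of_real x * e x * of_real x) * clifford (\<nu> + 1) (of_real x)))) = - A x"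
    proof -
      have "e x * of_real x * clifford (\<nu> + 1 + 1) (of_real x) = e x * (clifford \<nu> (of_real x) - (\<nu> + 1) * clifford (\<nu> + 1) (of_real x))"
        using r2 by (simp add: mult.assoc)
      moreover have "\<nu> / of_real x * e x * of_real x = \<nu> * e x" using xn by simp
      ultimately show ?thesis unfolding A_def by (simp add: algebra_simps)
    qed
    ultimately show "(B has_vector_derivative - A x) (at x)" by simp
  next
    have e0: "((\<lambda>x. e x * f x) \<longlongrightarrow> 0) (at_right 0)" if "(f \<longlongrightarrow> 0) (at_right 0)" for f :: "real \<Rightarrow> complex"
    proof (rule tendsto_norm_zero_cancel)
      show "((\<lambda>x. norm (e x * f x)) \<longlongrightarrow> 0) (at_right 0)"
        unfolding norm_mult ne using tendsto_norm_zero[OF that] by simp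
    qed
    \<comment> \<open>For imaginary \<nu> the function \<open>macdonald\<close> oscillates like
      x^\<nu> near 0. Recurrence and reflection write \<nu> A through the orders \<nu> + 1 and 1 -
      \<nu>, both of real part 1, where the limits are Gamma values; the factor \<open>e\<close> has
      modulus 1 and preserves convergence to 0.\<close>
    let ?f = "\<lambda>x. macdonald (\<nu> + 1) (of_real x) - \<nu> * c * clifford (- \<nu>) (of_real x)"
    let ?g = "\<lambda>x. macdonald (1 - \<nu>) (of_real x) - \<nu> * c * clifford \<nu> (of_real x)"
    have "(?f \<longlongrightarrow> Gamma (\<nu> + 1) - \<nu> * c * rGamma (- \<nu> + 1)) (at_right 0)"
      by (intro tendsto_intros macdonald_tendsto_Gamma clifford_tendsto) (use re in auto)
    hence f: "(?f \<longlongrightarrow> 0) (at_right 0)" using G1 by simp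
    have "(?g \<longlongrightarrow> Gamma (1 - \<nu>) - \<nu> * c * rGamma (\<nu> + 1)) (at_right 0)"
      by (intro tendsto_intros macdonald_tendsto_Gamma clifford_tendsto) (use re in auto)
    hence g: "(?g \<longlongrightarrow> 0) (at_right 0)" using G2 by simp
    have "((\<lambda>x. (?f x - e x * ?g x) / \<nu>) \<longlongrightarrow> (0 - 0) / \<nu>) (at_right 0)"
      by (intro tendsto_divide tendsto_diff f e0 g tendsto_const nz)
    moreover have "eventually (\<lambda>x. (?f x - e x * ?g x) / \<nu> = A x) (at_right 0)"
      using eventually_at_right_less[of 0]
    proof eventually_elim
      case (elim x)
      have xn: "complex_of_real x \<noteq> 0" using elim by simp
      have "macdonald (\<nu> - 1) (of_real x) = exp ((\<nu> - 1) * of_real (ln x)) * macdonald (1 - \<nu>) (of_real x)"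
        using macdonald_reflect[OF elim, of "\<nu> - 1"] by simp
      also have "exp ((\<nu> - 1) * of_real (ln x)) = e x / of_real x"
        using elim exp_of_real[of "ln x"] by (simp add: e_def left_diff_distrib exp_diff)
      finally have "of_real x * macdonald (\<nu> - 1) (of_real x) = e x * macdonald (1 - \<nu>) (of_real x)"
        using xn by simp
      hence "macdonald (\<nu> + 1) (of_real x) = \<nu> * macdonald \<nu> (of_real x) + e x * macdonald (1 - \<nu>) (of_real x)"
        using macdonald_recurrence[OF elim, of \<nu>] by simp
      thus ?case using nz by (simp add: A_def field_simps)
    qed
    ultimately show "(A \<longlongrightarrow> 0) (at_right 0)" using Lim_transform_eventually by fastforce
    have l0: "((\<lambda>x. of_real x * clifford (\<nu> + 1) (of_real x)) \<longlongrightarrow> of_real 0 * rGamma (\<nu> + 1 + 1)) (at_right (0::real))"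
      by (intro tendsto_intros clifford_tendsto)
    have "(B \<longlongrightarrow> Gamma (\<nu> + 1) - c * (- rGamma (- \<nu> - 1 + 1) + 0)) (at_right 0)"
      unfolding B_def[abs_def] mult.assoc
      by (intro tendsto_intros macdonald_tendsto_Gamma clifford_tendsto e0) (use re l0 in auto)
    moreover have rg: "rGamma (- \<nu> - 1 + 1) = - (\<nu> * rGamma (1 - \<nu>))"
      using rGamma_plus1[of "- \<nu>"] by simp
    have "Gamma (\<nu> + 1) - c * (- rGamma (- \<nu> - 1 + 1) + 0) = 0"
      unfolding G1 rg by (simp add: mult_ac)
    ultimately show "(B \<longlongrightarrow> 0) (at_right 0)" by simp
  qed fact
  thus ?thesis by (simp add: A_def c_def e_def)
qed

text \<open>At z = it one has (z/2)^2 = -t^2/4, which cancels the alternating signs of the series: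
  on the imaginary axis the Bessel function J is a modified Bessel function.\<close>

lemma besselJ_log_it:
  assumes t: "t > 0" and \<zeta>: "\<zeta> = of_real (ln t) + \<i> * of_real (pi / 2)"
  shows "besselJ_log \<mu> \<zeta> = exp (\<mu> * (of_real (ln (t / 2)) + \<i> * of_real (pi / 2))) * clifford \<mu> (of_real (t\<^sup>2 / 4))"
proof -
  let ?w = "of_real (ln (t / 2)) + \<i> * of_real (pi / 2) :: complex"
  have w: "\<zeta> - of_real (ln 2) = ?w" using t by (simp add: \<zeta> ln_div)
  have e2: "exp (2 * ?w) = - of_real (t\<^sup>2 / 4)"
  proof -
    have "2 * ?w = of_real (ln (t / 2) + ln (t / 2)) + \<i> * of_real pi"
      by (simp add: algebra_simps)
    hence "exp (2 * ?w) = - of_real (exp (ln (t / 2) + ln (t / 2)))"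
      by (simp only: exp_add[of _ "\<i> * of_real pi"] exp_of_real exp_pi_i') simp
    also have "exp (ln (t / 2) + ln (t / 2)) = t\<^sup>2 / 4"
      using t by (simp only: exp_add) (simp add: power2_eq_square)
    finally show ?thesis .
  qed
  have "besselJ_term \<mu> \<zeta> k = exp (\<mu> * ?w) * (rGamma (of_nat k + \<mu> + 1) / fact k * of_real (t\<^sup>2 / 4) ^ k)" for k
  proof -
    have "(2 * of_nat k + \<mu>) * w = of_nat k * (2 * w) + \<mu> * w" for w
      by (simp add: algebra_simps)
    hence "exp ((2 * of_nat k + \<mu>) * ?w) = exp (of_nat k * (2 * ?w)) * exp (\<mu> * ?w)"
      by (simp only: exp_add)
    also have "exp (of_nat k * (2 * ?w)) = (- of_real (t\<^sup>2 / 4)) ^ k"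
      by (simp only: exp_of_nat_mult e2)
    finally have "(-1) ^ k * exp ((2 * of_nat k + \<mu>) * ?w) = ((-1) * (- of_real (t\<^sup>2 / 4))) ^ k * exp (\<mu> * ?w)"
      by (simp only: power_mult_distrib mult.assoc)
    thus ?thesis unfolding besselJ_term_def w by simp
  qed
  hence "besselJ_term \<mu> \<zeta> = (\<lambda>k. exp (\<mu> * ?w) * (rGamma (of_nat k + \<mu> + 1) / fact k * of_real (t\<^sup>2 / 4) ^ k))"
    by (rule ext)
  thus ?thesis
    by (simp only: besselJ_log_eq clifford_def suminf_mult[OF summable_clifford])
qed

text \<open>With x = t^2/4 and \<tau> = ln (t/2) + u the sum exp \<tau> + x exp (-\<tau>) becomes t
  cosh u, and the remaining factors cancel. The integral is twice K of order it at t, times exp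
  (\<pi> t / 2), so this is the standard value (2/\<pi>) exp (\<pi> t / 2) K.\<close>

lemma H1_it_integral:
  assumes t: "t > 0"
  shows "integrable lborel (\<lambda>u. exp (of_real t * (\<i> * of_real u + of_real (pi / 2) - of_real (cosh u))))"
    and "\<i> * H1_it t = (\<integral>u. exp (of_real t * (\<i> * of_real u + of_real (pi / 2) - of_real (cosh u))) \<partial>lborel) / of_real pi"
proof -
  define \<nu> where "\<nu> = \<i> * complex_of_real t"
  define \<zeta> where "\<zeta> = of_real (ln t) + \<i> * complex_of_real (pi / 2)"
  define l where "l = complex_of_real (ln (t / 2))"
  define x where "x = t\<^sup>2 / 4"
  let ?f = "\<lambda>\<tau>. exp (\<nu> * of_real \<tau> - of_real (exp \<tau>) - of_real x * of_real (exp (- \<tau>)))"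
  let ?g = "\<lambda>u. exp (of_real t * (\<i> * of_real u + of_real (pi / 2) - of_real (cosh u)))"
  have x: "x > 0" using t by (simp add: x_def)
  have lnx: "of_real (ln x) = 2 * l"
    using t ln_realpow[of "t / 2" 2] by (simp add: x_def l_def power_divide)
  have shift: "?f (ln (t / 2) + 1 * u) = exp (\<nu> * l - of_real (t * pi / 2)) * ?g u" for u
  proof -
    have a: "exp (ln (t / 2) + 1 * u) = t / 2 * exp u" using t by (simp add: exp_add)
    have "x * exp (- (ln (t / 2) + 1 * u)) = t / 2 * exp (- u)"
      using t by (simp add: x_def exp_add exp_minus exp_diff power2_eq_square field_simps)
    hence b: "of_real x * of_real (exp (- (ln (t / 2) + 1 * u))) = complex_of_real (t / 2 * exp (- u))"
      by (simp only: of_real_mult[symmetric])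
    show ?thesis
      unfolding a b exp_add[symmetric]
      by (rule arg_cong[where f = exp]) (simp add: \<nu>_def l_def cosh_field_def field_simps)
  qed
  have fi: "integrable lborel ?f" by (rule macdonald_integrable) (use x in auto)
  define C where "C = exp (\<nu> * l - of_real (t * pi / 2))"
  have "integrable lborel (\<lambda>u. C * ?g u)"
    using lborel_integrable_real_affine[OF fi, of 1 "ln (t / 2)"] unfolding shift C_def by simp
  hence "integrable lborel (\<lambda>u. inverse C * (C * ?g u))" by (rule integrable_mult_right)
  moreover have "C \<noteq> 0" by (simp add: C_def)
  ultimately show gi: "integrable lborel ?g" by (simp add: mult.assoc[symmetric])
  have K: "macdonald \<nu> (of_real x) = exp (\<nu> * l - of_real (t * pi / 2)) * (\<integral>u. ?g u \<partial>lborel)"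
    unfolding macdonald_def
    using lborel_integral_real_affine[of 1 ?f "ln (t / 2)"] unfolding shift by simp
  have "exp (\<i> * complex_of_real (pi / 2)) = \<i>"
    by (simp only: cis_conv_exp[symmetric] cis_pi_half)
  hence en: "exp \<zeta> = \<nu>"
    unfolding \<zeta>_def \<nu>_def exp_add using t by (simp only: exp_of_real exp_ln mult.commute)
  have re: "Re \<nu> = 0" and nz: "\<nu> \<noteq> 0" using t by (auto simp: \<nu>_def)
  have "\<nu> \<notin> \<int>" using re nz by (auto elim!: Ints_cases simp: complex_eq_iff)
  hence s: "sin (exp \<zeta> * of_real pi) \<noteq> 0"
    by (auto simp: en sin_eq_0)
  have "\<i> * H1_it t = (exp (- \<nu> * (l + \<i> * of_real (pi / 2))) * clifford (- \<nu>) (of_real x) -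
      exp (- \<i> * of_real pi * \<nu>) * (exp (\<nu> * (l + \<i> * of_real (pi / 2))) * clifford \<nu> (of_real x))) / sin (\<nu> * of_real pi)"
    unfolding H1_it_def \<zeta>_def[symmetric] H1_diag_regular[OF s] besselJ_log_it[OF t \<zeta>_def] en x_def l_def ..
  also have "exp (- \<i> * of_real pi * \<nu>) * (exp (\<nu> * (l + \<i> * of_real (pi / 2))) * clifford \<nu> (of_real x))
     = exp (- \<nu> * (l + \<i> * of_real (pi / 2))) * (exp (\<nu> * of_real (ln x)) * clifford \<nu> (of_real x))"
    unfolding lnx mult.assoc[symmetric] exp_add[symmetric] by (simp add: algebra_simps)
  also have "(exp (- \<nu> * (l + \<i> * of_real (pi / 2))) * clifford (- \<nu>) (of_real x) -
      exp (- \<nu> * (l + \<i> * of_real (pi / 2))) * (exp (\<nu> * of_real (ln x)) * clifford \<nu> (of_real x))) / sin (\<nu> * of_real pi)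
      = exp (- \<nu> * (l + \<i> * of_real (pi / 2))) * macdonald \<nu> (of_real x) / of_real pi"
    using s unfolding macdonald_eq_clifford[OF re nz x] en by (simp add: field_simps)
  also have "\<dots> = (\<integral>u. ?g u \<partial>lborel) / of_real pi"
  proof -
    have "exp (- \<nu> * (l + \<i> * of_real (pi / 2))) * exp (\<nu> * l - of_real (t * pi / 2)) = 1"
      unfolding exp_add[symmetric] by (simp add: \<nu>_def algebra_simps)
    thus ?thesis unfolding K by (simp add: mult.assoc[symmetric])
  qed
  finally show "\<i> * H1_it t = (\<integral>u. ?g u \<partial>lborel) / of_real pi" .
qed

section \<open>The phase function and its horizontal lines\<close>

lemma cosh_ge_quadratic: "cosh x \<ge> 1 + x\<^sup>2 / 2" for x :: real
proof -
  have "cosh x = 1 + 2 * (sinh (x / 2))\<^sup>2"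
    using cosh_double[of "x / 2"] cosh_square_eq[of "x / 2"] by simp
  moreover have "\<bar>x / 2\<bar> \<le> \<bar>sinh (x / 2)\<bar>"
    using real_le_abs_sinh[of "x / 2"] by (simp add: sinh_field_def exp_minus)
  hence "(x / 2)\<^sup>2 \<le> (sinh (x / 2))\<^sup>2" by (rule abs_le_square_iff[THEN iffD1])
  ultimately show ?thesis by (simp add: power2_eq_square)
qed

lemma cosh_ge_exp: "cosh x \<ge> exp \<bar>x\<bar> / 2" for x :: real
  by (subst cosh_real_abs[symmetric]) (simp add: cosh_field_def)

lemma sinh_ge_cubic:
  fixes x :: real
  assumes "x \<ge> 0"
  shows "sinh x - x \<ge> x ^ 3 / 6"
proof -
  define f where "f x = sinh x - x - x ^ 3 / 6" for x :: real
  have "f 0 \<le> f x"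
  proof (rule DERIV_nonneg_imp_nondecreasing[OF assms])
    fix y :: real
    have "(f has_real_derivative (cosh y - 1 - y\<^sup>2 / 2)) (at y)"
      unfolding f_def by (auto intro!: derivative_eq_intros)
    thus "\<exists>d. (f has_real_derivative d) (at y) \<and> 0 \<le> d"
      using cosh_ge_quadratic[of y] by force
  qed
  thus ?thesis by (simp add: f_def)
qed

text \<open>The constant 28 is 7 times 4: sinh x - x \<ge> x/6 gives sinh x - x \<ge> (sinh x)/7,
  and sinh x \<ge> (exp x)/4 for x \<ge> 1.\<close>

lemma sinh_minus_id_ge_exp:
  fixes x :: real
  assumes "x \<ge> 1"
  shows "sinh x - x \<ge> exp x / 28"
proof -
  have "x ^ 3 \<ge> x" using power_increasing[of 1 3 x] assms by simp
  hence "sinh x - x \<ge> x / 6" using sinh_ge_cubic[of x] assms by linarith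
  hence 1: "sinh x - x \<ge> sinh x / 7" by linarith
  have "exp x \<ge> 2" using assms exp_ge_add_one_self[of x] by linarith
  moreover have "exp (-x) \<le> 1" using assms by simp
  ultimately have "2 * exp (-x) \<le> exp x" by linarith
  hence "sinh x \<ge> exp x / 4" by (simp add: sinh_field_def)
  with 1 show ?thesis by linarith
qed

lemma sin_ge_cubic:
  fixes x :: real
  assumes "x \<ge> 0"
  shows "sin x \<ge> x - x ^ 3 / 6"
proof -
  have "\<bar>sin x - (\<Sum>m<3. sin_coeff m * x ^ m)\<bar> \<le> inverse (fact 3) * \<bar>x\<bar> ^ 3"
    by (rule Maclaurin_sin_bound)
  moreover have "(\<Sum>m<3. sin_coeff m * x ^ m) = x"
    by (simp add: sin_coeff_def eval_nat_numeral)
  moreover have "inverse (fact 3) * \<bar>x\<bar> ^ 3 = x ^ 3 / 6"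
    using assms by (simp add: eval_nat_numeral)
  ultimately show ?thesis by linarith
qed

lemma sin_ge_half:
  fixes x :: real
  assumes "0 \<le> x" "x \<le> 1"
  shows "sin x \<ge> x / 2"
proof -
  have "x ^ 3 \<le> x" using assms power_decreasing[of 1 3 x] by simp
  thus ?thesis using sin_ge_cubic[of x] assms by linarith
qed

lemma gaussian_integral:
  fixes c :: real
  assumes "c > 0"
  shows "integrable lborel (\<lambda>x. exp (- c * x\<^sup>2))"
    and "(\<integral>x. exp (- c * x\<^sup>2) \<partial>lborel) = sqrt (pi / c)"
proof -
  define s where "s = sqrt (1 / (2 * c))"
  have s: "s > 0" "2 * s\<^sup>2 = 1 / c" using assms by (auto simp: s_def field_simps)
  have eq: "exp (- c * x\<^sup>2) = sqrt (pi / c) * normal_density 0 s x" for x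
  proof -
    have "2 * pi * s\<^sup>2 = pi / c" using s(2) by (metis mult.assoc mult.left_commute times_divide_eq_right mult.right_neutral)
    moreover have "- (x - 0)\<^sup>2 / (2 * s\<^sup>2) = - c * x\<^sup>2" unfolding s(2) by simp
    ultimately have "normal_density 0 s x = 1 / sqrt (pi / c) * exp (- c * x\<^sup>2)"
      unfolding normal_density_def by simp
    thus ?thesis using assms by simp
  qed
  show "integrable lborel (\<lambda>x. exp (- c * x\<^sup>2))"
    unfolding eq using integrable_normal_density[OF s(1)] by (intro integrable_mult_right)
  show "(\<integral>x. exp (- c * x\<^sup>2) \<partial>lborel) = sqrt (pi / c)"
    unfolding eq using integral_normal_density[OF s(1)] by simp
qed

lemma integrable_exp_neg_abs:
  fixes c :: real
  assumes "c > 0"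
  shows "integrable lborel (\<lambda>x. exp (- c * \<bar>x\<bar>))"
proof -
  have "integrable lborel (\<lambda>x. inverse (1 + x\<^sup>2) :: real)"
    using integrable_inverse_1_plus_square by (simp add: set_integrable_def einterval_def)
  from lborel_integrable_real_affine[OF this, of "c / 2" 0]
  have i: "integrable lborel (\<lambda>x. inverse (1 + (c / 2 * x)\<^sup>2))" using assms by simp
  have le: "exp (- c * \<bar>x\<bar>) \<le> inverse (1 + (c / 2 * x)\<^sup>2)" for x
  proof -
    have "1 + c * \<bar>x\<bar> + (c * \<bar>x\<bar>)\<^sup>2 / 2 \<le> exp (c * \<bar>x\<bar>)"
      by (rule exp_lower_Taylor_quadratic) (use assms in auto)
    moreover have "(c / 2 * x)\<^sup>2 \<le> (c * \<bar>x\<bar>)\<^sup>2 / 2" by (simp add: power_mult_distrib field_simps)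
    moreover have "c * \<bar>x\<bar> \<ge> 0" using assms by simp
    ultimately have "1 + (c / 2 * x)\<^sup>2 \<le> exp (c * \<bar>x\<bar>)" by linarith
    moreover have "1 + (c / 2 * x)\<^sup>2 > 0" by (simp add: add_pos_nonneg)
    ultimately show ?thesis by (simp add: exp_minus le_imp_inverse_le)
  qed
  show ?thesis
    by (rule Bochner_Integration.integrable_bound[OF i])
       (use le in \<open>auto intro!: AE_I2 order.trans[OF _ abs_ge_self]\<close>)
qed

lemma integrable_cosh_powr:
  fixes a :: real
  assumes "a > 0"
  shows "integrable lborel (\<lambda>x. cosh x powr (- a))"
proof -
  have le: "cosh x powr (- a) \<le> 2 powr a * exp (- a * \<bar>x\<bar>)" for x :: real
  proof -
    have "cosh x powr (- a) \<le> (exp \<bar>x\<bar> / 2) powr (- a)"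
      using assms cosh_ge_exp[of x] by (intro powr_mono2') auto
    also have "\<dots> = 2 powr a * exp (- a * \<bar>x\<bar>)"
      by (simp add: powr_divide powr_minus exp_powr_real exp_minus field_simps)
    finally show ?thesis .
  qed
  show ?thesis
    by (rule Bochner_Integration.integrable_bound[OF integrable_mult_right[OF integrable_exp_neg_abs[OF assms], of "2 powr a"]])
       (use le in \<open>auto intro!: AE_I2 borel_measurable_continuous_onI continuous_intros\<close>)
qed

lemma integrable_exp_cosh:
  fixes c :: real
  assumes "c > 0"
  shows "integrable lborel (\<lambda>x. exp (- c * cosh x))"
proof -
  have 1: "integrable lborel (\<lambda>x. exp (- (c / 2) * x\<^sup>2))"
    by (rule gaussian_integral) (use assms in auto)
  have 2: "exp (- c * cosh x) \<le> exp (- (c / 2) * x\<^sup>2)" for x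
  proof -
    have "c * (x\<^sup>2 / 2) \<le> c * cosh x"
      using cosh_ge_quadratic[of x] assms by (intro mult_left_mono) auto
    thus ?thesis by simp
  qed
  show ?thesis
  proof (rule Bochner_Integration.integrable_bound[OF 1 _ AE_I2])
    show "(\<lambda>x. exp (- c * cosh x)) \<in> borel_measurable lborel"
      unfolding measurable_lborel2 by (intro borel_measurable_continuous_onI continuous_intros)
  qed (use 2 in simp)
qed

text \<open>Taken in \<theta> first, the integral of the modulus is Gamma a times a power of Re Q,
  at most a multiple of (cosh u)^(-a). This decays exponentially for every a > 0, so Fubini applies,
  and \<open>Gamma_log_integral\<close> evaluates the inner integral.\<close>

lemma Mellin_Fubini:
  fixes Q :: "real \<Rightarrow> complex" and a c :: real
  assumes cont: "continuous_on UNIV Q" and ReQ: "\<And>u. Re (Q u) \<ge> c * cosh u" and c: "c > 0" and a: "a > 0"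
  shows "integrable lborel (\<lambda>\<theta>. of_real (exp (a * \<theta>)) * (\<integral>u. exp (- of_real (exp \<theta>) * Q u) \<partial>lborel))"
    and "(\<integral>\<theta>. of_real (exp (a * \<theta>)) * (\<integral>u. exp (- of_real (exp \<theta>) * Q u) \<partial>lborel) \<partial>lborel)
           = of_real (Gamma a) * (\<integral>u. Q u powr (- of_real a) \<partial>lborel)"
proof -
  define F where "F u \<theta> = exp (of_real (a * \<theta>) - of_real (exp \<theta>) * Q u)" for u \<theta> :: real
  have pos: "Re (Q u) > 0" for u using ReQ[of u] c cosh_real_pos[of u] by (smt (verit) mult_pos_pos)
  have nF: "norm (F u \<theta>) = exp (a * \<theta> - Re (Q u) * exp \<theta>)" for u \<theta>
    by (simp add: F_def mult.commute)
  have meas: "case_prod F \<in> borel_measurable (lborel \<Otimes>\<^sub>M lborel)"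
    unfolding lborel_prod measurable_lborel2 F_def case_prod_unfold
    by (intro borel_measurable_continuous_onI continuous_intros continuous_on_compose2[OF cont]) auto
  have int: "integrable (lborel \<Otimes>\<^sub>M lborel) (case_prod F)"
  proof (rule lborel_pair.Fubini_integrable[OF meas])
    show "AE u in lborel. integrable lborel (\<lambda>\<theta>. case (u, \<theta>) of (x, xa) \<Rightarrow> F x xa)"
      using Gamma_log_integral(1)[OF a pos] by (simp add: F_def)
    have "(\<integral>\<theta>. norm (F u \<theta>) \<partial>lborel) = Gamma a * Re (Q u) powr (- a)" for u
      unfolding nF by (rule real_Gamma_log_integral(2)[OF a pos])
    moreover have "integrable lborel (\<lambda>u. Gamma a * Re (Q u) powr (- a))"
    proof (rule integrable_mult_right, rule Bochner_Integration.integrable_bound)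
      show "integrable lborel (\<lambda>u. c powr (- a) * cosh u powr (- a))"
        by (intro integrable_mult_right integrable_cosh_powr a)
      have "Re (Q u) powr (- a) \<le> c powr (- a) * cosh u powr (- a)" for u
      proof -
        have "Re (Q u) powr (- a) \<le> (c * cosh u) powr (- a)"
          using ReQ[of u] c a by (intro powr_mono2') auto
        thus ?thesis using c by (simp add: powr_mult)
      qed
      thus "AE u in lborel. norm (Re (Q u) powr (- a)) \<le> norm (c powr (- a) * cosh u powr (- a))" by auto
      show "(\<lambda>u. Re (Q u) powr (- a)) \<in> borel_measurable lborel"
        unfolding measurable_lborel2 using pos
        by (intro borel_measurable_continuous_onI continuous_intros cont) (metis less_irrefl)
    qed
    ultimately show "integrable lborel (\<lambda>u. \<integral>\<theta>. norm (case (u, \<theta>) of (x, xa) \<Rightarrow> F x xa) \<partial>lborel)"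
      by simp
  qed
  have eq: "(\<integral>u. F u \<theta> \<partial>lborel) = of_real (exp (a * \<theta>)) * (\<integral>u. exp (- of_real (exp \<theta>) * Q u) \<partial>lborel)" for \<theta>
  proof -
    have "F u \<theta> = of_real (exp (a * \<theta>)) * exp (- of_real (exp \<theta>) * Q u)" for u
      unfolding F_def exp_of_real[symmetric] exp_add[symmetric] by (simp add: algebra_simps)
    thus ?thesis by (simp only: integral_mult_right_zero)
  qed
  show "integrable lborel (\<lambda>\<theta>. of_real (exp (a * \<theta>)) * (\<integral>u. exp (- of_real (exp \<theta>) * Q u) \<partial>lborel))"
    using lborel_pair.integrable_snd[OF int] unfolding eq .
  have "(\<integral>\<theta>. (\<integral>u. F u \<theta> \<partial>lborel) \<partial>lborel) = (\<integral>u. (\<integral>\<theta>. F u \<theta> \<partial>lborel) \<partial>lborel)"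
    by (rule lborel_pair.Fubini_integral[OF int])
  also have "\<dots> = (\<integral>u. of_real (Gamma a) * Q u powr (- of_real a) \<partial>lborel)"
    unfolding F_def Gamma_log_integral(2)[OF a pos] ..
  finally show "(\<integral>\<theta>. of_real (exp (a * \<theta>)) * (\<integral>u. exp (- of_real (exp \<theta>) * Q u) \<partial>lborel) \<partial>lborel)
           = of_real (Gamma a) * (\<integral>u. Q u powr (- of_real a) \<partial>lborel)"
    unfolding eq by simp
qed

text \<open>This is q of the overview. At z = u - i \<pi>/2 the exponent i u + \<pi>/2 - cosh u of
  the Hankel integral is - \<open>phase\<close> z.\<close>

definition phase :: "complex \<Rightarrow> complex" where
  "phase z = \<i> * (sinh z - z)"

lemma sinh_Complex: "sinh (Complex x y) = Complex (sinh x * cos y) (cosh x * sin y)"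
  by (simp add: complex_eq_iff sinh_field_def cosh_field_def Re_exp Im_exp field_simps)

lemma phase_Complex: "phase (Complex x y) = Complex (y - cosh x * sin y) (sinh x * cos y - x)"
  by (simp add: phase_def sinh_Complex complex_eq_iff)

lemma phase_holomorphic: "phase holomorphic_on A"
  unfolding phase_def sinh_field_def by (intro holomorphic_intros) auto

lemma continuous_on_phase_line: "continuous_on UNIV (\<lambda>x. phase (Complex x y))"
  by (intro continuous_on_compose2[OF holomorphic_on_imp_continuous_on[OF phase_holomorphic[of UNIV]]]
       continuous_intros) auto

definition hit :: "real \<Rightarrow> complex" where
  "hit t = \<i> * H1_it t"

text \<open>For - \<pi>/2 \<le> Im z \<le> - b one has sin (Im z) \<le> - sin b, so Re (phase z)
  grows at least like sin b cosh x, uniformly in the height. On the real axis itself the phase is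
  purely imaginary, so the line has to stay strictly below it.\<close>

lemma hit_line:
  assumes t: "t > 0" and b: "0 < b" "b \<le> pi / 2"
  shows "hit t = (\<integral>x. exp (- of_real t * phase (Complex x (- b))) \<partial>lborel) / of_real pi"
proof -
  let ?f = "\<lambda>z. exp (- of_real t * phase z)"
  have n: "norm (?f (Complex x y)) = exp (- t * (y - cosh x * sin y))" for x y
    by (simp add: phase_Complex)
  have sb: "sin b > 0" using b pi_gt_zero by (intro sin_gt_zero) linarith+
  have B: "norm (?f (Complex x y)) \<le> exp (t * pi / 2 - t * sin b * cosh \<bar>x\<bar>)" if y: "- (pi / 2) \<le> y" "y \<le> - b" for x y
  proof -
    have "sin b \<le> sin (- y)" using y b by (intro sin_monotone_2pi_le) auto
    hence "cosh x * sin b \<le> cosh x * sin (- y)" by (intro mult_left_mono) auto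
    hence "- (pi / 2) + sin b * cosh x \<le> y - cosh x * sin y" using y by (simp add: mult.commute)
    hence "t * (- (pi / 2) + sin b * cosh x) \<le> t * (y - cosh x * sin y)" using t by (intro mult_left_mono) auto
    thus ?thesis unfolding n by (simp add: algebra_simps)
  qed
  have int: "integrable lborel (\<lambda>x. ?f (Complex x y))" if y: "- (pi / 2) \<le> y" "y \<le> - b" for y
  proof (rule Bochner_Integration.integrable_bound)
    show "integrable lborel (\<lambda>x. exp (t * pi / 2) * exp (- (t * sin b) * cosh x))"
      by (intro integrable_mult_right integrable_exp_cosh) (use t sb in auto)
    show "AE x in lborel. norm (?f (Complex x y)) \<le> norm (exp (t * pi / 2) * exp (- (t * sin b) * cosh x))"
      using B[OF y] by (intro AE_I2) (simp add: exp_add[symmetric])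
    show "(\<lambda>x. ?f (Complex x y)) \<in> borel_measurable lborel"
      unfolding measurable_lborel2
      by (intro borel_measurable_continuous_onI continuous_intros continuous_on_phase_line)
  qed
  have base: "hit t = (\<integral>x. ?f (Complex x (- (pi / 2))) \<partial>lborel) / of_real pi"
  proof -
    have "exp (of_real t * (\<i> * of_real u + of_real (pi / 2) - of_real (cosh u))) = ?f (Complex u (- (pi / 2)))" for u
      by (rule arg_cong[where f = exp]) (simp add: phase_Complex complex_eq_iff algebra_simps)
    thus ?thesis using H1_it_integral(2)[OF t] by (simp add: hit_def)
  qed
  show ?thesis
  proof (cases "b = pi / 2")
    case False
    have "(\<integral>x. ?f (Complex x (- (pi / 2))) \<partial>lborel) = (\<integral>x. ?f (Complex x (- b)) \<partial>lborel)"
    proof (rule strip_shift[where a = "- pi" and b = 0 and R = 0 and B = "\<lambda>x. exp (t * pi / 2 - t * sin b * cosh x)"])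
      show "?f holomorphic_on {z. - pi < Im z \<and> Im z < 0}"
        by (intro holomorphic_intros phase_holomorphic)
      show "((\<lambda>x. exp (t * pi / 2 - t * sin b * cosh x)) \<longlongrightarrow> 0) at_top"
        unfolding cosh_field_def using t sb by real_asymp
    qed (use b False int B pi_gt_zero in auto)
    thus ?thesis using base by simp
  next
    case True
    show ?thesis unfolding True by (rule base)
  qed
qed

lemma phase_add_2pi_i: "phase (Complex x (3 * pi / 2)) = phase (Complex x (- (pi / 2))) + of_real (2 * pi)"
proof -
  have s: "sin (3 * pi / 2) = sin (- (pi / 2))" "cos (3 * pi / 2) = cos (- (pi / 2))"
    using sin_periodic[of "- (pi / 2)"] cos_periodic[of "- (pi / 2)"] by (simp_all add: field_simps)
  show ?thesis unfolding phase_Complex s by (simp add: complex_eq_iff)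
qed

lemma hit_upper_line:
  assumes t: "t > 0"
  shows "of_real (exp (- 2 * pi * t)) * hit t = (\<integral>x. exp (- of_real t * phase (Complex x (3 * pi / 2))) \<partial>lborel) / of_real pi"
proof -
  have "exp (- of_real t * phase (Complex x (3 * pi / 2))) =
      of_real (exp (- 2 * pi * t)) * exp (- of_real t * phase (Complex x (- (pi / 2))))" for x
    unfolding phase_add_2pi_i exp_of_real[symmetric] exp_add[symmetric]
    by (rule arg_cong[where f = exp]) (simp add: algebra_simps)
  moreover have "hit t = (\<integral>x. exp (- of_real t * phase (Complex x (- (pi / 2)))) \<partial>lborel) / of_real pi"
    by (rule hit_line) (use t in auto)
  ultimately show ?thesis by simp
qed

text \<open>On the line Im z = 3 \<pi> / 2 the real part of the phase is 3 \<pi> / 2 + cosh u, which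
  gives the growth asked for by \<open>Mellin_Fubini\<close>; the exponent a may be any positive
  number.\<close>

lemma Mellin_upper:
  assumes a: "a > 0"
  shows "integrable lborel (\<lambda>\<theta>. of_real (exp (a * \<theta>) * exp (- 2 * pi * exp \<theta>)) * hit (exp \<theta>))"
    and "(\<integral>\<theta>. of_real (exp (a * \<theta>) * exp (- 2 * pi * exp \<theta>)) * hit (exp \<theta>) \<partial>lborel) =
      of_real (Gamma a) / of_real pi * (\<integral>u. phase (Complex u (3 * pi / 2)) powr (- of_real a) \<partial>lborel)"
proof -
  let ?Q = "\<lambda>u. phase (Complex u (3 * pi / 2))"
  have re: "Re (?Q u) \<ge> 1 * cosh u" for u
    unfolding phase_add_2pi_i by (simp add: phase_Complex)
  note mf = Mellin_Fubini[OF continuous_on_phase_line re zero_less_one a]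
  have eq: "of_real (exp (a * \<theta>) * exp (- 2 * pi * exp \<theta>)) * hit (exp \<theta>) =
     of_real (exp (a * \<theta>)) * (\<integral>u. exp (- of_real (exp \<theta>) * ?Q u) \<partial>lborel) / of_real pi" for \<theta>
    using hit_upper_line[of "exp \<theta>"] by (simp add: mult.assoc)
  show "integrable lborel (\<lambda>\<theta>. of_real (exp (a * \<theta>) * exp (- 2 * pi * exp \<theta>)) * hit (exp \<theta>))"
    unfolding eq using mf(1) by (rule integrable_divide)
  show "(\<integral>\<theta>. of_real (exp (a * \<theta>) * exp (- 2 * pi * exp \<theta>)) * hit (exp \<theta>) \<partial>lborel) =
      of_real (Gamma a) / of_real pi * (\<integral>u. ?Q u powr (- of_real a) \<partial>lborel)"
    unfolding eq integral_divide_zero mf(2) by simp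
qed

section \<open>Mellin transform of the Hankel function on the imaginary axis\<close>

lemma cos_ge_quadratic: "cos x \<ge> 1 - x\<^sup>2 / 2" for x :: real
proof -
  have "cos x = 1 - 2 * (sin (x / 2))\<^sup>2" using cos_double_sin[of "x / 2"] by simp
  moreover have "(sin (x / 2))\<^sup>2 \<le> (x / 2)\<^sup>2"
    by (rule abs_le_square_iff[THEN iffD1]) (rule abs_sin_x_le_abs_x)
  ultimately show ?thesis by (simp add: power2_eq_square)
qed

text \<open>The line \<open>Im z = - s\<^bsup>-1/3\<^esup>\<close>, which depends on \<open>s\<close>, passes the saddle at its natural scale.\<close>
lemma hit_bound: obtains C where "\<And>s. s \<ge> 1 \<Longrightarrow> norm (hit s) \<le> C * s powr (- 1 / 3)"
proof -
  have "norm (hit s) \<le> (exp (1/6) * 2 / sqrt pi) * s powr (- 1 / 3)" if s: "s \<ge> 1" for s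
  proof -
    define \<beta> where "\<beta> = s powr (- 1 / 3)"
    have \<beta>: "0 < \<beta>" "\<beta> \<le> 1" using s powr_mono[of "- 1 / 3" 0 s] by (auto simp: \<beta>_def)
    have "\<beta> ^ 3 = \<beta> powr 3" using \<beta> by simp
    hence "\<beta> ^ 3 = s powr (- 1)" by (simp add: \<beta>_def powr_powr)
    hence \<beta>3: "s * \<beta> ^ 3 = 1" using s by (simp add: powr_minus)
    have sb: "sin \<beta> \<ge> \<beta> / 2" "sin \<beta> \<ge> \<beta> - \<beta> ^ 3 / 6"
      using \<beta> sin_ge_half[of \<beta>] sin_ge_cubic[of \<beta>] by auto
    let ?f = "\<lambda>x. exp (- of_real s * phase (Complex x (- \<beta>)))"
    \<comment> \<open>The factor exp (1/6) bounds the part constant in x, because s (\<beta> - sin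
      \<beta>) \<le> s \<beta>^3 / 6 = 1/6. The Gaussian comes from sin \<beta> \<ge> \<beta>/2 and
      cosh x - 1 \<ge> x^2 / 2.\<close>
    let ?w = "\<lambda>x. exp (1 / 6) * exp (- (s * \<beta> / 4) * x\<^sup>2)"
    have le: "norm (?f x) \<le> ?w x" for x
    proof -
      have "s * (\<beta> - sin \<beta>) \<le> s * (\<beta> ^ 3 / 6)" using s sb by (intro mult_left_mono) auto
      hence 1: "s * (\<beta> - sin \<beta>) \<le> 1 / 6" using \<beta>3 by simp
      have "(s * sin \<beta>) * (cosh x - 1) \<ge> (s * (\<beta> / 2)) * (x\<^sup>2 / 2)"
        using s sb \<beta> cosh_ge_quadratic[of x] by (intro mult_mono) auto
      with 1 have "s * \<beta> - s * (cosh x * sin \<beta>) \<le> 1 / 6 - (s * \<beta> / 4) * x\<^sup>2"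
        by (simp add: algebra_simps)
      thus ?thesis by (simp add: phase_Complex algebra_simps flip: exp_add)
    qed
    have g: "integrable lborel (\<lambda>x. exp (- (s * \<beta> / 4) * x\<^sup>2))" "(\<integral>x. exp (- (s * \<beta> / 4) * x\<^sup>2) \<partial>lborel) = sqrt (pi / (s * \<beta> / 4))"
      by (rule gaussian_integral; use s \<beta> in simp)+
    have wi: "integrable lborel ?w" by (intro integrable_mult_right g(1))
    have "?f \<in> borel_measurable lborel"
      unfolding measurable_lborel2
      by (intro borel_measurable_continuous_onI continuous_intros continuous_on_phase_line)
    hence fi: "integrable lborel ?f"
      by (rule Bochner_Integration.integrable_bound[OF wi])
         (intro AE_I2 order.trans[OF le], simp)
    have "norm (\<integral>x. ?f x \<partial>lborel) \<le> (\<integral>x. ?w x \<partial>lborel)"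
      by (rule Bochner_Integration.integral_norm_bound_integral[OF fi wi le])
    also have "(\<integral>x. ?w x \<partial>lborel) = exp (1 / 6) * sqrt (pi / (s * \<beta> / 4))"
      using g(2) by simp
    also have "sqrt (pi / (s * \<beta> / 4)) = 2 * sqrt pi * \<beta>"
    proof -
      \<comment> \<open>Since s \<beta>^3 = 1, the product s \<beta> is \<beta>^(-2): the width of
        the Gaussian and the distance of the line from the saddle have the same order.\<close>
      have "pi / (s * \<beta> / 4) = pi * (2 * \<beta>)\<^sup>2"
        using s \<beta> \<beta>3 by (simp add: field_simps power2_eq_square power3_eq_cube)
      thus ?thesis using \<beta> by (simp add: real_sqrt_mult)
    qed
    finally have 2: "norm (\<integral>x. ?f x \<partial>lborel) \<le> exp (1 / 6) * (2 * sqrt pi * \<beta>)" .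
    have "\<beta> \<le> pi / 2" using \<beta> pi_ge_two by linarith
    hence "norm (hit s) = norm (\<integral>x. ?f x \<partial>lborel) / pi"
      using hit_line[of s \<beta>] s \<beta> by (simp add: norm_divide)
    also have "\<dots> \<le> exp (1 / 6) * (2 * sqrt pi * \<beta>) / pi"
      using 2 by (intro divide_right_mono) auto
    also have "\<dots> = (exp (1/6) * 2 / sqrt pi) * \<beta>"
      using real_sqrt_mult_self[of pi] by (simp add: field_simps)
    finally show ?thesis by (simp add: \<beta>_def)
  qed
  thus ?thesis by (rule that)
qed

lemma hit_exp_continuous: "continuous_on UNIV (\<lambda>\<theta>. hit (exp \<theta>))"
proof -
  have "hit (exp \<theta>) = \<i> * H1_diag (of_real \<theta> + \<i> * of_real (pi / 2))" for \<theta>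
    by (simp add: hit_def H1_it_def)
  thus ?thesis
    by (auto intro!: continuous_intros continuous_on_compose2[OF holomorphic_on_imp_continuous_on[OF H1_diag_holomorphic]])
qed

text \<open>For t < 1 the damping factor is at least exp (- 2 \<pi>), so integrability carries over
  from the damped function. For t \<ge> 1 the bound of order t^(-1/3) leaves an exponential in
  \<theta> of rate a - 1/3 < 0.\<close>

lemma Mellin_hit_integrable:
  fixes a :: real
  assumes a: "0 < a" "a < 1 / 3"
  shows "integrable lborel (\<lambda>\<theta>. of_real (exp (a * \<theta>)) * hit (exp \<theta>))"
proof -
  obtain C where C: "\<And>s. s \<ge> 1 \<Longrightarrow> norm (hit s) \<le> C * s powr (- 1 / 3)" using hit_bound by blast
  let ?u = "\<lambda>\<theta>. norm (of_real (exp (a * \<theta>) * exp (- 2 * pi * exp \<theta>)) * hit (exp \<theta>))"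
  let ?v = "\<lambda>\<theta>::real. exp (- (1 / 3 - a) * \<bar>\<theta>\<bar>)"
  let ?w = "\<lambda>\<theta>. exp (2 * pi) * ?u \<theta> + \<bar>C\<bar> * ?v \<theta>"
  show ?thesis
  proof (rule Bochner_Integration.integrable_bound)
    show "integrable lborel ?w"
      by (intro Bochner_Integration.integrable_add integrable_mult_right integrable_norm
            Mellin_upper(1) integrable_exp_neg_abs) (use a in auto)
    show "(\<lambda>\<theta>. of_real (exp (a * \<theta>)) * hit (exp \<theta>)) \<in> borel_measurable lborel"
      unfolding measurable_lborel2
      by (intro borel_measurable_continuous_onI continuous_intros hit_exp_continuous)
    show "AE \<theta> in lborel. norm (of_real (exp (a * \<theta>)) * hit (exp \<theta>)) \<le> norm (?w \<theta>)"
    proof (rule AE_I2)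
      fix \<theta> :: real
      have "norm (of_real (exp (a * \<theta>)) * hit (exp \<theta>)) \<le> ?w \<theta>"
      proof (cases "\<theta> \<ge> 0")
        case True
        have "norm (of_real (exp (a * \<theta>)) * hit (exp \<theta>)) = exp (a * \<theta>) * norm (hit (exp \<theta>))"
          by (simp add: norm_mult)
        also have "\<dots> \<le> exp (a * \<theta>) * (C * exp \<theta> powr (- 1 / 3))"
          using C[of "exp \<theta>"] True by (intro mult_left_mono) auto
        also have "\<dots> \<le> exp (a * \<theta>) * (\<bar>C\<bar> * exp \<theta> powr (- 1 / 3))"
          by (intro mult_left_mono mult_right_mono) auto
        also have "\<dots> = \<bar>C\<bar> * ?v \<theta>"
          using True by (simp add: exp_powr_real exp_add[symmetric] algebra_simps)
        also have "\<dots> \<le> ?w \<theta>" by simp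
        finally show ?thesis .
      next
        case False
        have "1 \<le> exp (2 * pi) * exp (- 2 * pi * exp \<theta>)"
          using False by (simp add: exp_add[symmetric])
        hence "norm (of_real (exp (a * \<theta>)) * hit (exp \<theta>)) * 1 \<le>
            norm (of_real (exp (a * \<theta>)) * hit (exp \<theta>)) * (exp (2 * pi) * exp (- 2 * pi * exp \<theta>))"
          by (intro mult_left_mono) auto
        also have "\<dots> = exp (2 * pi) * ?u \<theta>" by (simp add: norm_mult)
        also have "\<dots> \<le> ?w \<theta>" by simp
        finally show ?thesis by simp
      qed
      thus "norm (of_real (exp (a * \<theta>)) * hit (exp \<theta>)) \<le> norm (?w \<theta>)" by simp
    qed
  qed
qed

text \<open>The common shape of the majorants near the saddle: a power singularity on a bounded
  interval and exponential decay outside. It is used for \<open>psi\<close> and for powers of the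
  phase on lines that approach the real axis.\<close>

lemma integrable_singular_bound:
  fixes p a A B R :: real
  assumes "p < 1" "a > 0" "R > 0"
  shows "integrable lborel (\<lambda>x. A * (indicator {-R..R} x * \<bar>x\<bar> powr (- p)) + B * exp (- a * \<bar>x\<bar>))"
proof -
  have "(\<lambda>x. x powr (- p)) absolutely_integrable_on {0<..R}"
    by (intro nonnegative_absolutely_integrable_1 integrable_on_powr_from_0') (use assms in auto)
  hence "integrable lebesgue (\<lambda>x. indicator {0<..R} x * x powr (- p))"
    by (simp add: set_integrable_def)
  hence i: "integrable lborel (\<lambda>x. indicator {0<..R} x * x powr (- p))"
    by (subst (asm) integrable_completion) auto
  from lborel_integrable_real_affine[OF i, of "-1" 0]
  have "integrable lborel (\<lambda>x. indicator {0<..R} (- x) * (- x) powr (- p))" by simp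
  with i have "integrable lborel (\<lambda>x. indicator {0<..R} x * x powr (- p) + indicator {0<..R} (- x) * (- x) powr (- p))"
    by (rule Bochner_Integration.integrable_add)
  also have "(\<lambda>x. indicator {0<..R} x * x powr (- p) + indicator {0<..R} (- x) * (- x) powr (- p)) =
      (\<lambda>x. indicator {-R..R} x * \<bar>x\<bar> powr (- p))"
    using assms by (auto simp: fun_eq_iff indicator_def)
  finally show ?thesis
    using assms by (intro Bochner_Integration.integrable_add integrable_mult_right integrable_exp_neg_abs)
qed

text \<open>The modulus of the power -a of the phase on the real axis, where the phase is the purely
  imaginary number i (sinh u - u).\<close>

definition psi :: "real \<Rightarrow> real \<Rightarrow> real" where
  "psi a u = (sinh \<bar>u\<bar> - \<bar>u\<bar>) powr (- a)"

lemma psi_integrable: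
  assumes a: "0 < a" "a < 1 / 3"
  shows "integrable lborel (psi a)"
proof (rule Bochner_Integration.integrable_bound)
  let ?w = "\<lambda>x. 6 powr a * (indicator {-1..1} x * \<bar>x\<bar> powr (- (3 * a))) + 28 powr a * exp (- a * \<bar>x\<bar>)"
  show "integrable lborel ?w" by (rule integrable_singular_bound) (use a in auto)
  show "psi a \<in> borel_measurable lborel" unfolding psi_def[abs_def] sinh_field_def by measurable
  have "psi a x \<le> ?w x" for x
  proof (cases "\<bar>x\<bar> \<ge> 1")
    case True
    have "psi a x \<le> (exp \<bar>x\<bar> / 28) powr (- a)"
      unfolding psi_def using sinh_minus_id_ge_exp[OF True] a by (intro powr_mono2') auto
    also have "\<dots> = 28 powr a * exp (- a * \<bar>x\<bar>)"
      by (simp add: powr_divide powr_minus exp_powr_real exp_minus field_simps)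
    also have "\<dots> \<le> ?w x" by simp
    finally show ?thesis .
  next
    case False
    show ?thesis
    proof (cases "x = 0")
      case nz: False
      have "psi a x \<le> (\<bar>x\<bar> ^ 3 / 6) powr (- a)"
        unfolding psi_def using sinh_ge_cubic[of "\<bar>x\<bar>"] a nz by (intro powr_mono2') auto
      also have "\<dots> = 6 powr a * \<bar>x\<bar> powr (- (3 * a))"
      proof -
        have "\<bar>x\<bar> ^ 3 = \<bar>x\<bar> powr 3" using nz by simp
        hence "(\<bar>x\<bar> ^ 3 / 6) powr (- a) = \<bar>x\<bar> powr (3 * - a) / 6 powr (- a)"
          by (simp only: powr_divide powr_powr abs_ge_zero powr_ge_zero)
        thus ?thesis by (simp add: powr_minus field_simps)
      qed
      also have "\<dots> = 6 powr a * (indicator {-1..1} x * \<bar>x\<bar> powr (- (3 * a)))" using False by (auto simp: indicator_def)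
      also have "\<dots> \<le> ?w x" by simp
      finally show ?thesis .
    qed (simp add: psi_def)
  qed
  thus "AE x in lborel. norm (psi a x) \<le> norm (?w x)"
    by (intro AE_I2) (auto simp: psi_def intro: order.trans[OF _ abs_ge_self])
qed

text \<open>As \<open>psi\<close> is even, averaging over u and -u replaces the pair w, cnj w by Re
  w. The boundary values from below and from above the real axis both have this form, with different
  w.\<close>

lemma psi_twisted_integral:
  assumes a: "0 < a" "a < 1 / 3"
  shows "integrable lborel (\<lambda>u. of_real (psi a u) * (if u > 0 then w else cnj w))"
    and "(\<integral>u. of_real (psi a u) * (if u > 0 then w else cnj w) \<partial>lborel) = of_real (Re w * (\<integral>u. psi a u \<partial>lborel))"
proof -
  let ?F = "\<lambda>u. of_real (psi a u) * (if u > 0 then w else cnj w)"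
  have m[measurable]: "psi a \<in> borel_measurable borel" using psi_integrable[OF a] by auto
  show i: "integrable lborel ?F"
    by (rule Bochner_Integration.integrable_bound[OF integrable_mult_right[OF psi_integrable[OF a], of "norm w"]])
       (auto simp: norm_mult mult.commute)
  have i': "integrable lborel (\<lambda>u. ?F (- u))"
    using lborel_integrable_real_affine[OF i, of "-1" 0] by simp
  have "(\<integral>u. ?F u \<partial>lborel) = (\<integral>u. ?F (- u) \<partial>lborel)"
    by (subst lborel_integral_real_affine[where c = "-1" and t = 0]) auto
  hence "2 * (\<integral>u. ?F u \<partial>lborel) = (\<integral>u. ?F u + ?F (- u) \<partial>lborel)"
    using i i' by simp
  also have "\<dots> = (\<integral>u. of_real (2 * Re w * psi a u) \<partial>lborel)"
  proof (rule integral_cong_AE)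
    have "AE u in lborel. u \<noteq> (0::real)" by (rule AE_lborel_singleton)
    thus "AE u in lborel. ?F u + ?F (- u) = of_real (2 * Re w * psi a u)"
      by eventually_elim (auto simp: psi_def complex_eq_iff)
  qed auto
  also have "\<dots> = 2 * of_real (Re w * (\<integral>u. psi a u \<partial>lborel))" by simp
  finally show "(\<integral>u. ?F u \<partial>lborel) = of_real (Re w * (\<integral>u. psi a u \<partial>lborel))" by simp
qed

text \<open>With the regularising weight \<open>exp (- b t)\<close> the line \<open>Im z = - b\<close> can be used: there
  \<open>q(z) + b\<close> has positive real part, tends to \<open>i (sinh u - u)\<close> as \<open>b \<rightarrow> 0\<close>, and its modulus is at
  least half of the limiting one, so no contour has to be moved through the saddle.\<close>
lemma Mellin_hit:
  assumes a: "0 < a" "a < 1 / 3"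
  shows "(\<integral>\<theta>. of_real (exp (a * \<theta>)) * hit (exp \<theta>) \<partial>lborel) =
     of_real (Gamma a / pi * cos (pi * a / 2) * (\<integral>u. psi a u \<partial>lborel))"
proof -
  \<comment> \<open>The summand b stands for the weight exp (- b t); it cancels the negative part of
    the phase on Im z = - b, leaving the real part cosh u sin b.\<close>
  define Q where "Q b u = phase (Complex u (- b)) + of_real b" for b u
  have Q: "Q b u = Complex (cosh u * sin b) (sinh u * cos b - u)" for b u
    by (simp add: Q_def phase_Complex complex_eq_iff)
  define b where "b n = 1 / real (Suc n)" for n
  have b: "0 < b n" "b n \<le> 1" for n by (auto simp: b_def)
  have b0: "b \<longlonglongrightarrow> 0" unfolding b_def using LIMSEQ_inverse_real_of_nat by (simp add: inverse_eq_divide)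
  have key: "(\<integral>\<theta>. of_real (exp (a * \<theta>)) * (of_real (exp (- b n * exp \<theta>)) * hit (exp \<theta>)) \<partial>lborel) =
      of_real (Gamma a) / of_real pi * (\<integral>u. Q (b n) u powr (- of_real a) \<partial>lborel)" for n
  proof -
    let ?b = "b n"
    have sb: "sin ?b > 0" using b[of n] sin_ge_half[of ?b] by simp
    have mf: "(\<integral>\<theta>. of_real (exp (a * \<theta>)) * (\<integral>u. exp (- of_real (exp \<theta>) * Q ?b u) \<partial>lborel) \<partial>lborel)
           = of_real (Gamma a) * (\<integral>u. Q ?b u powr (- of_real a) \<partial>lborel)"
    proof (rule Mellin_Fubini[where c = "sin ?b"])
      show "continuous_on UNIV (Q ?b)"
        unfolding Q_def[abs_def] by (intro continuous_intros continuous_on_phase_line)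
    qed (use a sb in \<open>auto simp: Q\<close>)
    have "of_real (exp (- ?b * exp \<theta>)) * hit (exp \<theta>) = (\<integral>u. exp (- of_real (exp \<theta>) * Q ?b u) \<partial>lborel) / of_real pi" for \<theta>
    proof -
      have "?b \<le> pi / 2" using b[of n] pi_ge_two by linarith
      hence "hit (exp \<theta>) = (\<integral>u. exp (- of_real (exp \<theta>) * phase (Complex u (- ?b))) \<partial>lborel) / of_real pi"
        by (intro hit_line) (use b[of n] in auto)
      moreover have "exp (- of_real (exp \<theta>) * Q ?b u) = of_real (exp (- ?b * exp \<theta>)) * exp (- of_real (exp \<theta>) * phase (Complex u (- ?b)))" for u
        unfolding Q_def exp_of_real[symmetric, of "- ?b * exp \<theta>"] exp_add[symmetric]
        by (rule arg_cong[where f = exp]) (simp add: algebra_simps)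
      ultimately show ?thesis by simp
    qed
    thus ?thesis using mf by simp
  qed
  have L: "(\<lambda>n. \<integral>\<theta>. of_real (exp (a * \<theta>)) * (of_real (exp (- b n * exp \<theta>)) * hit (exp \<theta>)) \<partial>lborel)
      \<longlonglongrightarrow> (\<integral>\<theta>. of_real (exp (a * \<theta>)) * hit (exp \<theta>) \<partial>lborel)"
  proof (rule integral_dominated_convergence[where w = "\<lambda>\<theta>. norm (of_real (exp (a * \<theta>)) * hit (exp \<theta>))"])
    show "integrable lborel (\<lambda>\<theta>. norm (of_real (exp (a * \<theta>)) * hit (exp \<theta>)))"
      by (intro integrable_norm Mellin_hit_integrable a)
    show "AE \<theta> in lborel. (\<lambda>n. of_real (exp (a * \<theta>)) * (of_real (exp (- b n * exp \<theta>)) * hit (exp \<theta>)))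
        \<longlonglongrightarrow> of_real (exp (a * \<theta>)) * hit (exp \<theta>)"
    proof (rule AE_I2)
      fix \<theta> :: real
      have "(\<lambda>n. of_real (exp (a * \<theta>)) * (of_real (exp (- b n * exp \<theta>)) * hit (exp \<theta>)))
        \<longlonglongrightarrow> of_real (exp (a * \<theta>)) * (of_real (exp (- 0 * exp \<theta>)) * hit (exp \<theta>))"
        by (intro tendsto_intros b0)
      thus "(\<lambda>n. of_real (exp (a * \<theta>)) * (of_real (exp (- b n * exp \<theta>)) * hit (exp \<theta>)))
        \<longlonglongrightarrow> of_real (exp (a * \<theta>)) * hit (exp \<theta>)" by simp
    qed
    show "AE \<theta> in lborel. norm (of_real (exp (a * \<theta>)) * (of_real (exp (- b n * exp \<theta>)) * hit (exp \<theta>)))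
        \<le> norm (of_real (exp (a * \<theta>)) * hit (exp \<theta>))" for n
    proof (rule AE_I2)
      fix \<theta> :: real
      have "exp (- b n * exp \<theta>) \<le> 1" using b[of n] by simp
      hence "exp (- b n * exp \<theta>) * (exp (a * \<theta>) * norm (hit (exp \<theta>))) \<le> 1 * (exp (a * \<theta>) * norm (hit (exp \<theta>)))"
        by (intro mult_right_mono) auto
      thus "norm (of_real (exp (a * \<theta>)) * (of_real (exp (- b n * exp \<theta>)) * hit (exp \<theta>)))
        \<le> norm (of_real (exp (a * \<theta>)) * hit (exp \<theta>))" by (simp add: norm_mult mult_ac)
    qed
  qed (unfold measurable_lborel2, (intro borel_measurable_continuous_onI continuous_intros hit_exp_continuous)+)
  \<comment> \<open>The limit i (sinh u - u) has argument \<pi>/2 for u > 0 and - \<pi>/2 for u < 0;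
    w is the phase factor of its power -a on the positive side.\<close>
  define w where "w = cis (- (pi * a / 2))"
  \<comment> \<open>If sinh |u| b^2 is at most the gap sinh |u| - |u|, then cos b \<ge> 1 - b^2/2
    keeps half of the gap in the imaginary part. Otherwise half of the gap is below sinh |u| b^2 /
    2, which the real part cosh u sin b exceeds.\<close>
  have lower: "norm (Q (b n) u) \<ge> (sinh \<bar>u\<bar> - \<bar>u\<bar>) / 2" for n u
  proof (cases "sinh \<bar>u\<bar> * (b n)\<^sup>2 \<le> sinh \<bar>u\<bar> - \<bar>u\<bar>")
    case True
    have "cos (b n) \<ge> 1 - (b n)\<^sup>2 / 2" by (rule cos_ge_quadratic)
    hence "sinh \<bar>u\<bar> * cos (b n) \<ge> sinh \<bar>u\<bar> * (1 - (b n)\<^sup>2 / 2)" by (intro mult_left_mono) auto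
    moreover have "(S - v) / 2 \<le> S * c - v" if "S * (1 - d / 2) \<le> S * c" "S * d \<le> S - v" for S c d v :: real
      using that by (simp add: right_diff_distrib)
    ultimately have "sinh \<bar>u\<bar> * cos (b n) - \<bar>u\<bar> \<ge> (sinh \<bar>u\<bar> - \<bar>u\<bar>) / 2" using True by blast
    moreover have "\<bar>Im (Q (b n) u)\<bar> = \<bar>sinh \<bar>u\<bar> * cos (b n) - \<bar>u\<bar>\<bar>"
      by (cases "u \<ge> 0") (auto simp: Q abs_if)
    ultimately show ?thesis using abs_Im_le_cmod[of "Q (b n) u"] by linarith
  next
    case False
    have "sinh \<bar>u\<bar> * ((b n)\<^sup>2 / 2) \<le> cosh u * sin (b n)"
    proof (rule mult_mono)
      show "sinh \<bar>u\<bar> \<le> cosh u" using sinh_le_cosh_real[of "\<bar>u\<bar>"] by simp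
      have "(b n)\<^sup>2 \<le> b n" using b[of n] by (simp add: power2_eq_square mult_left_le)
      thus "(b n)\<^sup>2 / 2 \<le> sin (b n)" using sin_ge_half[of "b n"] b[of n] by simp
    qed auto
    hence "Re (Q (b n) u) \<ge> (sinh \<bar>u\<bar> - \<bar>u\<bar>) / 2" using False by (simp add: Q)
    thus ?thesis using complex_Re_le_cmod[of "Q (b n) u"] by linarith
  qed
  have R: "(\<lambda>n. \<integral>u. Q (b n) u powr (- of_real a) \<partial>lborel) \<longlonglongrightarrow> (\<integral>u. of_real (psi a u) * (if u > 0 then w else cnj w) \<partial>lborel)"
  proof (rule integral_dominated_convergence[where w = "\<lambda>u. 2 powr a * psi a u"])
    show "integrable lborel (\<lambda>u. 2 powr a * psi a u)" by (intro integrable_mult_right psi_integrable a)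
    show "(\<lambda>u. of_real (psi a u) * (if u > 0 then w else cnj w)) \<in> borel_measurable lborel"
      using psi_twisted_integral(1)[OF a, of w] by auto
    show "(\<lambda>u. Q (b n) u powr (- of_real a)) \<in> borel_measurable lborel" for n
    proof -
      have "0 \<le> Re (Q (b n) u) \<and> Q (b n) u \<noteq> 0" for u
        using b[of n] sin_ge_half[of "b n"] by (auto simp: Q complex_eq_iff)
      thus ?thesis
        unfolding measurable_lborel2 Q_def[abs_def]
        by (intro borel_measurable_continuous_onI continuous_intros continuous_on_phase_line) auto
    qed
    show "AE u in lborel. norm (Q (b n) u powr (- of_real a)) \<le> 2 powr a * psi a u" for n
    proof (rule AE_mp[OF AE_lborel_singleton[of 0]], intro AE_I2 impI)
      fix u :: real assume u: "u \<noteq> 0"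
      have "sinh \<bar>u\<bar> - \<bar>u\<bar> > 0" using sinh_ge_cubic[of "\<bar>u\<bar>"] u
        by (smt (verit) abs_le_zero_iff divide_pos_pos zero_less_power)
      moreover have "norm (Q (b n) u powr (- of_real a)) = norm (Q (b n) u) powr (- a)"
        by (subst norm_powr_real_powr') auto
      ultimately have "norm (Q (b n) u powr (- of_real a)) \<le> ((sinh \<bar>u\<bar> - \<bar>u\<bar>) / 2) powr (- a)"
        using lower[of u n] a by (auto intro!: powr_mono2')
      also have "\<dots> = 2 powr a * psi a u"
        using \<open>sinh \<bar>u\<bar> - \<bar>u\<bar> > 0\<close> by (simp add: psi_def powr_divide powr_minus field_simps)
      finally show "norm (Q (b n) u powr (- of_real a)) \<le> 2 powr a * psi a u" .
    qed
    show "AE u in lborel. (\<lambda>n. Q (b n) u powr (- of_real a)) \<longlonglongrightarrow> of_real (psi a u) * (if u > 0 then w else cnj w)"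
    proof (rule AE_mp[OF AE_lborel_singleton[of 0]], intro AE_I2 impI)
      fix u :: real assume u: "u \<noteq> 0"
      define r where "r = sinh \<bar>u\<bar> - \<bar>u\<bar>"
      have r: "r > 0" unfolding r_def using sinh_ge_cubic[of "\<bar>u\<bar>"] u
        by (smt (verit) abs_le_zero_iff divide_pos_pos zero_less_power)
      have q0: "\<i> * of_real (sinh u - u) \<notin> \<real>\<^sub>\<le>\<^sub>0"
        using r by (cases "u > 0") (auto simp: r_def complex_nonpos_Reals_iff)
      have "(\<lambda>n. Q (b n) u) \<longlonglongrightarrow> Q 0 u"
        unfolding Q Complex_eq by (intro tendsto_intros b0)
      moreover have "Q 0 u = \<i> * of_real (sinh u - u)" by (simp add: Q complex_eq_iff)
      ultimately have "(\<lambda>n. Q (b n) u) \<longlonglongrightarrow> \<i> * of_real (sinh u - u)" by simp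
      hence lim: "(\<lambda>n. Q (b n) u powr (- of_real a)) \<longlonglongrightarrow> (\<i> * of_real (sinh u - u)) powr (- of_real a)"
        by (intro tendsto_powr_complex q0 tendsto_const)
      have psi_r: "of_real (psi a u) = exp (complex_of_real (- a * ln r))"
      proof -
        have "psi a u = r powr (- a)" by (simp only: psi_def r_def)
        thus ?thesis using r by (simp add: powr_def flip: exp_of_real)
      qed
      have "(\<i> * of_real (sinh u - u)) powr (- of_real a) = of_real (psi a u) * (if u > 0 then w else cnj w)"
      proof (cases "u > 0")
        case True
        hence e: "sinh u - u = r" by (simp add: r_def)
        have "Ln (\<i> * of_real r) = of_real (ln r) + \<i> * of_real pi / 2"
          using Ln_times_of_real[OF r, of "\<i>"] r by (simp add: mult.commute Ln_of_real)
        hence "(\<i> * of_real r) powr (- of_real a) = exp (of_real (- a * ln r)) * exp (\<i> * of_real (- (pi * a / 2)))"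
          using r by (simp add: powr_def exp_add[symmetric] algebra_simps)
        thus ?thesis using True unfolding e psi_r by (simp add: w_def cis_conv_exp)
      next
        case False
        hence e: "sinh u - u = - r" by (simp add: r_def)
        have Ln_eq: "Ln (- \<i> * of_real r) = of_real (ln r) - \<i> * of_real pi / 2"
          using Ln_times_of_real[OF r, of "- \<i>"] r by (simp add: mult.commute Ln_of_real)
        have "(\<i> * of_real (- r)) powr (- of_real a) = exp (- of_real a * Ln (- \<i> * of_real r))"
          using r by (simp add: powr_def)
        also have "\<dots> = exp (of_real (- a * ln r)) * exp (\<i> * of_real (pi * a / 2))"
          unfolding Ln_eq exp_add[symmetric] by (rule arg_cong[where f = exp]) (simp add: algebra_simps)
        finally have "(\<i> * of_real (- r)) powr (- of_real a) = exp (of_real (- a * ln r)) * exp (\<i> * of_real (pi * a / 2))" .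
        moreover have "cnj w = exp (\<i> * of_real (pi * a / 2))"
          unfolding w_def cis_cnj minus_minus by (rule cis_conv_exp)
        ultimately show ?thesis using False unfolding e psi_r by simp
      qed
      with lim show "(\<lambda>n. Q (b n) u powr (- of_real a)) \<longlonglongrightarrow> of_real (psi a u) * (if u > 0 then w else cnj w)"
        by simp
    qed
  qed
  have "(\<lambda>n. of_real (Gamma a) / of_real pi * (\<integral>u. Q (b n) u powr (- of_real a) \<partial>lborel))
     \<longlonglongrightarrow> of_real (Gamma a) / of_real pi * (\<integral>u. of_real (psi a u) * (if u > 0 then w else cnj w) \<partial>lborel)"
    by (intro tendsto_mult tendsto_const R)
  with L have "(\<integral>\<theta>. of_real (exp (a * \<theta>)) * hit (exp \<theta>) \<partial>lborel) =
      of_real (Gamma a) / of_real pi * (\<integral>u. of_real (psi a u) * (if u > 0 then w else cnj w) \<partial>lborel)"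
    unfolding key by (rule LIMSEQ_unique)
  thus ?thesis unfolding psi_twisted_integral(2)[OF a] by (simp add: w_def)
qed

section \<open>A logarithm of the phase\<close>

text \<open>The quotient (sinh z - z) / z^3, given by its power series so that 0 is an ordinary
  point, with value 1/6.\<close>

definition sinhc :: "complex \<Rightarrow> complex" where
  "sinhc z = (\<Sum>n. (if even n then 1 / fact (n + 3) else 0) * z ^ n)"

lemma summable_sinhc: "summable (\<lambda>n. (if even n then 1 / fact (n + 3) else 0) * z ^ n :: complex)"
proof (rule summable_comparison_test'[OF summable_exp_series[of 1 "norm z"], where N = 0])
  fix n :: nat
  have "norm ((if even n then 1 / fact (n + 3) else 0) * z ^ n :: complex) \<le> norm z ^ n / fact (n + 3)"
    by (simp add: norm_mult norm_divide norm_power)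
  also have "\<dots> \<le> norm z ^ n / fact n"
    by (intro divide_left_mono fact_mono) auto
  finally show "norm ((if even n then 1 / fact (n + 3) else 0) * z ^ n :: complex) \<le> 1 * (norm z ^ n / fact n)" by simp
qed

lemma sinhc_holomorphic: "sinhc holomorphic_on A"
proof -
  have "(sinhc has_field_derivative (\<Sum>n. diffs (\<lambda>n. if even n then 1 / fact (n + 3) else 0) n * z ^ n)) (at z)" for z
    unfolding sinhc_def[abs_def] by (rule termdiffs_strong_converges_everywhere) (rule summable_sinhc)
  thus ?thesis
    by (auto simp: holomorphic_on_def field_differentiable_def intro: has_field_derivative_at_within)
qed

lemma sinhc_cube: "z ^ 3 * sinhc z = sinh z - z"
proof -
  let ?f = "\<lambda>n. if even n then 0 else z ^ n /\<^sub>R fact n"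
  have "summable ?f" using sinh_converges[of z] by (rule sums_summable)
  from suminf_split_initial_segment[OF this, of 3]
  have "sinh z = (\<Sum>n. ?f (n + 3)) + (\<Sum>n<3. ?f n)"
    using sinh_converges[of z] by (simp only: sums_iff)
  moreover have "(\<Sum>n<3. ?f n) = z" by (simp add: eval_nat_numeral)
  moreover have "?f (n + 3) = z ^ 3 * ((if even n then 1 / fact (n + 3) else 0) * z ^ n)" for n
    by (simp add: scaleR_conv_of_real power_add field_simps)
  ultimately have "sinh z = (\<Sum>n. z ^ 3 * ((if even n then 1 / fact (n + 3) else 0) * z ^ n)) + z"
    by simp
  also have "(\<Sum>n. z ^ 3 * ((if even n then 1 / fact (n + 3) else 0) * z ^ n)) = z ^ 3 * sinhc z"
    unfolding sinhc_def by (rule suminf_mult[OF summable_sinhc])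
  finally show ?thesis by simp
qed

lemma sinhc_0: "sinhc 0 = 1 / 6"
  unfolding sinhc_def by (subst suminf_finite[where N = "{0}"]) (auto simp: eval_nat_numeral)

lemma sinhc_minus: "sinhc (- z) = sinhc z"
  unfolding sinhc_def by (intro suminf_cong) (auto simp: power_minus_even)

lemma sinhc_nonzero_eq: "z \<noteq> 0 \<Longrightarrow> sinhc z = (sinh z - z) / z ^ 3"
  using sinhc_cube[of z] by (simp add: field_simps)

lemma phase_sinhc: "phase z = (- \<i> * z) ^ 3 * sinhc z"
proof -
  have "(- \<i> * z) ^ 3 = \<i> * z ^ 3"
    by (simp add: power3_eq_cube mult_ac)
  thus ?thesis by (simp add: phase_def sinhc_cube[symmetric] mult_ac)
qed

lemma sin_less_id:
  fixes y :: real
  assumes "y > 0"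
  shows "sin y < y"
proof (cases "y \<le> 1")
  case True
  have "sin (y / 2) > 0" using assms True pi_ge_two by (intro sin_gt_zero) linarith+
  moreover have "cos (y / 2) < cos 0" using assms True pi_ge_two by (intro cos_monotone_0_pi) linarith+
  ultimately have "sin (y / 2) * cos (y / 2) < sin (y / 2) * 1" by (intro mult_strict_left_mono) auto
  moreover have "sin y = 2 * sin (y / 2) * cos (y / 2)" using sin_double[of "y / 2"] by simp
  moreover have "sin (y / 2) \<le> y / 2" using assms by (intro sin_x_le_x) auto
  ultimately show ?thesis by linarith
qed (use sin_le_one[of y] in linarith)

lemma sinh_less_id_cosh:
  fixes x :: real
  assumes "x > 0"
  shows "sinh x < x * cosh x"
proof -
  define f where "f x = x * cosh x - sinh x" for x :: real
  have "f 0 < f x"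
  proof (rule DERIV_pos_imp_increasing_open[OF assms])
    fix y :: real assume y: "0 < y" "y < x"
    have "(f has_real_derivative (y * sinh y)) (at y)"
      unfolding f_def by (auto intro!: derivative_eq_intros)
    moreover have "y * sinh y > 0" using y by simp
    ultimately show "\<exists>d. (f has_real_derivative d) (at y) \<and> 0 < d" by blast
  qed (auto simp: f_def intro!: continuous_intros)
  thus ?thesis by (simp add: f_def)
qed

lemma id_cos_le_sin:
  fixes y :: real
  assumes "0 \<le> y" "y \<le> pi"
  shows "y * cos y \<le> sin y"
proof -
  define f where "f y = sin y - y * cos y" for y :: real
  have "f 0 \<le> f y"
  proof (rule DERIV_nonneg_imp_nondecreasing[OF assms(1)])
    fix w :: real assume w: "0 \<le> w" "w \<le> y"
    have "(f has_real_derivative (w * sin w)) (at w)"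
      unfolding f_def by (auto intro!: derivative_eq_intros)
    moreover have "w * sin w \<ge> 0" using w assms by (intro mult_nonneg_nonneg sin_ge_zero) auto
    ultimately show "\<exists>d. (f has_real_derivative d) (at w) \<and> 0 \<le> d" by blast
  qed
  thus ?thesis by (simp add: f_def)
qed

text \<open>For x, y > 0 the second equation makes sin y positive, hence y < \<pi>. Then x y = sinh
  x cos y y \<le> sinh x sin y < x cosh x sin y = x y, a contradiction; the two inequalities are y
  cos y \<le> sin y and sinh x < x cosh x.\<close>

lemma sinh_eq_id_real_imag:
  fixes x y :: real
  assumes x: "x \<ge> 0" and y: "0 \<le> y" "y < 2 * pi"
    and eqs: "sinh x * cos y = x" "cosh x * sin y = y"
  shows "x = 0 \<and> y = 0"
proof (cases "y = 0")
  case True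
  hence "sinh x - x = 0" using eqs by simp
  hence "x ^ 3 \<le> 0" using sinh_ge_cubic[OF x] by simp
  thus ?thesis using x True by (simp add: power_le_zero_eq)
next
  case False
  hence y0: "y > 0" using y by simp
  have "sin y > 0" using eqs(2) y0 cosh_real_pos[of x] by (metis zero_less_mult_pos)
  hence ypi: "y < pi" using sin_le_zero[of y] y by (cases "y < pi") auto
  show ?thesis
  proof (cases "x = 0")
    case True
    thus ?thesis using eqs(2) sin_less_id[OF y0] by simp
  next
    case False
    hence x0: "x > 0" using x by simp
    have "x * y = sinh x * cos y * y" using eqs by simp
    also have "\<dots> \<le> sinh x * sin y"
      using id_cos_le_sin[of y] y0 ypi x0 by (simp add: mult.assoc mult.commute[of _ y])
    also have "\<dots> < (x * cosh x) * sin y"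
      using sinh_less_id_cosh[OF x0] \<open>sin y > 0\<close> by (intro mult_strict_right_mono)
    also have "\<dots> = x * y" using eqs by (simp add: mult.assoc)
    finally show ?thesis by simp
  qed
qed

text \<open>In this strip sinh z = z only at the saddle 0. The equations for the real and the
  imaginary part are invariant under sign changes of x and of y, so the quadrant x, y \<ge> 0
  decides. The result provides the logarithm on which all powers of the phase rest.\<close>

lemma sinhc_nonzero:
  assumes "\<bar>Im z\<bar> < 2 * pi"
  shows "sinhc z \<noteq> 0"
proof (cases "z = 0")
  case False
  have "sinh z \<noteq> z"
  proof
    assume *: "sinh z = z"
    obtain x y where z: "z = Complex x y" by (cases z)
    have 1: "sinh x * cos y = x" "cosh x * sin y = y"
      using * by (auto simp: z sinh_Complex)
    have "sinh \<bar>x\<bar> * cos \<bar>y\<bar> = \<bar>x\<bar>" using 1(1) by (cases "x \<ge> 0") (auto simp: abs_if)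
    moreover have "cosh \<bar>x\<bar> * sin \<bar>y\<bar> = \<bar>y\<bar>" using 1(2) by (cases "y \<ge> 0") (auto simp: abs_if)
    ultimately have "\<bar>x\<bar> = 0 \<and> \<bar>y\<bar> = 0"
      by (intro sinh_eq_id_real_imag) (use assms in \<open>auto simp: z\<close>)
    thus False using False by (auto simp: z complex_eq_iff)
  qed
  thus ?thesis using False by (simp add: sinhc_nonzero_eq)
qed (simp add: sinhc_0)

text \<open>Values of f lie in the multiples of 2 \<pi> i, and different ones are at least 2 \<pi>
  apart, so f is constant on a connected set. This is used to identify branches: two continuous
  logarithms that agree at one point agree throughout.\<close>

lemma exp_lift_unique:
  fixes f :: "'a::topological_space \<Rightarrow> complex"
  assumes S: "connected S" and cont: "continuous_on S f" and e: "\<And>x. x \<in> S \<Longrightarrow> exp (f x) = 1"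
    and x0: "x0 \<in> S" "f x0 = 0" and x: "x \<in> S"
  shows "f x = 0"
proof -
  have "f constant_on S"
  proof (rule continuous_discrete_range_constant[OF S cont])
    fix x assume x: "x \<in> S"
    show "\<exists>e>0. \<forall>y. y \<in> S \<and> f y \<noteq> f x \<longrightarrow> e \<le> norm (f y - f x)"
    proof (intro exI[of _ "2 * pi"] conjI allI impI)
      fix y assume y: "y \<in> S \<and> f y \<noteq> f x"
      obtain m n :: int where "Re (f x) = 0" "Im (f x) = of_int (2 * m) * pi" "Re (f y) = 0" "Im (f y) = of_int (2 * n) * pi"
        using e[OF x] e[of y] y by (auto simp: exp_eq_1)
      hence d: "f y - f x = of_int (n - m) * (2 * of_real pi * \<i>)" and "n \<noteq> m"
        using y by (auto simp: complex_eq_iff algebra_simps)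
      hence "\<bar>real_of_int (n - m)\<bar> \<ge> 1" by linarith
      hence "1 * (2 * pi) \<le> \<bar>real_of_int (n - m)\<bar> * (2 * pi)" by (intro mult_right_mono) auto
      moreover have "norm (f y - f x) = \<bar>real_of_int (n - m)\<bar> * (2 * pi)"
        unfolding d norm_mult by (simp flip: of_int_diff)
      ultimately show "2 * pi \<le> norm (f y - f x)" by linarith
    qed auto
  qed
  thus ?thesis using x0 x by (auto simp: constant_on_def)
qed

abbreviation strip :: "complex set" where
  "strip \<equiv> {z. - (2 * pi) < Im z \<and> Im z < 2 * pi}"

lemma strip_open: "open strip" and strip_convex: "convex strip"
proof -
  show "open strip"
    by (intro open_Collect_conj open_halfspace_Im_gt open_halfspace_Im_lt)
  show "convex strip"
    using convex_Int[OF convex_halfspace_Im_gt[of "- (2 * pi)"] convex_halfspace_Im_lt[of "2 * pi"]]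
    by (simp add: Collect_conj_eq)
qed

definition sinhc_log :: "complex \<Rightarrow> complex" where
  "sinhc_log = (SOME L. L holomorphic_on strip \<and> (\<forall>z\<in>strip. exp (L z) = sinhc z) \<and> L 0 = of_real (ln (1 / 6)))"

lemma sinhc_log:
  shows sinhc_log_holomorphic: "sinhc_log holomorphic_on strip"
    and exp_sinhc_log: "z \<in> strip \<Longrightarrow> exp (sinhc_log z) = sinhc z"
    and sinhc_log_0: "sinhc_log 0 = of_real (ln (1 / 6))"
proof -
  obtain L where L: "L holomorphic_on strip" "\<And>z. z \<in> strip \<Longrightarrow> exp (L z) = sinhc z"
  proof (rule holomorphic_logarithm_exists[OF strip_convex strip_open sinhc_holomorphic])
    show "sinhc z \<noteq> 0" if "z \<in> strip" for z
      by (rule sinhc_nonzero) (use that in \<open>auto simp: abs_less_iff\<close>)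
    show "0 \<in> strip" by simp
  qed blast
  define L' where "L' z = L z - L 0 + of_real (ln (1 / 6))" for z
  have "L' holomorphic_on strip" unfolding L'_def by (intro holomorphic_intros L)
  moreover have "exp (L' z) = sinhc z" if "z \<in> strip" for z
  proof -
    have "exp (of_real (ln (1 / 6))) = (1 / 6 :: complex)" unfolding exp_of_real by simp
    moreover have "exp (L 0) = 1 / 6" using L(2)[of 0] by (simp add: sinhc_0)
    ultimately have "exp (of_real (ln (1 / 6))) = exp (L 0)" by (simp only:)
    thus ?thesis using L(2)[OF that] by (simp only: L'_def exp_add exp_diff) simp
  qed
  moreover have "L' 0 = of_real (ln (1 / 6))" by (simp add: L'_def)
  ultimately have "\<exists>L. L holomorphic_on strip \<and> (\<forall>z\<in>strip. exp (L z) = sinhc z) \<and> L 0 = of_real (ln (1 / 6))"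
    by blast
  from someI_ex[OF this, folded sinhc_log_def]
  show "sinhc_log holomorphic_on strip" "z \<in> strip \<Longrightarrow> exp (sinhc_log z) = sinhc z"
    "sinhc_log 0 = of_real (ln (1 / 6))" by auto
qed

lemma sinhc_log_continuous: "continuous_on A f \<Longrightarrow> f ` A \<subseteq> strip \<Longrightarrow> continuous_on A (\<lambda>x. sinhc_log (f x))"
  by (rule continuous_on_compose2[OF holomorphic_on_imp_continuous_on[OF sinhc_log_holomorphic]])

lemma sinhc_log_minus:
  assumes "z \<in> strip"
  shows "sinhc_log (- z) = sinhc_log z"
proof -
  have "sinhc_log (- z) - sinhc_log z = 0"
  proof (rule exp_lift_unique[OF convex_connected[OF strip_convex],
        where f = "\<lambda>z. sinhc_log (- z) - sinhc_log z" and x = z and ?x0.0 = 0])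
    show "continuous_on strip (\<lambda>z. sinhc_log (- z) - sinhc_log z)"
      by (intro continuous_intros sinhc_log_continuous) auto
    show "exp (sinhc_log (- z) - sinhc_log z) = 1" if "z \<in> strip" for z
    proof -
      have "- z \<in> strip" using that by auto
      moreover have "sinhc z \<noteq> 0" using exp_sinhc_log[OF that] exp_not_eq_zero by metis
      ultimately show ?thesis using that by (simp add: exp_diff exp_sinhc_log sinhc_minus)
    qed
  qed (use assms in auto)
  thus ?thesis by simp
qed

text \<open>Where \<open>sinhc\<close> is positive along a line through 0, the branch fixed at 0
  continues as the real logarithm. The directions d = 1 and d = i are used.\<close>

lemma sinhc_log_line:
  fixes d :: complex and g :: "real \<Rightarrow> real"
  assumes I: "connected I" "0 \<in> I" and sub: "\<And>t. t \<in> I \<Longrightarrow> of_real t * d \<in> strip"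
    and g: "\<And>t. t \<in> I \<Longrightarrow> sinhc (of_real t * d) = of_real (g t)"
    and pos: "\<And>t. t \<in> I \<Longrightarrow> g t > 0" and t: "t \<in> I"
  shows "sinhc_log (of_real t * d) = of_real (ln (g t))"
proof -
  have c: "continuous_on I (\<lambda>t. sinhc (of_real t * d))"
    by (rule continuous_on_compose2[OF holomorphic_on_imp_continuous_on[OF sinhc_holomorphic[of UNIV]]])
       (auto intro!: continuous_intros)
  have "continuous_on I (\<lambda>t. Re (sinhc (of_real t * d)))"
    by (intro continuous_intros c)
  hence gc: "continuous_on I g" by (rule continuous_on_eq) (use g in auto)
  have "sinhc_log (of_real t * d) - of_real (ln (g t)) = 0"
  proof (rule exp_lift_unique[OF I(1),
        where f = "\<lambda>t. sinhc_log (of_real t * d) - of_real (ln (g t))" and x = t and ?x0.0 = 0])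
    show "continuous_on I (\<lambda>t. sinhc_log (of_real t * d) - of_real (ln (g t)))"
      using pos sub by (intro continuous_intros sinhc_log_continuous gc) (auto simp: less_imp_neq dest: pos)
    show "exp (sinhc_log (of_real t * d) - of_real (ln (g t))) = 1" if "t \<in> I" for t
      using exp_sinhc_log[OF sub[OF that]] g[OF that] pos[OF that] by (simp add: exp_diff exp_of_real)
    have "complex_of_real (g 0) = of_real (1 / 6)" using g[OF I(2)] by (simp add: sinhc_0)
    hence "g 0 = 1 / 6" by (simp only: of_real_eq_iff)
    thus "sinhc_log (of_real 0 * d) - of_real (ln (g 0)) = 0" by (simp add: sinhc_log_0)
  qed (use I t in auto)
  thus ?thesis by simp
qed

lemma sinh_ratio_pos: "sinh_ratio t > 0"
proof (cases "t = 0")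
  case False
  have 1: "s ^ 3 / (sinh s - s) > 0" if "s > 0" for s :: real
  proof -
    have "s ^ 3 > 0" using that by simp
    moreover have "sinh s - s > 0" using sinh_ge_cubic[of s] that \<open>s ^ 3 > 0\<close> by linarith
    ultimately show ?thesis by simp
  qed
  show ?thesis
  proof (cases "t > 0")
    case True
    thus ?thesis using 1[of t] by (simp add: sinh_ratio_def)
  next
    case False
    have "(- t) ^ 3 / (sinh (- t) - (- t)) = (- (t ^ 3)) / (- (sinh t - t))"
      by simp
    also have "\<dots> = t ^ 3 / (sinh t - t)" by (rule minus_divide_divide)
    finally have "(- t) ^ 3 / (sinh (- t) - (- t)) = t ^ 3 / (sinh t - t)" .
    thus ?thesis using 1[of "- t"] False \<open>t \<noteq> 0\<close> by (simp add: sinh_ratio_def)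
  qed
qed (simp add: sinh_ratio_def)

lemma sinh_of_real: "sinh (of_real x) = complex_of_real (sinh x)"
  by (simp add: sinh_field_def exp_of_real flip: of_real_minus)

lemma sinhc_log_real: "sinhc_log (of_real t) = of_real (- ln (sinh_ratio t))"
proof -
  have "sinhc_log (of_real t * 1) = of_real (ln (inverse (sinh_ratio t)))"
  proof (rule sinhc_log_line[where I = UNIV])
    show "sinhc (of_real t * 1) = of_real (inverse (sinh_ratio t))" for t
      by (cases "t = 0") (auto simp: sinhc_0 sinhc_nonzero_eq sinh_ratio_def sinh_of_real)
  qed (auto simp: sinh_ratio_pos)
  thus ?thesis using sinh_ratio_pos[of t] by (simp add: ln_inverse)
qed

lemma sinhc_log_imag:
  assumes "0 \<le> y" "y < 2 * pi"
  shows "sinhc_log (of_real y * \<i>) \<in> \<real>"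
proof -
  define g where "g y = (if y = 0 then 1 / 6 else (y - sin y) / y ^ 3)" for y :: real
  have "sinhc_log (of_real y * \<i>) = of_real (ln (g y))"
  proof (rule sinhc_log_line[where I = "{0..<2 * pi}"])
    show "sinhc (of_real t * \<i>) = of_real (g t)" for t
    proof (cases "t = 0")
      case False
      have "of_real t * \<i> = Complex 0 t" by (simp add: complex_eq_iff)
      moreover have "sinh (Complex 0 t) - Complex 0 t = of_real (sin t - t) * \<i>"
        unfolding sinh_Complex by (simp add: complex_eq_iff)
      moreover have "Complex 0 t ^ 3 = - (of_real t ^ 3 * \<i>)"
        by (simp add: power3_eq_cube complex_eq_iff)
      moreover have "Complex 0 t \<noteq> 0" using False by (simp add: complex_eq_iff)
      ultimately have "sinhc (of_real t * \<i>) = (of_real (sin t - t) * \<i>) / - (of_real t ^ 3 * \<i>)"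
        using sinhc_nonzero_eq[of "Complex 0 t"] by (simp only:) simp
      also have "\<dots> = of_real ((t - sin t) / t ^ 3)"
        using False by (simp add: field_simps)
      finally show ?thesis using False by (simp add: g_def)
    qed (simp add: g_def sinhc_0)
    show "g t > 0" if "t \<in> {0..<2 * pi}" for t
      using that sin_less_id[of t] by (auto simp: g_def)
  qed (use assms pi_gt_zero in auto)
  thus ?thesis by simp
qed

text \<open>A logarithm of the phase, from phase z = (- i z)^3 sinhc z. The principal logarithm of -
  i z has its cut along the negative imaginary axis, so this branch is holomorphic in the upper half
  of the strip and continuous up to the real axis except at 0.\<close>

definition phase_log :: "complex \<Rightarrow> complex" where
  "phase_log z = sinhc_log z + 3 * Ln (- \<i> * z)"

lemma exp_phase_log:
  assumes "z \<in> strip" "z \<noteq> 0"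
  shows "exp (phase_log z) = phase z"
proof -
  have "exp (3 * Ln (- \<i> * z)) = (- \<i> * z) ^ 3"
    using assms by (simp add: exp_of_nat_mult[of 3, simplified])
  thus ?thesis by (simp add: phase_log_def exp_add exp_sinhc_log[OF assms(1)] phase_sinhc)
qed

lemma upper_in_slit: "Im z > 0 \<Longrightarrow> - \<i> * z \<notin> \<real>\<^sub>\<le>\<^sub>0"
  by (simp add: complex_nonpos_Reals_iff)

lemma phase_log_holomorphic: "phase_log holomorphic_on {z. 0 < Im z \<and> Im z < 2 * pi}"
  unfolding phase_log_def
  by (intro holomorphic_intros holomorphic_on_subset[OF sinhc_log_holomorphic])
     (use upper_in_slit pi_gt_zero in \<open>auto simp del: complex_nonpos_Reals_iff\<close>)

text \<open>On this line the phase has positive real part, so its principal logarithm is continuous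
  and \<open>exp_lift_unique\<close> applies. The branches are compared at z = 3 \<pi> i / 2: both
  logarithms are real there, and a real difference with exponential 1 is 0.\<close>

lemma phase_log_upper_line: "phase_log (Complex x (3 * pi / 2)) = Ln (phase (Complex x (3 * pi / 2)))"
proof -
  let ?z = "\<lambda>x. Complex x (3 * pi / 2)"
  have re: "Re (phase (?z x)) > 0" for x
    unfolding phase_add_2pi_i by (simp add: phase_Complex add_pos_pos)
  have zin: "?z x \<in> strip" "?z x \<noteq> 0" for x using pi_gt_zero by (auto simp: complex_eq_iff)
  have "phase_log (?z x) - Ln (phase (?z x)) = 0"
  proof (rule exp_lift_unique[where S = UNIV
        and f = "\<lambda>x. phase_log (?z x) - Ln (phase (?z x))" and x = x and ?x0.0 = 0])
    show "continuous_on UNIV (\<lambda>x. phase_log (?z x) - Ln (phase (?z x)))"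
    proof (intro continuous_intros continuous_on_phase_line)
      show "continuous_on UNIV (\<lambda>x. phase_log (?z x))"
        by (rule continuous_on_compose2[OF holomorphic_on_imp_continuous_on[OF phase_log_holomorphic]])
           (use pi_gt_zero in \<open>auto intro!: continuous_intros\<close>)
      show "phase (?z x) \<notin> \<real>\<^sub>\<le>\<^sub>0" for x
        using re[of x] by (auto simp: complex_nonpos_Reals_iff)
    qed
    show e: "exp (phase_log (?z x) - Ln (phase (?z x))) = 1" for x
    proof -
      have "phase (?z x) \<noteq> 0" using re[of x] by auto
      thus ?thesis using exp_phase_log[OF zin] by (simp add: exp_diff)
    qed
    have z0: "?z 0 = of_real (3 * pi / 2) * \<i>" by (simp add: complex_eq_iff)
    have "phase_log (?z 0) - Ln (phase (?z 0)) \<in> \<real>"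
    proof (intro Reals_diff)
      have "Ln (- \<i> * ?z 0) = of_real (ln (3 * pi / 2))"
      proof -
        have eq: "- \<i> * ?z 0 = of_real (3 * pi / 2)" by (simp add: complex_eq_iff)
        show ?thesis unfolding eq by (rule Ln_of_real) simp
      qed
      thus "phase_log (?z 0) \<in> \<real>"
        unfolding phase_log_def by (simp add: z0 sinhc_log_imag del: of_real_divide of_real_mult)
      have ph: "phase (?z 0) = of_real (Re (phase (?z 0)))"
        by (simp add: phase_Complex complex_eq_iff)
      show "Ln (phase (?z 0)) \<in> \<real>"
        by (subst ph, subst Ln_of_real) (use re[of 0] in auto)
    qed
    then obtain r where r: "phase_log (?z 0) - Ln (phase (?z 0)) = of_real r" by (auto elim: Reals_cases)
    have "complex_of_real (exp r) = of_real 1" using e[of 0] unfolding r by (simp add: exp_of_real)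
    hence "r = 0" by (simp only: of_real_eq_iff) simp
    thus "phase_log (?z 0) - Ln (phase (?z 0)) = 0" using r by simp
  qed auto
  thus ?thesis by simp
qed

section \<open>Lower bounds for the phase and decay of its powers in the strip\<close>

lemma norm_phase_ge: "norm (phase (Complex x y)) \<ge> sinh \<bar>x\<bar> - \<bar>x\<bar> - \<bar>y\<bar>"
proof -
  have "(sinh \<bar>x\<bar>)\<^sup>2 \<le> (norm (sinh (Complex x y)))\<^sup>2"
  proof -
    have "(norm (sinh (Complex x y)))\<^sup>2 = (sinh x)\<^sup>2 * (cos y)\<^sup>2 + (cosh x)\<^sup>2 * (sin y)\<^sup>2"
      by (simp add: sinh_Complex cmod_power2 power_mult_distrib)
    also have "\<dots> = (sinh x)\<^sup>2 * ((cos y)\<^sup>2 + (sin y)\<^sup>2) + (sin y)\<^sup>2"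
      unfolding cosh_square_eq by algebra
    finally show ?thesis by simp
  qed
  hence "sinh \<bar>x\<bar> \<le> norm (sinh (Complex x y))" by (rule power2_le_imp_le) simp
  moreover have "norm (Complex x y) \<le> \<bar>x\<bar> + \<bar>y\<bar>" by (rule cmod_le[of "Complex x y", simplified])
  moreover have "norm (sinh (Complex x y)) - norm (Complex x y) \<le> norm (sinh (Complex x y) - Complex x y)"
    by (rule norm_triangle_ineq2)
  ultimately show ?thesis by (simp add: phase_def norm_mult)
qed

text \<open>Far out the exponential growth of sinh beats |x| and the largest height 3 \<pi> / 2. On
  the remaining compact rectangle \<open>sinhc\<close> has no zero, so its modulus has a positive
  minimum c, and |phase z| = |z|^3 |sinhc z|.\<close>

lemma phase_lower_bound:
  obtains R c where "R > 0" "c > 0"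
    "\<And>x y. \<bar>y\<bar> \<le> 3 * pi / 2 \<Longrightarrow> \<bar>x\<bar> \<ge> R \<Longrightarrow> norm (phase (Complex x y)) \<ge> exp \<bar>x\<bar> / 4"
    "\<And>x y. \<bar>y\<bar> \<le> 3 * pi / 2 \<Longrightarrow> \<bar>x\<bar> \<le> R \<Longrightarrow> norm (phase (Complex x y)) \<ge> c * norm (Complex x y) ^ 3"
proof -
  have "eventually (\<lambda>X::real. (exp X - exp (- X)) / 2 - X - 3 * pi / 2 \<ge> exp X / 4) at_top"
    by real_asymp
  then obtain R0 where R0: "\<And>X::real. X \<ge> R0 \<Longrightarrow> (exp X - exp (- X)) / 2 - X - 3 * pi / 2 \<ge> exp X / 4"
    by (auto simp: eventually_at_top_linorder)
  define R where "R = max R0 1"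
  define K where "K = cbox (Complex (- R) (- (3 * pi / 2))) (Complex R (3 * pi / 2))"
  have Kne: "Complex 0 0 \<in> K" by (simp add: K_def in_cbox_complex_iff R_def)
  have "continuous_on K (\<lambda>z. norm (sinhc z))"
    by (intro continuous_intros holomorphic_on_imp_continuous_on sinhc_holomorphic)
  then obtain z0 where z0: "z0 \<in> K" "\<And>z. z \<in> K \<Longrightarrow> norm (sinhc z0) \<le> norm (sinhc z)"
    using continuous_attains_inf[of K "\<lambda>z. norm (sinhc z)"] Kne unfolding K_def by (metis compact_cbox empty_iff)
  have "\<bar>Im z0\<bar> \<le> 3 * pi / 2" using z0(1) by (auto simp: K_def in_cbox_complex_iff abs_le_iff)
  hence "\<bar>Im z0\<bar> < 2 * pi" using pi_gt_zero by linarith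
  hence c: "norm (sinhc z0) > 0" using sinhc_nonzero by simp
  show ?thesis
  proof (rule that[of R "norm (sinhc z0)"])
    fix x y :: real assume y: "\<bar>y\<bar> \<le> 3 * pi / 2"
    show "norm (phase (Complex x y)) \<ge> exp \<bar>x\<bar> / 4" if "\<bar>x\<bar> \<ge> R"
    proof -
      have "exp \<bar>x\<bar> / 4 \<le> (exp \<bar>x\<bar> - exp (- \<bar>x\<bar>)) / 2 - \<bar>x\<bar> - 3 * pi / 2"
        by (rule R0) (use that in \<open>simp add: R_def\<close>)
      also have "\<dots> = sinh \<bar>x\<bar> - \<bar>x\<bar> - 3 * pi / 2" by (simp add: sinh_field_def)
      also have "\<dots> \<le> sinh \<bar>x\<bar> - \<bar>x\<bar> - \<bar>y\<bar>" using y by simp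
      also have "\<dots> \<le> norm (phase (Complex x y))" by (rule norm_phase_ge)
      finally show ?thesis .
    qed
    show "norm (phase (Complex x y)) \<ge> norm (sinhc z0) * norm (Complex x y) ^ 3" if "\<bar>x\<bar> \<le> R"
    proof -
      have "Complex x y \<in> K" using that y by (auto simp: K_def in_cbox_complex_iff abs_le_iff)
      from mult_left_mono[OF z0(2)[OF this], of "norm (Complex x y) ^ 3"]
      show ?thesis unfolding phase_sinhc norm_mult norm_power by (simp add: mult.commute)
    qed
  qed (use c in \<open>auto simp: R_def\<close>)
qed

text \<open>Three majorants for three purposes: uniform decay for the vertical sides of rectangles,
  a majorant independent of the height for the limit y to 0, and a bound without singularity for
  integrability on one fixed line off the real axis.\<close>

lemma norm_phase_powr_le_line:
  fixes a :: real
  assumes a: "a > 0"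
  obtains C R where "\<And>x y. R \<le> \<bar>x\<bar> \<Longrightarrow> \<bar>y\<bar> \<le> 3 * pi / 2 \<Longrightarrow> norm (phase (Complex x y)) powr (- a) \<le> 4 powr a * exp (- a * \<bar>x\<bar>)"
    "\<And>x y. \<bar>y\<bar> \<le> 3 * pi / 2 \<Longrightarrow> x \<noteq> 0 \<Longrightarrow> norm (phase (Complex x y)) powr (- a) \<le>
       C * (indicator {-R..R} x * \<bar>x\<bar> powr (- (3 * a))) + 4 powr a * exp (- a * \<bar>x\<bar>)"
    "\<And>x y. \<bar>y\<bar> \<le> 3 * pi / 2 \<Longrightarrow> y \<noteq> 0 \<Longrightarrow> norm (phase (Complex x y)) powr (- a) \<le>
       (C * \<bar>y\<bar> powr (- (3 * a)) * exp (a * R) + 4 powr a) * exp (- a * \<bar>x\<bar>)"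
    "R > 0"
proof -
  obtain R c where R: "R > 0" and c: "c > 0" and
    far: "\<And>x y. \<bar>y\<bar> \<le> 3 * pi / 2 \<Longrightarrow> \<bar>x\<bar> \<ge> R \<Longrightarrow> norm (phase (Complex x y)) \<ge> exp \<bar>x\<bar> / 4" and
    near: "\<And>x y. \<bar>y\<bar> \<le> 3 * pi / 2 \<Longrightarrow> \<bar>x\<bar> \<le> R \<Longrightarrow> norm (phase (Complex x y)) \<ge> c * norm (Complex x y) ^ 3"
    using phase_lower_bound by metis
  have F: "norm (phase (Complex x y)) powr (- a) \<le> 4 powr a * exp (- a * \<bar>x\<bar>)"
    if "\<bar>x\<bar> \<ge> R" "\<bar>y\<bar> \<le> 3 * pi / 2" for x y
  proof -
    have "norm (phase (Complex x y)) powr (- a) \<le> (exp \<bar>x\<bar> / 4) powr (- a)"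
      using far[OF that(2,1)] a by (intro powr_mono2') auto
    also have "\<dots> = 4 powr a * exp (- a * \<bar>x\<bar>)"
      by (simp add: powr_divide powr_minus exp_powr_real exp_minus field_simps)
    finally show ?thesis .
  qed
  have N: "norm (phase (Complex x y)) powr (- a) \<le> c powr (- a) * s powr (- (3 * a))"
    if "\<bar>x\<bar> \<le> R" "\<bar>y\<bar> \<le> 3 * pi / 2" "s > 0" "s \<le> norm (Complex x y)" for x y s
  proof -
    have "c * s ^ 3 \<le> c * norm (Complex x y) ^ 3" using that c by (intro mult_left_mono power_mono) auto
    also have "\<dots> \<le> norm (phase (Complex x y))" by (rule near) fact+
    finally have "norm (phase (Complex x y)) powr (- a) \<le> (c * s ^ 3) powr (- a)"
      using a c that by (intro powr_mono2') auto
    also have "s ^ 3 = s powr 3" using that by simp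
    also have "(c * s powr 3) powr (- a) = c powr (- a) * s powr (- (3 * a))"
      using c that by (simp add: powr_mult powr_powr del: powr_numeral)
    finally show ?thesis .
  qed
  show ?thesis
  proof (rule that[of R "c powr (- a)"])
    fix x y :: real assume y: "\<bar>y\<bar> \<le> 3 * pi / 2"
    show "norm (phase (Complex x y)) powr (- a) \<le>
       c powr (- a) * (indicator {-R..R} x * \<bar>x\<bar> powr (- (3 * a))) + 4 powr a * exp (- a * \<bar>x\<bar>)" if x: "x \<noteq> 0"
    proof (cases "\<bar>x\<bar> \<le> R")
      case True
      have "norm (phase (Complex x y)) powr (- a) \<le> c powr (- a) * \<bar>x\<bar> powr (- (3 * a))"
        using abs_Re_le_cmod[of "Complex x y"] x by (intro N True y) auto
      also have "\<dots> = c powr (- a) * (indicator {-R..R} x * \<bar>x\<bar> powr (- (3 * a)))"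
        using True by (auto simp: indicator_def abs_le_iff)
      also have "\<dots> \<le> \<dots> + 4 powr a * exp (- a * \<bar>x\<bar>)" by simp
      finally show ?thesis .
    next
      case False
      have "norm (phase (Complex x y)) powr (- a) \<le> 4 powr a * exp (- a * \<bar>x\<bar>)"
        using False y by (intro F) auto
      also have "\<dots> \<le> c powr (- a) * (indicator {-R..R} x * \<bar>x\<bar> powr (- (3 * a))) + 4 powr a * exp (- a * \<bar>x\<bar>)"
        by simp
      finally show ?thesis .
    qed
    show "norm (phase (Complex x y)) powr (- a) \<le>
       (c powr (- a) * \<bar>y\<bar> powr (- (3 * a)) * exp (a * R) + 4 powr a) * exp (- a * \<bar>x\<bar>)" if y0: "y \<noteq> 0"
    proof (cases "\<bar>x\<bar> \<le> R")
      case True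
      have "norm (phase (Complex x y)) powr (- a) \<le> c powr (- a) * \<bar>y\<bar> powr (- (3 * a)) * 1"
        using N[OF True y, of "\<bar>y\<bar>"] abs_Im_le_cmod[of "Complex x y"] y0 by simp
      also have "\<dots> \<le> c powr (- a) * \<bar>y\<bar> powr (- (3 * a)) * (exp (a * R) * exp (- a * \<bar>x\<bar>))"
        using True a by (intro mult_left_mono) (auto simp: exp_add[symmetric])
      also have "\<dots> \<le> \<dots> + 4 powr a * exp (- a * \<bar>x\<bar>)" by simp
      finally show ?thesis by (simp add: algebra_simps)
    next
      case False
      have "norm (phase (Complex x y)) powr (- a) \<le> 4 powr a * exp (- a * \<bar>x\<bar>)"
        using False y by (intro F) auto
      also have "\<dots> \<le> (c powr (- a) * \<bar>y\<bar> powr (- (3 * a)) * exp (a * R) + 4 powr a) * exp (- a * \<bar>x\<bar>)"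
        by (intro mult_right_mono) auto
      finally show ?thesis .
    qed
  qed (use F R in auto)
qed

definition phase_powr :: "real \<Rightarrow> complex \<Rightarrow> complex" where
  "phase_powr a z = exp (- of_real a * phase_log z)"

lemma norm_exp_real_multiple: "exp (w :: complex) = v \<Longrightarrow> norm (exp (- of_real a * w)) = norm v powr (- a)"
  by (auto simp: powr_def)

lemma norm_phase_powr:
  assumes "z \<in> strip" "z \<noteq> 0"
  shows "norm (phase_powr a z) = norm (phase z) powr (- a)"
  unfolding phase_powr_def by (rule norm_exp_real_multiple) (rule exp_phase_log[OF assms])

lemma phase_powr_holomorphic: "phase_powr a holomorphic_on {z. 0 < Im z \<and> Im z < 2 * pi}"
  unfolding phase_powr_def by (intro holomorphic_intros phase_log_holomorphic)

lemma phase_powr_upper_line: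
  "phase_powr a (Complex x (3 * pi / 2)) = phase (Complex x (3 * pi / 2)) powr (- of_real a)"
proof -
  have "phase (Complex x (3 * pi / 2)) = exp (phase_log (Complex x (3 * pi / 2)))"
    by (rule exp_phase_log[symmetric]) (use pi_gt_zero in \<open>auto simp: complex_eq_iff\<close>)
  hence "phase (Complex x (3 * pi / 2)) \<noteq> 0" by simp
  thus ?thesis by (simp add: phase_powr_def powr_def phase_log_upper_line)
qed

lemma phase_powr_line_integrable:
  fixes a y :: real
  assumes a: "a > 0" and y: "0 < y" "y \<le> 3 * pi / 2"
  shows "integrable lborel (\<lambda>x. phase_powr a (Complex x y))"
proof -
  obtain C R where C: "\<And>x y. \<bar>y\<bar> \<le> 3 * pi / 2 \<Longrightarrow> y \<noteq> 0 \<Longrightarrow> norm (phase (Complex x y)) powr (- a) \<le>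
       (C * \<bar>y\<bar> powr (- (3 * a)) * exp (a * R) + 4 powr a) * exp (- a * \<bar>x\<bar>)"
    using norm_phase_powr_le_line[OF a] by metis
  show ?thesis
  proof (rule Bochner_Integration.integrable_bound)
    show "integrable lborel (\<lambda>x. (C * \<bar>y\<bar> powr (- (3 * a)) * exp (a * R) + 4 powr a) * exp (- a * \<bar>x\<bar>))"
      by (intro integrable_mult_right integrable_exp_neg_abs a)
    show "(\<lambda>x. phase_powr a (Complex x y)) \<in> borel_measurable lborel"
      unfolding measurable_lborel2
      by (intro borel_measurable_continuous_onI
            continuous_on_compose2[OF holomorphic_on_imp_continuous_on[OF phase_powr_holomorphic[of a]]] continuous_intros)
         (use y pi_gt_zero in auto)
    show "AE x in lborel. norm (phase_powr a (Complex x y)) \<le>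
       norm ((C * \<bar>y\<bar> powr (- (3 * a)) * exp (a * R) + 4 powr a) * exp (- a * \<bar>x\<bar>))"
    proof (rule AE_I2)
      fix x
      have "norm (phase_powr a (Complex x y)) = norm (phase (Complex x y)) powr (- a)"
        by (rule norm_phase_powr) (use y pi_gt_zero in \<open>auto simp: complex_eq_iff\<close>)
      also have "\<dots> \<le> (C * \<bar>y\<bar> powr (- (3 * a)) * exp (a * R) + 4 powr a) * exp (- a * \<bar>x\<bar>)"
        by (rule C) (use y in auto)
      finally show "norm (phase_powr a (Complex x y)) \<le>
       norm ((C * \<bar>y\<bar> powr (- (3 * a)) * exp (a * R) + 4 powr a) * exp (- a * \<bar>x\<bar>))" by simp
    qed
  qed
qed

lemma exp_neg_tendsto: "a > 0 \<Longrightarrow> ((\<lambda>X. A * exp (- a * X)) \<longlongrightarrow> 0) at_top" for a A :: real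
  by real_asymp

lemma phase_powr_line_shift:
  fixes a y :: real
  assumes a: "a > 0" and y: "0 < y" "y < 3 * pi / 2"
  shows "(\<integral>x. phase_powr a (Complex x y) \<partial>lborel) = (\<integral>x. phase_powr a (Complex x (3 * pi / 2)) \<partial>lborel)"
proof -
  obtain R where R: "\<And>x y. R \<le> \<bar>x\<bar> \<Longrightarrow> \<bar>y\<bar> \<le> 3 * pi / 2 \<Longrightarrow> norm (phase (Complex x y)) powr (- a) \<le> 4 powr a * exp (- a * \<bar>x\<bar>)"
    using norm_phase_powr_le_line[OF a] by metis
  show ?thesis
  proof (rule strip_shift[where a = 0 and b = "2 * pi" and R = R and B = "\<lambda>x. 4 powr a * exp (- a * x)"])
    show "phase_powr a holomorphic_on {z. 0 < Im z \<and> Im z < 2 * pi}" by (rule phase_powr_holomorphic)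
    show "((\<lambda>x. 4 powr a * exp (- a * x)) \<longlongrightarrow> 0) at_top" by (rule exp_neg_tendsto[OF a])
    fix x y' assume *: "R \<le> \<bar>x\<bar>" "y \<le> y'" "y' \<le> 3 * pi / 2"
    have "norm (phase_powr a (Complex x y')) = norm (phase (Complex x y')) powr (- a)"
      by (rule norm_phase_powr) (use y * pi_gt_zero in \<open>auto simp: complex_eq_iff\<close>)
    also have "\<dots> \<le> 4 powr a * exp (- a * \<bar>x\<bar>)" by (rule R) (use * y in auto)
    finally show "norm (phase_powr a (Complex x y')) \<le> 4 powr a * exp (- a * \<bar>x\<bar>)" .
  qed (use a y pi_gt_zero in \<open>auto intro!: phase_powr_line_integrable\<close>)
qed

text \<open>Reached from above, - i x has argument - \<pi>/2 for x > 0 and \<pi>/2 for x < 0; cubing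
  gives - 3\<pi>/2 and 3\<pi>/2. Reached from below, the same values i (sinh x - x) had arguments
  \<pi>/2 and - \<pi>/2. Passing the branch point on the two sides is thus the origin of the two
  cosines in the Mellin ratio.\<close>

lemma phase_powr_boundary:
  assumes x: "x \<noteq> 0"
  shows "phase_powr a (Complex x 0) = of_real (psi a x) * (if x > 0 then cis (3 * pi * a / 2) else cnj (cis (3 * pi * a / 2)))"
proof -
  define r where "r = sinh \<bar>x\<bar> - \<bar>x\<bar>"
  have x3: "\<bar>x\<bar> ^ 3 > 0" using x by simp
  have r: "r > 0" unfolding r_def using sinh_ge_cubic[of "\<bar>x\<bar>"] x3 by linarith
  have sr: "sinh_ratio x = \<bar>x\<bar> ^ 3 / r"
  proof (cases "x > 0")
    case False
    have "x ^ 3 / (sinh x - x) = (- (\<bar>x\<bar> ^ 3)) / (- r)"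
      using False by (simp add: r_def abs_if power3_eq_cube)
    thus ?thesis using x by (simp add: sinh_ratio_def)
  qed (simp add: sinh_ratio_def r_def)
  have ln: "- ln (sinh_ratio x) + 3 * ln \<bar>x\<bar> = ln r"
    unfolding sr using r x3 x by (simp add: ln_div ln_realpow)
  have xc: "Complex x 0 = of_real x" by (simp add: complex_eq_iff)
  have psi_r: "of_real (psi a x) = exp (complex_of_real (- a * ln r))"
  proof -
    have "psi a x = r powr (- a)" by (simp only: psi_def r_def)
    thus ?thesis using r by (simp add: powr_def flip: exp_of_real)
  qed
  show ?thesis
  proof (cases "x > 0")
    case True
    have L: "Ln (- \<i> * of_real x) = of_real (ln \<bar>x\<bar>) - \<i> * of_real pi / 2"
      using Ln_times_of_real[OF True, of "- \<i>"] True by (simp add: mult.commute Ln_of_real)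
    have "phase_log (Complex x 0) = of_real (- ln (sinh_ratio x) + 3 * ln \<bar>x\<bar>) - \<i> * of_real (3 * pi / 2)"
      unfolding phase_log_def xc sinhc_log_real L by (simp add: algebra_simps)
    hence "phase_powr a (Complex x 0) = exp (of_real (- a * ln r)) * exp (\<i> * of_real (3 * pi * a / 2))"
      unfolding ln phase_powr_def exp_add[symmetric] by (simp only:) (rule arg_cong[where f = exp], simp add: algebra_simps)
    thus ?thesis using True psi_r by (simp add: cis_conv_exp)
  next
    case False
    hence nx: "- x > 0" using x by simp
    have "Ln (\<i> * of_real (- x)) = of_real (ln \<bar>x\<bar>) + \<i> * of_real pi / 2"
      using Ln_times_of_real[OF nx, of "\<i>"] Ln_of_real[OF nx] nx by (simp add: mult.commute abs_if)
    hence L: "Ln (- \<i> * of_real x) = of_real (ln \<bar>x\<bar>) + \<i> * of_real pi / 2" by simp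
    have "phase_log (Complex x 0) = of_real (- ln (sinh_ratio x) + 3 * ln \<bar>x\<bar>) + \<i> * of_real (3 * pi / 2)"
      unfolding phase_log_def xc sinhc_log_real L by (simp add: algebra_simps)
    hence "phase_powr a (Complex x 0) = exp (of_real (- a * ln r)) * exp (\<i> * of_real (- (3 * pi * a / 2)))"
      unfolding ln phase_powr_def exp_add[symmetric] by (simp only:) (rule arg_cong[where f = exp], simp add: algebra_simps)
    moreover have "cnj (cis (3 * pi * a / 2)) = exp (\<i> * of_real (- (3 * pi * a / 2)))"
      unfolding cis_cnj by (rule cis_conv_exp)
    ultimately show ?thesis using False psi_r by simp
  qed
qed

text \<open>The integral over Im z = 1/(n+1) does not depend on n and converges to the one over the
  real axis. The dominating function has the singularity |x|^(-3a), integrable because a <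
  1/3.\<close>

lemma upper_line_integral:
  assumes a: "0 < a" "a < 1 / 3"
  shows "(\<integral>x. phase (Complex x (3 * pi / 2)) powr (- of_real a) \<partial>lborel) = of_real (cos (3 * pi * a / 2) * (\<integral>u. psi a u \<partial>lborel))"
proof -
  obtain C R where R: "R > 0" and bound: "\<And>x y. \<bar>y\<bar> \<le> 3 * pi / 2 \<Longrightarrow> x \<noteq> 0 \<Longrightarrow> norm (phase (Complex x y)) powr (- a) \<le>
       C * (indicator {-R..R} x * \<bar>x\<bar> powr (- (3 * a))) + 4 powr a * exp (- a * \<bar>x\<bar>)"
    using norm_phase_powr_le_line[OF a(1)] by metis
  define y where "y n = 1 / real (Suc n)" for n
  have y: "0 < y n" "y n < 3 * pi / 2" "y n < 2 * pi" for n
  proof -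
    have "y n \<le> 1" by (simp add: y_def)
    thus "y n < 3 * pi / 2" "y n < 2 * pi" using pi_ge_two by linarith+
    show "0 < y n" by (simp add: y_def)
  qed
  have y0: "y \<longlonglongrightarrow> 0" unfolding y_def using LIMSEQ_inverse_real_of_nat by (simp add: inverse_eq_divide)
  let ?w = "cis (3 * pi * a / 2)"
  have "(\<lambda>n. \<integral>x. phase_powr a (Complex x (y n)) \<partial>lborel) \<longlonglongrightarrow> (\<integral>x. of_real (psi a x) * (if x > 0 then ?w else cnj ?w) \<partial>lborel)"
  proof (rule integral_dominated_convergence)
    show "integrable lborel (\<lambda>x. C * (indicator {-R..R} x * \<bar>x\<bar> powr (- (3 * a))) + 4 powr a * exp (- a * \<bar>x\<bar>))"
      by (rule integrable_singular_bound) (use a R in auto)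
    show "(\<lambda>x. of_real (psi a x) * (if x > 0 then ?w else cnj ?w)) \<in> borel_measurable lborel"
      using psi_twisted_integral(1)[OF a, of ?w] by auto
    show "(\<lambda>x. phase_powr a (Complex x (y n))) \<in> borel_measurable lborel" for n
      using phase_powr_line_integrable[OF a(1), of "y n"] y[of n] by auto
    show "AE x in lborel. norm (phase_powr a (Complex x (y n))) \<le> C * (indicator {-R..R} x * \<bar>x\<bar> powr (- (3 * a))) + 4 powr a * exp (- a * \<bar>x\<bar>)" for n
    proof (rule AE_mp[OF AE_lborel_singleton[of 0]], intro AE_I2 impI)
      fix x :: real assume x: "x \<noteq> 0"
      have "norm (phase_powr a (Complex x (y n))) = norm (phase (Complex x (y n))) powr (- a)"
        by (rule norm_phase_powr) (use x y[of n] pi_gt_zero in \<open>auto simp: complex_eq_iff intro: less_trans[of _ 0]\<close>)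
      also have "\<dots> \<le> C * (indicator {-R..R} x * \<bar>x\<bar> powr (- (3 * a))) + 4 powr a * exp (- a * \<bar>x\<bar>)"
        by (rule bound) (use x y[of n] in auto)
      finally show "norm (phase_powr a (Complex x (y n))) \<le> C * (indicator {-R..R} x * \<bar>x\<bar> powr (- (3 * a))) + 4 powr a * exp (- a * \<bar>x\<bar>)" .
    qed
    show "AE x in lborel. (\<lambda>n. phase_powr a (Complex x (y n))) \<longlonglongrightarrow> of_real (psi a x) * (if x > 0 then ?w else cnj ?w)"
    proof (rule AE_mp[OF AE_lborel_singleton[of 0]], intro AE_I2 impI)
      fix x :: real assume x: "x \<noteq> 0"
      have "isCont sinhc_log (Complex x 0)"
        using holomorphic_on_imp_continuous_on[OF sinhc_log_holomorphic] strip_open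
        by (auto simp: continuous_on_eq_continuous_at)
      moreover have "isCont (\<lambda>z. Ln (- \<i> * z)) (Complex x 0)"
        using x by (intro continuous_intros) (auto simp: complex_nonpos_Reals_iff)
      ultimately have "isCont phase_log (Complex x 0)"
        unfolding phase_log_def[abs_def] by (intro isCont_add isCont_mult continuous_const)
      hence "isCont (phase_powr a) (Complex x 0)"
        unfolding phase_powr_def[abs_def] by (intro continuous_intros)
      moreover have "(\<lambda>n. Complex x (y n)) \<longlonglongrightarrow> Complex x 0"
        unfolding Complex_eq using y0 by (auto intro!: tendsto_eq_intros)
      ultimately have "(\<lambda>n. phase_powr a (Complex x (y n))) \<longlonglongrightarrow> phase_powr a (Complex x 0)"
        by (rule isCont_tendsto_compose)
      thus "(\<lambda>n. phase_powr a (Complex x (y n))) \<longlonglongrightarrow> of_real (psi a x) * (if x > 0 then ?w else cnj ?w)"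
        unfolding phase_powr_boundary[OF x] .
    qed
  qed
  moreover have "(\<integral>x. phase_powr a (Complex x (y n)) \<partial>lborel) = (\<integral>x. phase (Complex x (3 * pi / 2)) powr (- of_real a) \<partial>lborel)" for n
    using phase_powr_line_shift[OF a(1) y(1,2)] by (simp add: phase_powr_upper_line)
  ultimately have "(\<lambda>n. \<integral>x. phase (Complex x (3 * pi / 2)) powr (- of_real a) \<partial>lborel) \<longlonglongrightarrow>
      (\<integral>x. of_real (psi a x) * (if x > 0 then ?w else cnj ?w) \<partial>lborel)" by simp
  hence "(\<integral>x. phase (Complex x (3 * pi / 2)) powr (- of_real a) \<partial>lborel) = (\<integral>x. of_real (psi a x) * (if x > 0 then ?w else cnj ?w) \<partial>lborel)"
    by (rule LIMSEQ_unique[OF tendsto_const])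
  thus ?thesis unfolding psi_twisted_integral(2)[OF a] by simp
qed

section \<open>The coefficients\<close>

text \<open>Needed because \<open>dcoef\<close> is defined by real derivatives, whereas the residue
  is expressed by complex ones.\<close>

lemma higher_deriv_of_real:
  fixes F :: "complex \<Rightarrow> complex" and f :: "real \<Rightarrow> real"
  assumes S: "open S" "range complex_of_real \<subseteq> S" and holo: "F holomorphic_on S"
    and eq: "\<And>t. F (of_real t) = of_real (f t)"
  shows "(deriv ^^ k) F (of_real t) = of_real ((deriv ^^ k) f t)"
proof (induction k arbitrary: t)
  case (Suc k)
  let ?G = "(deriv ^^ k) F" and ?g = "(deriv ^^ k) f"
  have "?G holomorphic_on S" by (rule holomorphic_higher_deriv[OF holo S(1)])
  hence "(?G has_field_derivative deriv ?G (of_real t)) (at (of_real t))"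
    by (rule holomorphic_derivI[OF _ S(1)]) (use S(2) in auto)
  hence "((\<lambda>t. ?G (of_real t)) has_vector_derivative deriv ?G (of_real t)) (at t)"
    by (rule has_vector_derivative_real_field)
  hence v: "((\<lambda>t. complex_of_real (?g t)) has_vector_derivative deriv ?G (of_real t)) (at t)"
    unfolding Suc.IH .
  have r: "(?g has_vector_derivative Re (deriv ?G (of_real t))) (at t)"
    using bounded_linear.has_vector_derivative[OF bounded_linear_Re v] by simp
  have "((\<lambda>t. 0 :: real) has_vector_derivative Im (deriv ?G (of_real t))) (at t)"
    using bounded_linear.has_vector_derivative[OF bounded_linear_Im v] by simp
  hence "Im (deriv ?G (of_real t)) = 0"
    using vector_derivative_unique_at has_vector_derivative_const by blast
  moreover have "deriv ?g t = Re (deriv ?G (of_real t))"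
    using r by (intro DERIV_imp_deriv) (simp add: has_real_derivative_iff_has_vector_derivative)
  ultimately show ?case by (simp add: complex_eq_iff)
qed (simp add: eq)

text \<open>For a = (2n+1)/3 the exponent 3a is an odd integer, so the power becomes the
  single-valued function \<open>f\<close> with a pole at 0. Since \<open>f\<close> is odd, its
  integrals over Im z = - 3\<pi>/2 and Im z = 3\<pi>/2 are opposite; their difference is 2 \<pi> i
  times the residue, hence the upper one is - \<pi> i times it.\<close>

lemma upper_line_integral_dcoef:
  "(\<integral>x. phase (Complex x (3 * pi / 2)) powr (- of_real ((2 * real n + 1) / 3)) \<partial>lborel) =
     of_real pi * (-1) ^ n * of_real (dcoef n)"
proof -
  define a where "a = (2 * real n + 1) / 3"
  have a: "a > 0" by (simp add: a_def)
  define F where "F z = exp (- of_real a * sinhc_log z)" for z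
  define f where "f z = F z / z ^ Suc (2 * n)" for z
  have Fh: "F holomorphic_on strip"
    unfolding F_def by (intro holomorphic_intros sinhc_log_holomorphic)
  \<comment> \<open>The constant is (- i)^(2n+1), produced by replacing the power of - i z in
    \<open>phase_powr\<close> by the power of z.\<close>
  have f_upper: "f z = - \<i> * (-1) ^ n * phase_powr a z" if "z \<in> strip" "Im z > 0" for z
  proof -
    have z0: "z \<noteq> 0" using that by auto
    have "exp (- of_real a * (3 * Ln (- \<i> * z))) = inverse (exp (of_nat (Suc (2 * n)) * Ln (- \<i> * z)))"
      unfolding exp_minus[symmetric] by (rule arg_cong[where f = exp]) (simp add: a_def field_simps)
    also have "exp (of_nat (Suc (2 * n)) * Ln (- \<i> * z)) = (- \<i> * z) ^ Suc (2 * n)"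
      unfolding exp_of_nat_mult using z0 by simp
    also have "\<dots> = - \<i> * (-1) ^ n * z ^ Suc (2 * n)"
    proof -
      have "(- \<i>) ^ Suc (2 * n) = - \<i> * (-1) ^ n" by (simp add: power_mult)
      thus ?thesis by (simp only: power_mult_distrib)
    qed
    finally have e: "exp (- of_real a * (3 * Ln (- \<i> * z))) = inverse (- \<i> * (-1) ^ n * z ^ Suc (2 * n))" .
    have "phase_powr a z = F z * exp (- of_real a * (3 * Ln (- \<i> * z)))"
      unfolding phase_powr_def phase_log_def F_def exp_add[symmetric]
      by (rule arg_cong[where f = exp]) (simp add: algebra_simps)
    hence "phase_powr a z = F z * inverse (- \<i> * (-1) ^ n * z ^ Suc (2 * n))" unfolding e .
    moreover have "(-1) ^ n * ((-1) ^ n :: complex) = 1" by (simp flip: power_mult_distrib)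
    ultimately show ?thesis using z0 by (simp add: f_def field_simps)
  qed
  have Lz: "f (- z) = - f z" if "z \<in> strip" for z
    using sinhc_log_minus[OF that] by (simp add: f_def F_def)
  have norm_f: "norm (f z) = norm (phase z) powr (- a)" if "z \<in> strip" "z \<noteq> 0" for z
  proof -
    have "norm (F z) = norm (sinhc z) powr (- a)"
      unfolding F_def by (rule norm_exp_real_multiple) (rule exp_sinhc_log[OF that(1)])
    moreover have "norm z ^ Suc (2 * n) = (norm z ^ 3) powr a"
    proof -
      have "norm z ^ Suc (2 * n) = norm z powr real (Suc (2 * n))" using that by (intro powr_realpow[symmetric]) auto
      also have "real (Suc (2 * n)) = 3 * a" by (simp add: a_def)
      also have "norm z powr (3 * a) = (norm z powr 3) powr a" by (simp only: powr_powr)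
      finally show ?thesis using that by simp
    qed
    ultimately show ?thesis
      by (simp add: f_def phase_sinhc norm_divide norm_mult norm_power powr_mult powr_minus field_simps)
  qed
  obtain R where R: "R > 0" "\<And>x y. R \<le> \<bar>x\<bar> \<Longrightarrow> \<bar>y\<bar> \<le> 3 * pi / 2 \<Longrightarrow> norm (phase (Complex x y)) powr (- a) \<le> 4 powr a * exp (- a * \<bar>x\<bar>)"
    using norm_phase_powr_le_line[OF a] by metis
  let ?u = "\<lambda>x. f (Complex x (3 * pi / 2))"
  have up: "?u x = - \<i> * (-1) ^ n * phase_powr a (Complex x (3 * pi / 2))" for x
    by (rule f_upper) (use pi_gt_zero in auto)
  have iu: "integrable lborel ?u"
    unfolding up by (intro integrable_mult_right phase_powr_line_integrable a) (use pi_gt_zero in auto)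
  have low: "f (Complex x (- (3 * pi / 2))) = - ?u (0 + (-1) * x)" for x
  proof -
    have "Complex x (- (3 * pi / 2)) = - Complex (0 + (-1) * x) (3 * pi / 2)" by (simp add: complex_eq_iff)
    moreover have "Complex (0 + (-1) * x) (3 * pi / 2) \<in> strip" using pi_gt_zero by simp
    ultimately show ?thesis by (simp only: Lz)
  qed
  have il: "integrable lborel (\<lambda>x. f (Complex x (- (3 * pi / 2))))"
    unfolding low by (intro Bochner_Integration.integrable_minus lborel_integrable_real_affine iu) auto
  have "(\<integral>x. f (Complex x (- (3 * pi / 2))) \<partial>lborel) - (\<integral>x. ?u x \<partial>lborel) = 2 * pi * \<i> * residue f 0"
  proof (rule strip_residue[where a = "- (2 * pi)" and b = "2 * pi" and R = R and B = "\<lambda>x. 4 powr a * exp (- a * x)", OF _ _ _ _ _ il iu])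
    show "f holomorphic_on strip - {0}"
      unfolding f_def by (intro holomorphic_intros holomorphic_on_subset[OF Fh]) auto
    show "((\<lambda>x. 4 powr a * exp (- a * x)) \<longlongrightarrow> 0) at_top" by (rule exp_neg_tendsto[OF a])
    fix x y assume *: "R \<le> \<bar>x\<bar>" "- (3 * pi / 2) \<le> y" "y \<le> 3 * pi / 2"
    have "- (2 * pi) < y" "y < 2 * pi" using * pi_gt_zero by linarith+
    hence "norm (f (Complex x y)) = norm (phase (Complex x y)) powr (- a)"
      by (intro norm_f) (use * R(1) in \<open>auto simp: complex_eq_iff\<close>)
    also have "\<dots> \<le> 4 powr a * exp (- a * \<bar>x\<bar>)" by (rule R(2)) (use * in auto)
    finally show "norm (f (Complex x y)) \<le> 4 powr a * exp (- a * \<bar>x\<bar>)" .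
  qed (use pi_gt_zero in auto)
  moreover have "(\<integral>x. f (Complex x (- (3 * pi / 2))) \<partial>lborel) = - (\<integral>x. ?u x \<partial>lborel)"
    unfolding low using lborel_integral_real_affine[of "-1" ?u 0] by simp
  moreover have "U = of_real (- pi) * \<i> * r" if "L - U = of_real (2 * pi) * \<i> * r" "L = - U" for L U r :: complex
  proof -
    have "L - U = 2 * of_real pi * \<i> * r" using that(1) by simp
    hence "2 * U = 2 * (- of_real pi * \<i> * r)" using that(2) by algebra
    thus ?thesis by simp
  qed
  ultimately have 1: "(\<integral>x. ?u x \<partial>lborel) = - pi * \<i> * residue f 0" by blast
  have F_real: "F (of_real t) = of_real (sinh_ratio t powr a)" for t
    unfolding F_def sinhc_log_real using sinh_ratio_pos[of t]
    by (simp add: powr_def exp_of_real flip: of_real_mult)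
  have "residue f 0 = (deriv ^^ (2 * n)) F 0 / fact (2 * n)"
    unfolding f_def by (rule residue_holomorphic_over_power'[OF strip_open _ Fh]) auto
  also have "(deriv ^^ (2 * n)) F 0 = of_real ((deriv ^^ (2 * n)) (\<lambda>t. sinh_ratio t powr a) 0)"
  proof -
    have "range complex_of_real \<subseteq> strip" by auto
    from higher_deriv_of_real[OF strip_open this Fh F_real, of "2 * n" 0] show ?thesis by simp
  qed
  finally have 2: "residue f 0 = of_real (dcoef n)" by (simp add: dcoef_def a_def)
  have "(\<integral>x. ?u x \<partial>lborel) = - \<i> * (-1) ^ n * (\<integral>x. phase_powr a (Complex x (3 * pi / 2)) \<partial>lborel)"
    unfolding up by (rule integral_mult_right_zero)
  hence "\<i> * (-1) ^ n * (- pi * \<i> * of_real (dcoef n)) =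
     \<i> * (-1) ^ n * (- \<i> * (-1) ^ n * (\<integral>x. phase_powr a (Complex x (3 * pi / 2)) \<partial>lborel))"
    unfolding 1 2 by simp
  also have "\<dots> = - (\<i> * \<i>) * ((-1) ^ n * (-1) ^ n) * (\<integral>x. phase_powr a (Complex x (3 * pi / 2)) \<partial>lborel)"
    by (simp only: mult_ac minus_mult_left minus_mult_right)
  also have "- (\<i> * \<i>) = 1" by simp
  also have "(-1) ^ n * (-1) ^ n = (1 :: complex)" by (simp flip: power_mult_distrib)
  finally have "(\<integral>x. phase_powr a (Complex x (3 * pi / 2)) \<partial>lborel) = of_real pi * (-1) ^ n * of_real (dcoef n)"
    by (simp add: mult_ac)
  thus ?thesis by (simp only: phase_powr_upper_line a_def)
qed

lemma Mellin_upper_dcoef: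
  "(\<integral>\<theta>. of_real (exp ((2 * real n + 1) / 3 * \<theta>) * exp (- 2 * pi * exp \<theta>)) * hit (exp \<theta>) \<partial>lborel) =
     of_real (Gamma ((2 * real n + 1) / 3)) * (-1) ^ n * of_real (dcoef n)"
  by (subst Mellin_upper(2)) (simp_all only: upper_line_integral_dcoef, simp_all)

text \<open>One statement for both integrals of the theorem: K is the constant i for the
  coefficients and \<open>kerH\<close> for the remainders. The exponent (2N+1)/3 is (2N-2)/3 plus 1
  from dt = exp \<theta> d\<theta>, and - i converts \<open>hit\<close> back into H1.\<close>

lemma weighted_log_substitution:
  fixes K :: "real \<Rightarrow> complex"
  assumes K: "continuous_on UNIV (\<lambda>\<theta>. K (exp \<theta>))" and bound: "\<And>\<theta>. norm (K (exp \<theta>)) \<le> M"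
  shows "(\<lambda>t. wt N t * K t * H1_it t) absolutely_integrable_on {0<..}"
    and "integral {0<..} (\<lambda>t. wt N t * K t * H1_it t) =
      (\<integral>\<theta>. of_real (exp ((2 * real N + 1) / 3 * \<theta>) * exp (- 2 * pi * exp \<theta>)) * hit (exp \<theta>) * (- \<i> * K (exp \<theta>)) \<partial>lborel)"
    and "integrable lborel (\<lambda>\<theta>. of_real (exp ((2 * real N + 1) / 3 * \<theta>) * exp (- 2 * pi * exp \<theta>)) * hit (exp \<theta>) * (- \<i> * K (exp \<theta>)))"
proof -
  let ?g = "\<lambda>\<theta>. of_real (exp ((2 * real N + 1) / 3 * \<theta>) * exp (- 2 * pi * exp \<theta>)) * hit (exp \<theta>)"
  have a: "(2 * real N + 1) / 3 > 0" by simp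
  have eq: "exp \<theta> *\<^sub>R (wt N (exp \<theta>) * K (exp \<theta>) * H1_it (exp \<theta>)) = ?g \<theta> * (- \<i> * K (exp \<theta>))" for \<theta>
  proof -
    have "exp \<theta> * (exp \<theta> powr ((2 * real N - 2) / 3) * exp (- 2 * pi * exp \<theta>)) =
        exp ((2 * real N + 1) / 3 * \<theta>) * exp (- 2 * pi * exp \<theta>)"
      by (simp add: exp_powr_real exp_add[symmetric] field_simps)
    hence "of_real (exp \<theta>) * wt N (exp \<theta>) = complex_of_real (exp ((2 * real N + 1) / 3 * \<theta>) * exp (- 2 * pi * exp \<theta>))"
      unfolding wt_def of_real_mult[symmetric] by (simp only:)
    moreover have "H1_it (exp \<theta>) = - \<i> * hit (exp \<theta>)" by (simp add: hit_def)
    ultimately show ?thesis by (simp only: scaleR_conv_of_real mult.assoc[symmetric]) (simp add: mult_ac)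
  qed
  have cont: "continuous_on UNIV (\<lambda>\<theta>. ?g \<theta> * (- \<i> * K (exp \<theta>)))"
    by (intro continuous_intros hit_exp_continuous K)
  show int: "integrable lborel (\<lambda>\<theta>. ?g \<theta> * (- \<i> * K (exp \<theta>)))"
  proof (rule Bochner_Integration.integrable_bound)
    show "integrable lborel (\<lambda>\<theta>. M *\<^sub>R ?g \<theta>)"
      by (intro integrable_scaleR_right Mellin_upper(1) a)
    show "(\<lambda>\<theta>. ?g \<theta> * (- \<i> * K (exp \<theta>))) \<in> borel_measurable lborel"
      unfolding measurable_lborel2 by (rule borel_measurable_continuous_onI[OF cont])
    show "AE \<theta> in lborel. norm (?g \<theta> * (- \<i> * K (exp \<theta>))) \<le> norm (M *\<^sub>R ?g \<theta>)"
    proof (rule AE_I2)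
      fix \<theta>
      have "norm (?g \<theta> * (- \<i> * K (exp \<theta>))) = norm (?g \<theta>) * norm (K (exp \<theta>))" by (simp add: norm_mult)
      also have "\<dots> \<le> norm (?g \<theta>) * \<bar>M\<bar>" using bound[of \<theta>] by (intro mult_left_mono) auto
      finally show "norm (?g \<theta> * (- \<i> * K (exp \<theta>))) \<le> norm (M *\<^sub>R ?g \<theta>)" by (simp only: norm_scaleR mult.commute)
    qed
  qed
  have meas: "(\<lambda>\<theta>. exp \<theta> *\<^sub>R (wt N (exp \<theta>) * K (exp \<theta>) * H1_it (exp \<theta>))) \<in> borel_measurable borel"
    unfolding eq by (rule borel_measurable_continuous_onI[OF cont])
  show "(\<lambda>t. wt N t * K t * H1_it t) absolutely_integrable_on {0<..}"
    using log_substitution(1)[OF meas] int unfolding eq by simp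
  show "integral {0<..} (\<lambda>t. wt N t * K t * H1_it t) = (\<integral>\<theta>. ?g \<theta> * (- \<i> * K (exp \<theta>)) \<partial>lborel)"
    using log_substitution(2)[OF meas] int unfolding eq by simp
qed

lemma dcoef_integral:
  shows "(\<lambda>t. of_real (t powr ((2 * real n - 2) / 3) * exp (- 2 * pi * t)) * (\<i> * H1_it t)) integrable_on {0<..}"
    and "complex_of_real (dcoef n) = (-1) ^ n / of_real (Gamma ((2 * real n + 1) / 3)) *
        integral {0<..} (\<lambda>t. of_real (t powr ((2 * real n - 2) / 3) * exp (- 2 * pi * t)) * (\<i> * H1_it t))"
proof -
  let ?I = "\<lambda>t. of_real (t powr ((2 * real n - 2) / 3) * exp (- 2 * pi * t)) * (\<i> * H1_it t)"
  have eq: "wt n t * \<i> * H1_it t = ?I t" for t by (simp add: wt_def mult.assoc)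
  note w = weighted_log_substitution[where K = "\<lambda>_. \<i>" and M = 1 and N = n, OF continuous_on_const, simplified norm_ii, OF order.refl, unfolded eq]
  show "?I integrable_on {0<..}"
    using w(1) by (rule set_lebesgue_integral_eq_integral(1))
  have "integral {0<..} ?I = of_real (Gamma ((2 * real n + 1) / 3)) * (-1) ^ n * of_real (dcoef n)"
    unfolding w(2) Mellin_upper_dcoef[symmetric] by simp
  hence "(-1) ^ n / of_real (Gamma ((2 * real n + 1) / 3)) * integral {0<..} ?I =
      (of_real (Gamma ((2 * real n + 1) / 3)) / of_real (Gamma ((2 * real n + 1) / 3))) *
      ((-1) ^ n * (-1) ^ n) * of_real (dcoef n)"
    by (simp only:) (simp add: mult_ac)
  moreover have "Gamma ((2 * real n + 1) / 3) > 0" by (rule Gamma_real_pos) simp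
  hence "Gamma ((2 * real n + 1) / 3) \<noteq> 0" by (rule less_imp_neq[symmetric])
  hence "of_real (Gamma ((2 * real n + 1) / 3)) / of_real (Gamma ((2 * real n + 1) / 3)) = (1 :: complex)"
    by (intro divide_self) (simp only: of_real_eq_0_iff not_False_eq_True)
  moreover have "(-1) ^ n * ((-1) ^ n :: complex) = 1" by (simp flip: power_mult_distrib)
  ultimately show "complex_of_real (dcoef n) = (-1) ^ n / of_real (Gamma ((2 * real n + 1) / 3)) * integral {0<..} ?I"
    by (simp only: mult_1_left)
qed

section \<open>Convolutions and the Mellin transform of the Stieltjes kernel\<close>

lemma convolution_integral:
  fixes g k :: "real \<Rightarrow> complex"
  assumes g: "integrable lborel g" and k: "integrable lborel k"
  shows "integrable lborel (\<lambda>\<tau>. \<integral>\<theta>. g \<theta> * k (\<tau> - \<theta>) \<partial>lborel)"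
    and "(\<integral>\<tau>. (\<integral>\<theta>. g \<theta> * k (\<tau> - \<theta>) \<partial>lborel) \<partial>lborel) = (\<integral>\<theta>. g \<theta> \<partial>lborel) * (\<integral>r. k r \<partial>lborel)"
proof -
  have [measurable]: "g \<in> borel_measurable borel" "k \<in> borel_measurable borel" using g k by auto
  let ?f = "\<lambda>\<theta> \<tau>. g \<theta> * k (\<tau> - \<theta>)"
  have shift: "(\<integral>\<tau>. h (\<tau> - \<theta>) \<partial>lborel) = (\<integral>\<tau>. h \<tau> \<partial>lborel)" for \<theta> and h :: "real \<Rightarrow> 'c::{banach,second_countable_topology}"
    using lborel_integral_real_affine[of 1 h "- \<theta>"] by (simp add: add.commute)
  have shift_i: "integrable lborel (\<lambda>\<tau>. k (\<tau> - \<theta>))" for \<theta>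
    using lborel_integrable_real_affine[OF k, of 1 "- \<theta>"] by (simp add: add.commute)
  have int: "integrable (lborel \<Otimes>\<^sub>M lborel) (case_prod ?f)"
  proof (rule lborel_pair.Fubini_integrable)
    show "case_prod ?f \<in> borel_measurable (lborel \<Otimes>\<^sub>M lborel)" by measurable
    show "AE \<theta> in lborel. integrable lborel (\<lambda>\<tau>. case (\<theta>, \<tau>) of (x, y) \<Rightarrow> ?f x y)"
      using shift_i by (auto intro!: integrable_mult_right)
    have "(\<integral>\<tau>. norm (?f \<theta> \<tau>) \<partial>lborel) = norm (g \<theta>) * (\<integral>\<tau>. norm (k \<tau>) \<partial>lborel)" for \<theta>
      using shift[of "\<lambda>\<tau>. norm (k \<tau>)" \<theta>] by (simp add: norm_mult)
    thus "integrable lborel (\<lambda>\<theta>. \<integral>\<tau>. norm (case (\<theta>, \<tau>) of (x, y) \<Rightarrow> ?f x y) \<partial>lborel)"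
      using g by simp
  qed
  show "integrable lborel (\<lambda>\<tau>. \<integral>\<theta>. g \<theta> * k (\<tau> - \<theta>) \<partial>lborel)"
    by (rule lborel_pair.integrable_snd[OF int])
  have "(\<integral>\<tau>. (\<integral>\<theta>. ?f \<theta> \<tau> \<partial>lborel) \<partial>lborel) = (\<integral>\<theta>. (\<integral>\<tau>. ?f \<theta> \<tau> \<partial>lborel) \<partial>lborel)"
    by (rule lborel_pair.Fubini_integral[OF int])
  also have "\<dots> = (\<integral>\<theta>. g \<theta> * (\<integral>r. k r \<partial>lborel) \<partial>lborel)"
    using shift[of k] by simp
  also have "\<dots> = (\<integral>\<theta>. g \<theta> \<partial>lborel) * (\<integral>r. k r \<partial>lborel)" by simp
  finally show "(\<integral>\<tau>. (\<integral>\<theta>. g \<theta> * k (\<tau> - \<theta>) \<partial>lborel) \<partial>lborel) = (\<integral>\<theta>. g \<theta> \<partial>lborel) * (\<integral>r. k r \<partial>lborel)" .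
qed

text \<open>The reciprocal of 1 + E is written as a Gamma integral with exponent 1. Interchanging
  the integrations leaves Gamma c Gamma (1 - c) with the phase exp (- i \<phi> c), and the
  reflection formula finishes. The bound on \<phi> gives E a positive real part, as
  \<open>Gamma_log_integral\<close> requires.\<close>

lemma Stieltjes_Mellin:
  fixes c \<phi> :: real
  assumes c: "0 < c" "c < 1" and \<phi>: "\<bar>\<phi>\<bar> < pi / 2"
  shows "integrable lborel (\<lambda>\<rho>. of_real (exp (c * \<rho>)) / (1 + exp (of_real \<rho> + \<i> * of_real \<phi>)))"
    and "(\<integral>\<rho>. of_real (exp (c * \<rho>)) / (1 + exp (of_real \<rho> + \<i> * of_real \<phi>)) \<partial>lborel) =
      exp (- \<i> * of_real (\<phi> * c)) * of_real (pi / sin (pi * c))"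
proof -
  let ?E = "\<lambda>\<rho>. exp (of_real \<rho> + \<i> * of_real \<phi>)"
  define f where "f \<rho> \<sigma> = exp (of_real (c * \<rho>)) * exp (of_real (1 * \<sigma>) - of_real (exp \<sigma>) * (1 + ?E \<rho>))" for \<rho> \<sigma> :: real
  have cosp: "cos \<phi> > 0" using \<phi> by (intro cos_gt_zero_pi) (auto simp: abs_less_iff)
  have ReE: "Re (?E \<rho>) = exp \<rho> * cos \<phi>" for \<rho> by (simp add: Re_exp)
  have Q: "Re (1 + ?E \<rho>) > 0" for \<rho> using cosp by (simp add: ReE add_pos_pos)
  have inner: "(\<integral>\<sigma>. f \<rho> \<sigma> \<partial>lborel) = of_real (exp (c * \<rho>)) / (1 + ?E \<rho>)" for \<rho>
  proof -
    have "1 + ?E \<rho> \<noteq> 0" using Q[of \<rho>] by (metis less_irrefl zero_complex.sel(1))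
    hence "(1 + ?E \<rho>) powr (- of_real 1) = inverse (1 + ?E \<rho>)" by (simp add: powr_minus)
    thus ?thesis
      unfolding f_def integral_mult_right_zero Gamma_log_integral(2)[OF zero_less_one Q]
      by (simp only: exp_of_real divide_inverse Gamma_1 of_real_1 mult_1_left)
  qed
  \<comment> \<open>The product exp \<sigma> E(\<rho>) depends only on \<rho> + \<sigma>, so \<rho>
    and \<sigma> may trade places; the \<rho>-integral then has Gamma form.\<close>
  have swap: "f \<rho> \<sigma> = exp (of_real (1 * \<sigma>) - of_real (exp \<sigma>)) *
      exp (of_real (c * \<rho>) - of_real (exp \<rho>) * exp (of_real \<sigma> + \<i> * of_real \<phi>))" for \<rho> \<sigma>
  proof -
    have "of_real (exp \<sigma>) * ?E \<rho> = of_real (exp \<rho>) * exp (of_real \<sigma> + \<i> * of_real \<phi>)"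
      by (simp add: exp_add exp_of_real mult_ac)
    thus ?thesis
      unfolding f_def exp_add[symmetric] by (intro arg_cong[where f = exp]) (simp add: algebra_simps)
  qed
  have Q': "Re (exp (of_real \<sigma> + \<i> * of_real \<phi>)) > 0" for \<sigma> :: real using cosp by (simp add: Re_exp)
  have outer: "(\<integral>\<rho>. f \<rho> \<sigma> \<partial>lborel) = of_real (Gamma c) * exp (- \<i> * of_real (\<phi> * c)) * exp (of_real ((1 - c) * \<sigma>) - of_real (exp \<sigma>) * 1)" for \<sigma>
  proof -
    have "exp (of_real \<sigma> + \<i> * of_real \<phi>) powr (- of_real c) = exp (- of_real c * (of_real \<sigma> + \<i> * of_real \<phi>))"
    proof -
      have "Ln (exp (of_real \<sigma> + \<i> * of_real \<phi>)) = of_real \<sigma> + \<i> * of_real \<phi>"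
        by (rule Ln_exp) (use \<phi> in \<open>auto simp: abs_less_iff\<close>)
      thus ?thesis by (simp add: powr_def)
    qed
    thus ?thesis
      unfolding swap integral_mult_right_zero Gamma_log_integral(2)[OF c(1) Q']
      by (simp add: mult.assoc[symmetric] flip: exp_add) (simp add: mult.assoc algebra_simps flip: exp_add)
  qed
  have meas: "case_prod f \<in> borel_measurable (lborel \<Otimes>\<^sub>M lborel)"
    unfolding lborel_prod measurable_lborel2 f_def case_prod_unfold
    by (intro borel_measurable_continuous_onI continuous_intros)
  have int: "integrable (lborel \<Otimes>\<^sub>M lborel) (case_prod f)"
  proof (rule lborel_pair.Fubini_integrable[OF meas])
    show "AE \<rho> in lborel. integrable lborel (\<lambda>\<sigma>. case (\<rho>, \<sigma>) of (x, y) \<Rightarrow> f x y)"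
      unfolding f_def using Gamma_log_integral(1)[OF zero_less_one Q] by (auto intro!: integrable_mult_right)
    have n: "norm (f \<rho> \<sigma>) = exp (c * \<rho>) * exp (1 * \<sigma> - (1 + exp \<rho> * cos \<phi>) * exp \<sigma>)" for \<rho> \<sigma>
      unfolding f_def norm_mult norm_exp_eq_Re by (simp add: Re_exp algebra_simps)
    have "(\<integral>\<sigma>. norm (f \<rho> \<sigma>) \<partial>lborel) = exp (c * \<rho>) * (1 + exp \<rho> * cos \<phi>) powr (- 1)" for \<rho>
      unfolding n integral_mult_right_zero
      by (subst real_Gamma_log_integral(2)) (use cosp in \<open>auto intro!: add_pos_pos\<close>)
    moreover have "integrable lborel (\<lambda>\<rho>. exp (c * \<rho>) * (1 + exp \<rho> * cos \<phi>) powr (- 1))"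
    proof (rule Bochner_Integration.integrable_bound)
      \<comment> \<open>The integrand decays with rate 1 - c at plus infinity and with rate c at
        minus infinity; the smaller rate serves both ends.\<close>
      let ?m = "min c (1 - c)"
      show "integrable lborel (\<lambda>\<rho>. (1 + inverse (cos \<phi>)) * exp (- ?m * \<bar>\<rho>\<bar>))"
        by (intro integrable_mult_right integrable_exp_neg_abs) (use c in auto)
      show "(\<lambda>\<rho>. exp (c * \<rho>) * (1 + exp \<rho> * cos \<phi>) powr (- 1)) \<in> borel_measurable lborel" by measurable
      have "exp (c * \<rho>) * (1 + exp \<rho> * cos \<phi>) powr (- 1) \<le> (1 + inverse (cos \<phi>)) * exp (- ?m * \<bar>\<rho>\<bar>)" for \<rho>
      proof -
        have p: "1 + exp \<rho> * cos \<phi> > 0" using cosp by (simp add: add_pos_pos)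
        hence pw: "(1 + exp \<rho> * cos \<phi>) powr (- 1) = inverse (1 + exp \<rho> * cos \<phi>)" by (simp add: powr_minus)
        have m: "?m * \<bar>\<rho>\<bar> \<le> (1 - c) * \<bar>\<rho>\<bar>" "?m * \<bar>\<rho>\<bar> \<le> c * \<bar>\<rho>\<bar>"
          by (intro mult_right_mono; simp)+
        show ?thesis
        proof (cases "\<rho> \<ge> 0")
          case True
          have "inverse (1 + exp \<rho> * cos \<phi>) \<le> inverse (exp \<rho> * cos \<phi>)"
            using cosp by (intro le_imp_inverse_le) auto
          hence "exp (c * \<rho>) * inverse (1 + exp \<rho> * cos \<phi>) \<le> exp (c * \<rho>) * inverse (exp \<rho> * cos \<phi>)"
            by (intro mult_left_mono) auto
          also have "\<dots> = inverse (cos \<phi>) * exp (- (1 - c) * \<bar>\<rho>\<bar>)"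
            using True by (simp add: exp_minus[symmetric] inverse_mult_distrib exp_add[symmetric] algebra_simps mult_exp_exp)
          also have "\<dots> \<le> (1 + inverse (cos \<phi>)) * exp (- ?m * \<bar>\<rho>\<bar>)"
            using cosp m(1) by (intro mult_mono) (auto simp: algebra_simps)
          finally show ?thesis unfolding pw .
        next
          case False
          have "inverse (1 + exp \<rho> * cos \<phi>) \<le> inverse 1"
            using cosp by (intro le_imp_inverse_le) auto
          hence "exp (c * \<rho>) * inverse (1 + exp \<rho> * cos \<phi>) \<le> 1 * exp (- c * \<bar>\<rho>\<bar>)"
            using False mult_left_mono[of "inverse (1 + exp \<rho> * cos \<phi>)" 1 "exp (c * \<rho>)"] by simp
          also have "\<dots> \<le> (1 + inverse (cos \<phi>)) * exp (- ?m * \<bar>\<rho>\<bar>)"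
            using cosp m(2) by (intro mult_mono) auto
          finally show ?thesis unfolding pw .
        qed
      qed
      thus "AE \<rho> in lborel. norm (exp (c * \<rho>) * (1 + exp \<rho> * cos \<phi>) powr (- 1)) \<le> norm ((1 + inverse (cos \<phi>)) * exp (- ?m * \<bar>\<rho>\<bar>))"
        by (intro AE_I2) (auto intro: order.trans[OF _ abs_ge_self])
    qed
    ultimately show "integrable lborel (\<lambda>\<rho>. \<integral>\<sigma>. norm (case (\<rho>, \<sigma>) of (x, y) \<Rightarrow> f x y) \<partial>lborel)"
      by simp
  qed
  show "integrable lborel (\<lambda>\<rho>. of_real (exp (c * \<rho>)) / (1 + ?E \<rho>))"
    using lborel_pair.integrable_fst[OF int] unfolding inner .
  have "(\<integral>\<rho>. of_real (exp (c * \<rho>)) / (1 + ?E \<rho>) \<partial>lborel) = (\<integral>\<sigma>. (\<integral>\<rho>. f \<rho> \<sigma> \<partial>lborel) \<partial>lborel)"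
    unfolding inner[symmetric] by (rule lborel_pair.Fubini_integral[OF int, symmetric])
  also have "\<dots> = of_real (Gamma c) * exp (- \<i> * of_real (\<phi> * c)) * (of_real (Gamma (1 - c)) * 1 powr (- of_real (1 - c)))"
    unfolding outer integral_mult_right_zero
    by (subst Gamma_log_integral(2)) (use c in auto)
  also have "\<dots> = exp (- \<i> * of_real (\<phi> * c)) * of_real (Gamma c * Gamma (1 - c))" by simp
  also have "complex_of_real (Gamma c * Gamma (1 - c)) = of_real (pi / sin (pi * c))"
  proof -
    have "complex_of_real (Gamma c * Gamma (1 - c)) = Gamma (of_real c) * Gamma (of_real (1 - c))"
      by (simp only: Gamma_complex_of_real of_real_mult)
    also have "\<dots> = of_real pi / sin (of_real (pi * c))"
      using Gamma_reflection_complex[of "of_real c"] by simp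
    finally show ?thesis by (simp only: sin_of_real of_real_divide)
  qed
  finally show "(\<integral>\<rho>. of_real (exp (c * \<rho>)) / (1 + ?E \<rho>) \<partial>lborel) =
      exp (- \<i> * of_real (\<phi> * c)) * of_real (pi / sin (pi * c))" .
qed

section \<open>The remainder and its recursion\<close>

definition kerH :: "nat \<Rightarrow> complex \<Rightarrow> real \<Rightarrow> complex" where
  "kerH N \<zeta> t = exp ((2 * of_nat N + 1) * of_real pi * \<i> / 3)
            / (1 + tw23 t \<zeta> * exp (2 * of_real pi * \<i> / 3)) + 1 / (1 + tw23 t \<zeta>)"

lemma tw23_exp: "tw23 (exp \<theta>) \<zeta> = exp (2 / 3 * (of_real \<theta> - \<zeta>))"
  unfolding tw23_def exp_powr_real exp_of_real[symmetric] exp_add[symmetric]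
  by (rule arg_cong[where f = exp]) (simp add: field_simps)

text \<open>With r = |exp w| and C the square of the cosine, |1 + exp w|^2 is the convex combination
  of (1 - r)^2 and (1 + r)^2 with weights 1 - C and C; the second part is at least C. The bound
  depends only on Im w, hence is uniform in the integration variable.\<close>

lemma norm_one_plus_exp_ge: "norm (1 + exp w) \<ge> \<bar>cos (Im w / 2)\<bar>"
proof -
  define r C where "r = exp (Re w)" and "C = (cos (Im w / 2))\<^sup>2"
  have C: "0 \<le> C" "C \<le> 1" by (auto simp: C_def abs_square_le_1)
  have r: "r > 0" by (simp add: r_def)
  have cw: "cos (Im w) = 2 * C - 1" using cos_double_cos[of "Im w / 2"] by (simp add: C_def)
  have "(norm (1 + exp w))\<^sup>2 = (1 + r * cos (Im w))\<^sup>2 + (r * sin (Im w))\<^sup>2"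
    by (simp add: cmod_power2 Re_exp Im_exp r_def)
  also have "\<dots> = 1 + 2 * r * cos (Im w) + r\<^sup>2 * ((cos (Im w))\<^sup>2 + (sin (Im w))\<^sup>2)"
    by algebra
  also have "\<dots> = 1 + 2 * r * cos (Im w) + r\<^sup>2" by simp
  also have "\<dots> = (1 - r)\<^sup>2 * (1 - C) + C * (1 + r)\<^sup>2"
    unfolding cw by (simp add: power2_eq_square algebra_simps)
  finally have eq: "(norm (1 + exp w))\<^sup>2 = (1 - r)\<^sup>2 * (1 - C) + C * (1 + r)\<^sup>2" .
  have "C * 1 \<le> C * (1 + r)\<^sup>2" using C r by (intro mult_left_mono) auto
  moreover have "(1 - r)\<^sup>2 * (1 - C) \<ge> 0" using C by simp
  ultimately have "(\<bar>cos (Im w / 2)\<bar>)\<^sup>2 \<le> (norm (1 + exp w))\<^sup>2"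
    unfolding eq by (simp add: C_def)
  thus ?thesis by (rule power2_le_imp_le) simp
qed

abbreviation Hstrip :: "complex set" where
  "Hstrip \<equiv> {\<zeta>. - (pi / 2) < Im \<zeta> \<and> Im \<zeta> < 3 * pi / 2}"

lemma Hstrip_open: "open Hstrip" and Hstrip_convex: "convex Hstrip"
proof -
  show "open Hstrip"
    by (intro open_Collect_conj open_halfspace_Im_gt open_halfspace_Im_lt)
  show "convex Hstrip"
    using convex_Int[OF convex_halfspace_Im_gt[of "- (pi / 2)"] convex_halfspace_Im_lt[of "3 * pi / 2"]]
    by (simp add: Collect_conj_eq)
qed

text \<open>The edges of \<open>Hstrip\<close> are exactly where one of these angles reaches
  \<pi>/2: the lower edge belongs to the first denominator of the kernel, the upper edge to the
  second.\<close>

lemma cos_half_pos: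
  assumes "- (pi / 2) < y" "y < 3 * pi / 2"
  shows "cos (pi / 3 - y / 3) > 0" "cos (y / 3) > 0"
  using assms pi_gt_zero by (auto intro!: cos_gt_zero_pi simp: field_simps)

lemma kerH_denominators:
  fixes \<theta> :: real and \<zeta> :: complex
  shows "norm (1 + tw23 (exp \<theta>) \<zeta> * exp (2 * of_real pi * \<i> / 3)) \<ge> cos (pi / 3 - Im \<zeta> / 3)"
    and "norm (1 + tw23 (exp \<theta>) \<zeta>) \<ge> cos (Im \<zeta> / 3)"
proof -
  define w where "w = 2 / 3 * (of_real \<theta> - \<zeta>)"
  define v where "v = w + 2 * of_real pi * \<i> / 3"
  have w: "tw23 (exp \<theta>) \<zeta> = exp w" "tw23 (exp \<theta>) \<zeta> * exp (2 * of_real pi * \<i> / 3) = exp v"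
    by (simp_all only: tw23_exp w_def v_def exp_add)
  have "Im w / 2 = - (Im \<zeta> / 3)" "Im v / 2 = pi / 3 - Im \<zeta> / 3"
    by (simp_all add: w_def v_def field_simps)
  hence "cos (Im w / 2) = cos (Im \<zeta> / 3)" "cos (Im v / 2) = cos (pi / 3 - Im \<zeta> / 3)"
    by (simp_all only: cos_minus)
  thus "norm (1 + tw23 (exp \<theta>) \<zeta> * exp (2 * of_real pi * \<i> / 3)) \<ge> cos (pi / 3 - Im \<zeta> / 3)"
    "norm (1 + tw23 (exp \<theta>) \<zeta>) \<ge> cos (Im \<zeta> / 3)"
    unfolding w(2) unfolding w(1) using norm_one_plus_exp_ge[of v] norm_one_plus_exp_ge[of w] by linarith+
qed

lemma kerH_denominators_nonzero:
  assumes "\<zeta> \<in> Hstrip"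
  shows "1 + tw23 (exp \<theta>) \<zeta> * exp (2 * of_real pi * \<i> / 3) \<noteq> 0" "1 + tw23 (exp \<theta>) \<zeta> \<noteq> 0"
  using kerH_denominators[where \<theta> = \<theta> and \<zeta> = \<zeta>] cos_half_pos[of "Im \<zeta>"] assms by auto

text \<open>On a closed range of heights the smaller of the two cosines attains a positive minimum.
  The numerators have modulus 1, so one bound serves all N.\<close>

lemma kerH_bound:
  assumes "- (pi / 2) < lo" "hi < 3 * pi / 2"
  obtains M where "\<And>(N :: nat) (\<theta> :: real) (\<zeta> :: complex). lo \<le> Im \<zeta> \<Longrightarrow> Im \<zeta> \<le> hi \<Longrightarrow> norm (kerH N \<zeta> (exp \<theta>)) \<le> M"
proof (cases "lo \<le> hi")
  case True
  define d where "d y = min (cos (pi / 3 - y / 3)) (cos (y / 3))" for y :: real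
  have "continuous_on {lo..hi} d" unfolding d_def by (intro continuous_intros) auto
  then obtain y0 where y0: "y0 \<in> {lo..hi}" "\<And>y. y \<in> {lo..hi} \<Longrightarrow> d y0 \<le> d y"
    using continuous_attains_inf[of "{lo..hi}" d] True by (metis atLeastatMost_empty_iff compact_Icc)
  have d0: "d y0 > 0" using cos_half_pos[of y0] y0(1) assms by (auto simp: d_def)
  have "norm (kerH N \<zeta> (exp \<theta>)) \<le> 1 / d y0 + 1 / d y0" if "lo \<le> Im \<zeta>" "Im \<zeta> \<le> hi" for N and \<theta> :: real and \<zeta> :: complex
  proof -
    have d: "d y0 \<le> cos (pi / 3 - Im \<zeta> / 3)" "d y0 \<le> cos (Im \<zeta> / 3)"
      using y0(2)[of "Im \<zeta>"] that by (auto simp: d_def)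
    have e: "norm (exp ((2 * of_nat N + 1) * of_real pi * \<i> / 3)) = 1" by simp
    show ?thesis
      unfolding kerH_def
    proof (intro order.trans[OF norm_triangle_ineq] add_mono)
      show "norm (exp ((2 * of_nat N + 1) * of_real pi * \<i> / 3) / (1 + tw23 (exp \<theta>) \<zeta> * exp (2 * of_real pi * \<i> / 3))) \<le> 1 / d y0"
        unfolding norm_divide e
        by (intro divide_left_mono mult_pos_pos order.trans[OF d(1) kerH_denominators(1)] d0
              less_le_trans[OF d0 order.trans[OF d(1) kerH_denominators(1)]]) auto
      show "norm (1 / (1 + tw23 (exp \<theta>) \<zeta>)) \<le> 1 / d y0"
        unfolding norm_divide norm_one
        by (intro divide_left_mono mult_pos_pos order.trans[OF d(2) kerH_denominators(2)] d0
              less_le_trans[OF d0 order.trans[OF d(2) kerH_denominators(2)]]) auto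
    qed
  qed
  thus ?thesis by (rule that)
qed (use that[of 0] in auto)

text \<open>The measure t^((2N-2)/3) exp (- 2 \<pi> t) h(t) dt on the logarithmic scale. Its total
  is Gamma ((2N+1)/3) d_2N up to the sign (-1)^N.\<close>

definition mass :: "nat \<Rightarrow> real \<Rightarrow> complex" where
  "mass N \<theta> = of_real (exp ((2 * real N + 1) / 3 * \<theta>) * exp (- 2 * pi * exp \<theta>)) * hit (exp \<theta>)"

lemma mass_integrable: "integrable lborel (mass N)"
  unfolding mass_def[abs_def] by (rule Mellin_upper(1)) simp

lemma mass_integral: "(\<integral>\<theta>. mass N \<theta> \<partial>lborel) = of_real (Gamma ((2 * real N + 1) / 3)) * (-1) ^ N * of_real (dcoef N)"
  unfolding mass_def by (rule Mellin_upper_dcoef)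

lemma kerH_continuous:
  assumes "\<zeta> \<in> Hstrip"
  shows "continuous_on UNIV (\<lambda>\<theta>. kerH N \<zeta> (exp \<theta>))"
  using kerH_denominators_nonzero[OF assms] unfolding kerH_def tw23_exp
  by (intro continuous_intros) auto

definition R_int :: "nat \<Rightarrow> complex \<Rightarrow> complex" where
  "R_int N \<zeta> = (\<integral>\<theta>. mass N \<theta> * (- \<i> * kerH N \<zeta> (exp \<theta>)) \<partial>lborel)"

lemma R_H_eq:
  assumes \<zeta>: "\<zeta> \<in> Hstrip"
  shows "R_H N \<zeta> = (-1) ^ N / (3 * of_real pi * exp ((2 * of_nat N + 1) / 3 * \<zeta>)) * R_int N \<zeta>"
    and "integrable lborel (\<lambda>\<theta>. mass N \<theta> * (- \<i> * kerH N \<zeta> (exp \<theta>)))"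
    and "(\<lambda>t. wt N t * kerH N \<zeta> t * H1_it t) integrable_on {0<..}"
proof -
  obtain M where M: "\<And>\<theta>. norm (kerH N \<zeta> (exp \<theta>)) \<le> M"
  proof -
    obtain M where "\<And>N \<theta> \<zeta>'. Im \<zeta> \<le> Im \<zeta>' \<Longrightarrow> Im \<zeta>' \<le> Im \<zeta> \<Longrightarrow> norm (kerH N \<zeta>' (exp \<theta>)) \<le> M"
      using kerH_bound[of "Im \<zeta>" "Im \<zeta>"] \<zeta> by blast
    thus ?thesis by (intro that[of M]) auto
  qed
  note w = weighted_log_substitution[where N = N, OF kerH_continuous[OF \<zeta>] M]
  show "integrable lborel (\<lambda>\<theta>. mass N \<theta> * (- \<i> * kerH N \<zeta> (exp \<theta>)))"
    using w(3) unfolding mass_def .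
  show "(\<lambda>t. wt N t * kerH N \<zeta> t * H1_it t) integrable_on {0<..}"
    using w(1) by (rule set_lebesgue_integral_eq_integral(1))
  show "R_H N \<zeta> = (-1) ^ N / (3 * of_real pi * exp ((2 * of_nat N + 1) / 3 * \<zeta>)) * R_int N \<zeta>"
    using w(2) unfolding R_H_def R_int_def mass_def kerH_def by simp
qed

lemma R_H_holomorphic: "R_H N holomorphic_on Hstrip"
proof -
  have "R_int N field_differentiable (at z0)" if z0: "z0 \<in> Hstrip" for z0
  proof -
    obtain r where r: "r > 0" "cball z0 r \<subseteq> Hstrip"
      using Hstrip_open z0 open_contains_cball by blast
    \<comment> \<open>The top and bottom points of the closed ball; that they lie in
      \<open>Hstrip\<close> gives the strict bounds on the heights which \<open>kerH_bound\<close>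
      asks for.\<close>
    have e: "z0 + \<i> * of_real r \<in> cball z0 r" "z0 - \<i> * of_real r \<in> cball z0 r"
      using r(1) by (auto simp: dist_norm norm_mult)
    hence "z0 + \<i> * of_real r \<in> Hstrip" "z0 - \<i> * of_real r \<in> Hstrip" using r(2) by blast+
    hence "- (pi / 2) < Im z0 - r" "Im z0 + r < 3 * pi / 2" by auto
    then obtain M where M: "\<And>N \<theta> \<zeta>. Im z0 - r \<le> Im \<zeta> \<Longrightarrow> Im \<zeta> \<le> Im z0 + r \<Longrightarrow> norm (kerH N \<zeta> (exp \<theta>)) \<le> M"
      using kerH_bound by blast
    have sub: "ball z0 r \<subseteq> Hstrip" using r(2) by (meson ball_subset_cball order.trans)
    show ?thesis
      unfolding field_differentiable_def R_int_def[abs_def]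
    proof (rule exI, rule has_field_derivative_integral[OF r(1), where B = "\<lambda>\<theta>. norm (mass N \<theta>) * M"])
      show "(\<lambda>\<theta>. mass N \<theta> * (- \<i> * kerH N z (exp \<theta>))) \<in> borel_measurable lborel" if "z \<in> ball z0 r" for z
        using R_H_eq(2)[of z N] that sub by auto
      show "(\<lambda>z. mass N \<theta> * (- \<i> * kerH N z (exp \<theta>))) holomorphic_on ball z0 r" for \<theta>
        using kerH_denominators_nonzero sub unfolding kerH_def tw23_exp
        by (intro holomorphic_intros) blast+
      show "norm (mass N \<theta> * (- \<i> * kerH N z (exp \<theta>))) \<le> norm (mass N \<theta>) * M" if "z \<in> ball z0 r" for \<theta> z
      proof -
        have "\<bar>Im (z0 - z)\<bar> \<le> norm (z0 - z)" by (rule abs_Im_le_cmod)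
        also have "\<dots> < r" using that by (simp add: dist_norm)
        finally have "norm (kerH N z (exp \<theta>)) \<le> M" by (intro M) auto
        thus ?thesis by (simp add: norm_mult mult_left_mono)
      qed
      show "integrable lborel (\<lambda>\<theta>. norm (mass N \<theta>) * M)"
        by (intro integrable_mult_left integrable_norm mass_integrable)
    qed
  qed
  hence "R_int N holomorphic_on Hstrip"
    by (auto simp: holomorphic_on_def intro: field_differentiable_at_within)
  hence "(\<lambda>\<zeta>. (-1) ^ N / (3 * of_real pi * exp ((2 * of_nat N + 1) / 3 * \<zeta>)) * R_int N \<zeta>) holomorphic_on Hstrip"
    by (intro holomorphic_intros) auto
  thus ?thesis by (rule holomorphic_transform) (simp add: R_H_eq(1))
qed

text \<open>With u = (t/\<nu>)^(2/3), one step 1/(1 + v) = 1 - v/(1 + v) of the geometric series is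
  made in each fraction of the kernel, with v = u or v = u exp (2 \<pi> i / 3). The constant part
  integrates to the N-th coefficient, and the factor u raises the weight from N to N + 1.\<close>

lemma R_H_step:
  assumes \<zeta>: "\<zeta> \<in> Hstrip"
  shows "R_H N \<zeta> = - (2 / (3 * of_real pi)) * (of_real (dcoef N) * exp (2 * (2 * of_nat N + 1) * of_real pi * \<i> / 3)
                     * of_real (s3 N) * gterm N \<zeta>) + R_H (Suc N) \<zeta>"
proof -
  define \<phi> where "\<phi> = (2 * real N + 1) * pi / 3"
  define c where "c = exp (2 * of_real pi * \<i> / 3)"
  define e where "e = exp (\<i> * of_real \<phi>)"
  have e1: "exp ((2 * of_nat N + 1) * of_real pi * \<i> / 3) = e"
    unfolding e_def \<phi>_def by (rule arg_cong[where f = exp]) simp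
  have e2: "exp ((2 * of_nat (Suc N) + 1) * of_real pi * \<i> / 3) = e * c"
    unfolding e1[symmetric] c_def exp_add[symmetric] by (rule arg_cong[where f = exp]) (simp add: field_simps)
  have K: "kerH N \<zeta> (exp \<theta>) = (e + 1) - exp (2 / 3 * (of_real \<theta> - \<zeta>)) * kerH (Suc N) \<zeta> (exp \<theta>)" for \<theta>
  proof -
    define u where "u = exp (2 / 3 * (of_real \<theta> - \<zeta>))"
    have nz: "1 + u * c \<noteq> 0" "1 + u \<noteq> 0"
      using kerH_denominators_nonzero[OF \<zeta>, of \<theta>] by (auto simp: u_def c_def tw23_exp)
    have "u * (e * c / (1 + u * c)) = e - e / (1 + u * c)" "u * (1 / (1 + u)) = 1 - 1 / (1 + u)"
      using nz by (simp_all add: field_simps)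
    hence "e / (1 + u * c) + 1 / (1 + u) = (e + 1) - u * (e * c / (1 + u * c) + 1 / (1 + u))"
      by (simp only: distrib_left) simp
    thus ?thesis unfolding kerH_def e1 e2 tw23_exp c_def[symmetric] u_def[symmetric] .
  qed
  have m: "mass N \<theta> * exp (2 / 3 * (of_real \<theta> - \<zeta>)) = exp (- (2 / 3) * \<zeta>) * mass (Suc N) \<theta>" for \<theta>
  proof -
    have "of_real (exp ((2 * real N + 1) / 3 * \<theta>)) * exp (2 / 3 * (of_real \<theta> - \<zeta>)) =
        exp (- (2 / 3) * \<zeta>) * of_real (exp ((2 * real (Suc N) + 1) / 3 * \<theta>))"
      unfolding exp_of_real[symmetric] exp_add[symmetric]
      by (rule arg_cong[where f = exp]) (simp add: field_simps)
    thus ?thesis by (simp add: mass_def mult_ac)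
  qed
  have "mass N \<theta> * (- \<i> * kerH N \<zeta> (exp \<theta>)) = (- \<i> * (e + 1)) * mass N \<theta> -
      exp (- (2 / 3) * \<zeta>) * (mass (Suc N) \<theta> * (- \<i> * kerH (Suc N) \<zeta> (exp \<theta>)))" for \<theta>
  proof -
    have "mass N \<theta> * (- \<i> * kerH N \<zeta> (exp \<theta>)) = (- \<i> * (e + 1)) * mass N \<theta> -
        (mass N \<theta> * exp (2 / 3 * (of_real \<theta> - \<zeta>))) * (- \<i> * kerH (Suc N) \<zeta> (exp \<theta>))"
      unfolding K by (simp add: algebra_simps)
    thus ?thesis unfolding m by (simp add: mult_ac)
  qed
  hence I: "R_int N \<zeta> = (- \<i> * (e + 1)) * (\<integral>\<theta>. mass N \<theta> \<partial>lborel) - exp (- (2 / 3) * \<zeta>) * R_int (Suc N) \<zeta>"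
    unfolding R_int_def using mass_integrable[of N] R_H_eq(2)[OF \<zeta>, of "Suc N"] by simp
  define E where "E = exp ((2 * of_nat N + 1) / 3 * \<zeta>)"
  have E': "exp ((2 * of_nat (Suc N) + 1) / 3 * \<zeta>) * exp (- (2 / 3) * \<zeta>) = E"
    unfolding E_def exp_add[symmetric] by (rule arg_cong[where f = exp]) (simp add: field_simps)
  have E'': "1 / exp ((2 * of_nat (Suc N) + 1) / 3 * \<zeta>) = exp (- (2 / 3) * \<zeta>) / E"
    unfolding E'[symmetric] by simp
  have "R_H (Suc N) \<zeta> = - ((-1) ^ N) / (3 * of_real pi) * (1 / exp ((2 * of_nat (Suc N) + 1) / 3 * \<zeta>)) * R_int (Suc N) \<zeta>"
    unfolding R_H_eq(1)[OF \<zeta>] by simp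
  also have "\<dots> = - ((-1) ^ N / (3 * of_real pi * E) * (exp (- (2 / 3) * \<zeta>) * R_int (Suc N) \<zeta>))"
    unfolding E'' by simp
  finally have R1: "(-1) ^ N / (3 * of_real pi * E) * (exp (- (2 / 3) * \<zeta>) * R_int (Suc N) \<zeta>) = - R_H (Suc N) \<zeta>"
    by simp
  \<comment> \<open>Since e^3 = -1, the right-hand side is - 2 e^2 (e - 1/e) / (2i) = i (e^3 - e) =
    - i (e + 1).\<close>
  have ang: "- \<i> * (e + 1) = - 2 * exp (2 * (2 * of_nat N + 1) * of_real pi * \<i> / 3) * of_real (s3 N)"
  proof -
    have s: "of_real (s3 N) = (e - inverse e) / (2 * \<i>)"
      unfolding s3_def e_def \<phi>_def[symmetric]
      by (simp add: sin_of_real[symmetric] sin_exp_eq exp_minus mult.commute)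
    have e3: "e * e * e = -1"
    proof -
      have "e * e * e = exp (\<i> * of_real pi + of_int (int N) * (of_real (2 * pi) * \<i>))"
        unfolding e_def exp_add[symmetric] by (rule arg_cong[where f = exp]) (simp add: \<phi>_def field_simps)
      also have "\<dots> = -1 * exp (of_int (int N) * (of_real (2 * pi) * \<i>))" by (simp add: exp_add)
      also have "exp (of_int (int N) * (of_real (2 * pi) * \<i>)) = 1"
        by (subst exp_eq_1) (auto intro!: exI[of _ "int N"])
      finally show ?thesis by simp
    qed
    have ee: "exp (2 * (2 * of_nat N + 1) * of_real pi * \<i> / 3) = e * e"
      unfolding e_def exp_add[symmetric] by (rule arg_cong[where f = exp]) (simp add: \<phi>_def field_simps)
    have "e \<noteq> 0" by (simp add: e_def)
    hence "- 2 * (e * e) * ((e - inverse e) / (2 * \<i>)) = \<i> * (e * e * e - e)"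
      by (simp add: field_simps)
    also have "\<dots> = - \<i> * (e + 1)" unfolding e3 by (simp add: algebra_simps)
    finally show ?thesis unfolding ee s by simp
  qed
  have pm: "(-1) ^ N * ((-1) ^ N * x) = (x :: complex)" for x by (simp add: mult.assoc[symmetric] flip: power_mult_distrib)
  have "R_H N \<zeta> = (-1) ^ N / (3 * of_real pi * E) * ((- \<i> * (e + 1)) * (\<integral>\<theta>. mass N \<theta> \<partial>lborel)) + R_H (Suc N) \<zeta>"
    unfolding R_H_eq(1)[OF \<zeta>, of N] I E_def[symmetric] right_diff_distrib R1 by simp
  also have "(-1) ^ N / (3 * of_real pi * E) * ((- \<i> * (e + 1)) * (\<integral>\<theta>. mass N \<theta> \<partial>lborel)) =
     (- \<i> * (e + 1)) / (3 * of_real pi * E) * ((-1) ^ N * ((-1) ^ N * (of_real (Gamma ((2 * real N + 1) / 3)) * of_real (dcoef N))))"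
    unfolding mass_integral by (simp add: field_simps)
  also have "\<dots> = - (2 / (3 * of_real pi)) * (of_real (dcoef N) * exp (2 * (2 * of_nat N + 1) * of_real pi * \<i> / 3)
                     * of_real (s3 N) * gterm N \<zeta>)"
    unfolding pm ang gterm_def E_def[symmetric] by (simp add: field_simps)
  finally show ?thesis .
qed

section \<open>The resurgence identity\<close>

text \<open>One fraction of the kernel as a function of the ratio s/t = exp r of the outer to the
  inner variable: (s/t)^(-1/3) divided by 1 + (s/t)^(-2/3) exp (i \<phi>).\<close>

definition T_kernel :: "real \<Rightarrow> real \<Rightarrow> complex" where
  "T_kernel \<phi> r = of_real (exp (- r / 3)) / (1 + exp (of_real (- (2 / 3) * r) + \<i> * of_real \<phi>))"

text \<open>The substitution \<rho> = - 2r/3 reduces to \<open>Stieltjes_Mellin\<close> with c = 1/2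
  - 3a/2. The condition a < 1/3 is c > 0, and sin (\<pi> c) = cos (3 \<pi> a / 2) is the denominator
  of the Mellin ratio.\<close>

lemma T_kernel_Mellin:
  assumes a: "0 < a" "a < 1 / 3" and \<phi>: "\<bar>\<phi>\<bar> < pi / 2"
  shows "integrable lborel (\<lambda>r. of_real (exp (a * r)) * T_kernel \<phi> r)"
    and "(\<integral>r. of_real (exp (a * r)) * T_kernel \<phi> r \<partial>lborel) =
       exp (- \<i> * of_real (\<phi> * (1 / 2 - 3 * a / 2))) * of_real (3 / 2 * pi / cos (3 * pi * a / 2))"
proof -
  define c where "c = 1 / 2 - 3 * a / 2"
  have c: "0 < c" "c < 1" using a by (auto simp: c_def)
  let ?H = "\<lambda>\<rho>. of_real (exp (c * \<rho>)) / (1 + exp (of_real \<rho> + \<i> * of_real \<phi>))"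
  have eq: "of_real (exp (a * r)) * T_kernel \<phi> r = ?H (0 + (- (2 / 3)) * r)" for r
  proof -
    have "exp (a * r) * exp (- r / 3) = exp (c * (0 + (- (2 / 3)) * r))"
      unfolding exp_add[symmetric] by (rule arg_cong[where f = exp]) (simp add: c_def field_simps)
    hence "of_real (exp (a * r)) * of_real (exp (- r / 3)) = complex_of_real (exp (c * (0 + (- (2 / 3)) * r)))"
      unfolding of_real_mult[symmetric] by (simp only:)
    thus ?thesis unfolding T_kernel_def times_divide_eq_right by (simp only: add_0)
  qed
  show "integrable lborel (\<lambda>r. of_real (exp (a * r)) * T_kernel \<phi> r)"
    unfolding eq by (rule lborel_integrable_real_affine[OF Stieltjes_Mellin(1)[OF c \<phi>]]) simp
  have "(\<integral>\<rho>. ?H \<rho> \<partial>lborel) = \<bar>- (2 / 3)\<bar> *\<^sub>R (\<integral>r. ?H (0 + (- (2 / 3)) * r) \<partial>lborel)"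
    by (rule lborel_integral_real_affine) simp
  moreover have "B = 3 / 2 * A" if "A = \<bar>- (2 / 3)\<bar> *\<^sub>R B" for A B :: complex
    using that by (simp add: scaleR_conv_of_real field_simps)
  ultimately have "(\<integral>r. of_real (exp (a * r)) * T_kernel \<phi> r \<partial>lborel) = 3 / 2 * (\<integral>\<rho>. ?H \<rho> \<partial>lborel)"
    unfolding eq by blast
  also have "sin (pi * c) = cos (3 * pi * a / 2)"
    by (subst sin_cos_eq) (simp add: c_def field_simps)
  hence "3 / 2 * (\<integral>\<rho>. ?H \<rho> \<partial>lborel) = exp (- \<i> * of_real (\<phi> * c)) * of_real (3 / 2 * pi / cos (3 * pi * a / 2))"
    unfolding Stieltjes_Mellin(2)[OF c \<phi>] by simp
  finally show "(\<integral>r. of_real (exp (a * r)) * T_kernel \<phi> r \<partial>lborel) =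
       exp (- \<i> * of_real (\<phi> * (1 / 2 - 3 * a / 2))) * of_real (3 / 2 * pi / cos (3 * pi * a / 2))"
    by (simp only: c_def)
qed

text \<open>For \<nu> = is the two angles of the remainder kernel become \<pi>/3 and - \<pi>/3. The
  factor \<nu>^(-1/3) contributes exp (- i \<pi>/6), which turns the numerators exp (i \<pi>/3) and
  1 into a conjugate pair.\<close>

definition conv_kernel :: "real \<Rightarrow> complex" where
  "conv_kernel r = (exp (\<i> * of_real (pi / 6)) * T_kernel (pi / 3) r + exp (- \<i> * of_real (pi / 6)) * T_kernel (- (pi / 3)) r)
      / (3 * of_real pi)"

text \<open>The weights exp (i \<pi>/6) and exp (- i \<pi>/6) combine with the phases from
  \<open>T_kernel_Mellin\<close> to exp (i \<pi> a / 2) and its conjugate, whose sum is twice the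
  cosine in the numerator.\<close>

lemma conv_kernel_Mellin:
  assumes a: "0 < a" "a < 1 / 3"
  shows "integrable lborel (\<lambda>r. of_real (exp (a * r)) * conv_kernel r)"
    and "(\<integral>r. of_real (exp (a * r)) * conv_kernel r \<partial>lborel) = of_real (cos (pi * a / 2) / cos (3 * pi * a / 2))"
proof -
  have p: "\<bar>pi / 3\<bar> < pi / 2" "\<bar>- (pi / 3)\<bar> < pi / 2" using pi_gt_zero by auto
  note T1 = T_kernel_Mellin[OF a p(1)] and T2 = T_kernel_Mellin[OF a p(2)]
  have eq: "of_real (exp (a * r)) * conv_kernel r = (exp (\<i> * of_real (pi / 6)) * (of_real (exp (a * r)) * T_kernel (pi / 3) r) +
      exp (- \<i> * of_real (pi / 6)) * (of_real (exp (a * r)) * T_kernel (- (pi / 3)) r)) / (3 * of_real pi)" for r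
    by (simp add: conv_kernel_def algebra_simps)
  show "integrable lborel (\<lambda>r. of_real (exp (a * r)) * conv_kernel r)"
    unfolding eq by (intro integrable_divide Bochner_Integration.integrable_add integrable_mult_right T1(1) T2(1))
  define C where "C = cos (3 * pi * a / 2)"
  have e1: "exp (\<i> * of_real (pi / 6)) * exp (- \<i> * of_real (pi / 3 * (1 / 2 - 3 * a / 2))) = exp (\<i> * of_real (pi * a / 2))"
    unfolding exp_add[symmetric] by (rule arg_cong[where f = exp]) (simp add: field_simps)
  have e2: "exp (- \<i> * of_real (pi / 6)) * exp (- \<i> * of_real (- (pi / 3) * (1 / 2 - 3 * a / 2))) = exp (- (\<i> * of_real (pi * a / 2)))"
    unfolding exp_add[symmetric] by (rule arg_cong[where f = exp]) (simp add: field_simps)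
  have "(\<integral>r. of_real (exp (a * r)) * conv_kernel r \<partial>lborel) =
     (exp (\<i> * of_real (pi / 6)) * (\<integral>r. of_real (exp (a * r)) * T_kernel (pi / 3) r \<partial>lborel) +
      exp (- \<i> * of_real (pi / 6)) * (\<integral>r. of_real (exp (a * r)) * T_kernel (- (pi / 3)) r \<partial>lborel)) / (3 * of_real pi)"
    unfolding eq using T1(1) T2(1) by simp
  also have "\<dots> = (exp (\<i> * of_real (pi * a / 2)) + exp (- (\<i> * of_real (pi * a / 2)))) * of_real (3 / 2 * pi / C) / (3 * of_real pi)"
    unfolding T1(2) T2(2) C_def[symmetric] mult.assoc[symmetric] e1 e2 by (simp only: distrib_right)
  also have "exp (\<i> * of_real (pi * a / 2)) + exp (- (\<i> * of_real (pi * a / 2))) = 2 * cos (of_real (pi * a / 2))"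
    unfolding cos_exp_eq by simp
  also have "2 * cos (of_real (pi * a / 2)) * of_real (3 / 2 * pi / C) / (3 * of_real pi) = complex_of_real (cos (pi * a / 2) / C)"
    unfolding cos_of_real by simp
  finally show "(\<integral>r. of_real (exp (a * r)) * conv_kernel r \<partial>lborel) = of_real (cos (pi * a / 2) / cos (3 * pi * a / 2))"
    by (simp only: C_def)
qed

definition damped_hit :: "real \<Rightarrow> complex" where
  "damped_hit \<theta> = of_real (exp (- 2 * pi * exp \<theta>)) * hit (exp \<theta>)"

abbreviation axis :: "real \<Rightarrow> complex" where
  "axis \<tau> \<equiv> of_real \<tau> + \<i> * of_real (pi / 2)"

lemma axis_in_Hstrip: "axis \<tau> \<in> Hstrip"
  using pi_gt_zero by simp

lemma R_H_axis: "\<i> * R_H 0 (axis \<tau>) = (\<integral>\<theta>. damped_hit \<theta> * conv_kernel (\<tau> - \<theta>) \<partial>lborel)"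
proof -
  have E: "exp ((2 * of_nat 0 + 1) / 3 * axis \<tau>) = exp (of_real (\<tau> / 3) + \<i> * of_real (pi / 6))"
    by (rule arg_cong[where f = exp]) (simp add: field_simps)
  have K: "mass 0 \<theta> * (- \<i> * kerH 0 (axis \<tau>) (exp \<theta>)) =
      - \<i> * (3 * of_real pi * exp (of_real (\<tau> / 3) + \<i> * of_real (pi / 6))) * (damped_hit \<theta> * conv_kernel (\<tau> - \<theta>))" for \<theta>
  proof -
    define r where "r = \<tau> - \<theta>"
    define A B where "A = 1 + exp (of_real (- (2 / 3) * r) + \<i> * of_real (pi / 3))"
      and "B = 1 + exp (of_real (- (2 / 3) * r) + \<i> * of_real (- (pi / 3)))"
    have u: "tw23 (exp \<theta>) (axis \<tau>) = exp (of_real (- (2 / 3) * r) + \<i> * of_real (- (pi / 3)))"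
      unfolding tw23_exp by (rule arg_cong[where f = exp]) (simp add: r_def field_simps)
    have u': "tw23 (exp \<theta>) (axis \<tau>) * exp (2 * of_real pi * \<i> / 3) = exp (of_real (- (2 / 3) * r) + \<i> * of_real (pi / 3))"
      unfolding u exp_add[symmetric] by (rule arg_cong[where f = exp]) (simp add: field_simps)
    have e0: "exp ((2 * of_nat 0 + 1) * of_real pi * \<i> / 3) = exp (\<i> * of_real (pi / 6)) * exp (\<i> * of_real (pi / 6))"
      unfolding exp_add[symmetric] by (rule arg_cong[where f = exp]) (simp add: field_simps)
    have k: "kerH 0 (axis \<tau>) (exp \<theta>) = exp (\<i> * of_real (pi / 6)) * exp (\<i> * of_real (pi / 6)) / A + 1 / B"
      unfolding kerH_def u' e0 unfolding u A_def B_def ..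
    have m: "mass 0 \<theta> = exp (of_real (\<tau> / 3)) * of_real (exp (- r / 3)) * damped_hit \<theta>"
    proof -
      have "exp ((2 * real 0 + 1) / 3 * \<theta>) = exp (\<tau> / 3) * exp (- r / 3)"
        unfolding exp_add[symmetric] by (rule arg_cong[where f = exp]) (simp add: r_def field_simps)
      thus ?thesis unfolding mass_def damped_hit_def by (simp only: of_real_mult exp_of_real) (simp add: mult_ac)
    qed
    have ei: "exp (\<i> * of_real (pi / 6)) * exp (- \<i> * of_real (pi / 6)) = 1"
      unfolding exp_add[symmetric] by simp
    have eqX: "3 * of_real pi * conv_kernel r = exp (\<i> * of_real (pi / 6)) * (of_real (exp (- r / 3)) / A) + exp (- \<i> * of_real (pi / 6)) * (of_real (exp (- r / 3)) / B)"
      unfolding conv_kernel_def T_kernel_def A_def B_def by simp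
    have "exp (\<i> * of_real (pi / 6)) * (3 * of_real pi * conv_kernel r) =
        of_real (exp (- r / 3)) * (exp (\<i> * of_real (pi / 6)) * exp (\<i> * of_real (pi / 6)) / A
        + (exp (\<i> * of_real (pi / 6)) * exp (- \<i> * of_real (pi / 6))) / B)"
      unfolding eqX by (simp only: distrib_left divide_inverse mult_ac)
    hence c: "exp (\<i> * of_real (pi / 6)) * (3 * of_real pi * conv_kernel r) = of_real (exp (- r / 3)) * kerH 0 (axis \<tau>) (exp \<theta>)"
      unfolding ei k .
    have "mass 0 \<theta> * (- \<i> * kerH 0 (axis \<tau>) (exp \<theta>)) =
      - \<i> * exp (of_real (\<tau> / 3)) * damped_hit \<theta> * (of_real (exp (- r / 3)) * kerH 0 (axis \<tau>) (exp \<theta>))"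
      unfolding m by (simp only: mult_ac)
    also have "\<dots> = - \<i> * (3 * of_real pi * exp (of_real (\<tau> / 3) + \<i> * of_real (pi / 6))) * (damped_hit \<theta> * conv_kernel r)"
      unfolding c[symmetric] exp_add by (simp only: mult_ac)
    finally show ?thesis by (simp only: r_def)
  qed
  have "\<i> * R_H 0 (axis \<tau>) = \<i> / (3 * of_real pi * exp (of_real (\<tau> / 3) + \<i> * of_real (pi / 6))) * R_int 0 (axis \<tau>)"
    unfolding R_H_eq(1)[OF axis_in_Hstrip] E by simp
  also have "\<dots> = (\<integral>\<theta>. damped_hit \<theta> * conv_kernel (\<tau> - \<theta>) \<partial>lborel)"
    unfolding R_int_def K integral_mult_right_zero by simp
  finally show ?thesis .
qed

text \<open>The weight exp (a \<tau>) splits between the two factors of the convolution, so the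
  transforms multiply. The cosine of 3 \<pi> a / 2 from \<open>upper_line_integral\<close> cancels
  the denominator of the kernel transform, and what is left is \<open>Mellin_hit\<close>.\<close>

lemma R_H_axis_Mellin:
  assumes a: "0 < a" "a < 1 / 3"
  shows "integrable lborel (\<lambda>\<tau>. of_real (exp (a * \<tau>)) * (\<i> * R_H 0 (axis \<tau>)))"
    and "(\<integral>\<tau>. of_real (exp (a * \<tau>)) * (\<i> * R_H 0 (axis \<tau>)) \<partial>lborel) =
       (\<integral>\<tau>. of_real (exp (a * \<tau>)) * hit (exp \<tau>) \<partial>lborel)"
proof -
  let ?g = "\<lambda>\<theta>. of_real (exp (a * \<theta>)) * damped_hit \<theta>" and ?k = "\<lambda>r. of_real (exp (a * r)) * conv_kernel r"
  have g: "?g = (\<lambda>\<theta>. of_real (exp (a * \<theta>) * exp (- 2 * pi * exp \<theta>)) * hit (exp \<theta>))"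
    by (simp add: damped_hit_def fun_eq_iff mult.assoc)
  have gi: "integrable lborel ?g" unfolding g by (rule Mellin_upper(1)[OF a(1)])
  note ki = conv_kernel_Mellin[OF a]
  have eq: "of_real (exp (a * \<tau>)) * (\<i> * R_H 0 (axis \<tau>)) = (\<integral>\<theta>. ?g \<theta> * ?k (\<tau> - \<theta>) \<partial>lborel)" for \<tau>
  proof -
    have "?g \<theta> * ?k (\<tau> - \<theta>) = of_real (exp (a * \<tau>)) * (damped_hit \<theta> * conv_kernel (\<tau> - \<theta>))" for \<theta>
    proof -
      have "exp (a * \<theta>) * exp (a * (\<tau> - \<theta>)) = exp (a * \<tau>)"
        unfolding exp_add[symmetric] by (rule arg_cong[where f = exp]) (simp add: algebra_simps)
      hence "complex_of_real (exp (a * \<theta>)) * of_real (exp (a * (\<tau> - \<theta>))) = of_real (exp (a * \<tau>))"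
        unfolding of_real_mult[symmetric] by (simp only:)
      thus ?thesis by (metis (no_types, lifting) mult.assoc mult.left_commute)
    qed
    thus ?thesis unfolding R_H_axis by (simp only: integral_mult_right_zero)
  qed
  show "integrable lborel (\<lambda>\<tau>. of_real (exp (a * \<tau>)) * (\<i> * R_H 0 (axis \<tau>)))"
    unfolding eq by (rule convolution_integral(1)[OF gi ki(1)])
  \<comment> \<open>The range of a keeps 3 \<pi> a / 2 strictly below \<pi>/2, so the cosine to be
    cancelled is positive.\<close>
  have "0 < pi * (3 * a)" "pi * (3 * a) < pi * 1"
    using a by (simp, intro mult_strict_left_mono) auto
  hence "cos (pi * (3 * a) / 2) > 0" by (intro cos_gt_zero_pi) linarith+
  hence "cos (3 * pi * a / 2) > 0" by (simp add: mult_ac)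
  hence C: "cos (3 * pi * a / 2) \<noteq> 0" by simp
  have "(\<integral>\<tau>. of_real (exp (a * \<tau>)) * (\<i> * R_H 0 (axis \<tau>)) \<partial>lborel) =
     (\<integral>\<theta>. ?g \<theta> \<partial>lborel) * of_real (cos (pi * a / 2) / cos (3 * pi * a / 2))"
    unfolding eq convolution_integral(2)[OF gi ki(1)] ki(2) ..
  also have "(\<integral>\<theta>. ?g \<theta> \<partial>lborel) = of_real (Gamma a / pi * (cos (3 * pi * a / 2) * (\<integral>u. psi a u \<partial>lborel)))"
    unfolding g Mellin_upper(2)[OF a(1)] upper_line_integral[OF a] by simp
  also have "\<dots> * of_real (cos (pi * a / 2) / cos (3 * pi * a / 2)) =
      complex_of_real (Gamma a / pi * cos (pi * a / 2) * (\<integral>u. psi a u \<partial>lborel))"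
    unfolding of_real_mult[symmetric] using C by (intro arg_cong[where f = of_real]) (simp add: field_simps)
  finally show "(\<integral>\<tau>. of_real (exp (a * \<tau>)) * (\<i> * R_H 0 (axis \<tau>)) \<partial>lborel) =
       (\<integral>\<tau>. of_real (exp (a * \<tau>)) * hit (exp \<tau>) \<partial>lborel)"
    unfolding Mellin_hit[OF a] .
qed

text \<open>The transform is holomorphic in the strip 0 < Re z < c and vanishes on a real segment,
  hence in the whole strip. Its values on the line Re z = c/2 form the Fourier transform of exp (c
  \<tau> / 2) G, to which \<open>Fourier_unique\<close> applies.\<close>

lemma Mellin_unique:
  fixes G :: "real \<Rightarrow> complex"
  assumes c: "0 < c" and cont: "continuous_on UNIV G"
    and int: "\<And>a. 0 < a \<Longrightarrow> a < c \<Longrightarrow> integrable lborel (\<lambda>\<tau>. of_real (exp (a * \<tau>)) * G \<tau>)"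
    and zero: "\<And>a. 0 < a \<Longrightarrow> a < c \<Longrightarrow> (\<integral>\<tau>. of_real (exp (a * \<tau>)) * G \<tau> \<partial>lborel) = 0"
  shows "G \<tau> = 0"
proof -
  let ?S = "{z. 0 < Re z \<and> Re z < c}"
  have oS: "open ?S"
    by (intro open_Collect_conj open_halfspace_Re_gt open_halfspace_Re_lt)
  have cS: "convex ?S"
    using convex_Int[OF convex_halfspace_Re_gt[of 0] convex_halfspace_Re_lt[of c]]
    by (simp add: Collect_conj_eq)
  define D where "D z = (\<integral>\<tau>. exp (z * of_real \<tau>) * G \<tau> \<partial>lborel)" for z
  have "D field_differentiable (at z0)" if z0: "z0 \<in> ?S" for z0
  proof -
    obtain r where r: "r > 0" "cball z0 r \<subseteq> ?S"
      using oS z0 open_contains_cball by blast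
    have e: "z0 + of_real r \<in> cball z0 r" "z0 - of_real r \<in> cball z0 r"
      using r(1) by (auto simp: dist_norm)
    hence "z0 + of_real r \<in> ?S" "z0 - of_real r \<in> ?S" using r(2) by blast+
    hence b: "0 < Re z0 - r" "Re z0 - r < c" "0 < Re z0 + r" "Re z0 + r < c" by auto
    \<comment> \<open>The exponentials at the two extreme real parts dominate everything between
      them: the larger abscissa for \<tau> \<ge> 0, the smaller one for \<tau> < 0.\<close>
    let ?B = "\<lambda>\<tau>. norm (of_real (exp ((Re z0 - r) * \<tau>)) * G \<tau>) + norm (of_real (exp ((Re z0 + r) * \<tau>)) * G \<tau>)"
    show ?thesis
      unfolding field_differentiable_def D_def[abs_def]
    proof (rule exI, rule has_field_derivative_integral[OF r(1), where B = ?B])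
      show "(\<lambda>\<tau>. exp (z * of_real \<tau>) * G \<tau>) \<in> borel_measurable lborel" for z
        unfolding measurable_lborel2 by (intro borel_measurable_continuous_onI continuous_intros cont)
      show "(\<lambda>z. exp (z * of_real \<tau>) * G \<tau>) holomorphic_on ball z0 r" for \<tau>
        by (intro holomorphic_intros)
      show "integrable lborel ?B"
        by (intro Bochner_Integration.integrable_add integrable_norm int b)
      show "norm (exp (z * of_real \<tau>) * G \<tau>) \<le> ?B \<tau>" if "z \<in> ball z0 r" for \<tau> z
      proof -
        have "\<bar>Re (z0 - z)\<bar> \<le> norm (z0 - z)" by (rule abs_Re_le_cmod)
        also have "\<dots> < r" using that by (simp add: dist_norm)
        finally have rz: "Re z0 - r \<le> Re z" "Re z \<le> Re z0 + r" by auto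
        have "exp (Re z * \<tau>) \<le> exp ((Re z0 - r) * \<tau>) + exp ((Re z0 + r) * \<tau>)"
        proof (cases "\<tau> \<ge> 0")
          case True
          hence "exp (Re z * \<tau>) \<le> exp ((Re z0 + r) * \<tau>)" using rz by (simp add: mult_right_mono)
          thus ?thesis using exp_ge_zero[of "(Re z0 - r) * \<tau>"] by linarith
        next
          case False
          hence "exp (Re z * \<tau>) \<le> exp ((Re z0 - r) * \<tau>)" using rz by (simp add: mult_right_mono_neg)
          thus ?thesis using exp_ge_zero[of "(Re z0 + r) * \<tau>"] by linarith
        qed
        from mult_right_mono[OF this, of "norm (G \<tau>)"]
        show ?thesis by (simp add: norm_mult distrib_right)
      qed
    qed
  qed
  hence holo: "D holomorphic_on ?S"
    by (auto simp: holomorphic_on_def intro: field_differentiable_at_within)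
  have Dz: "D z = 0" if z: "z \<in> ?S" for z
  proof (rule analytic_continuation[OF holo oS convex_connected[OF cS], where U = "complex_of_real ` {0<..<c}" and \<xi> = "of_real (c / 2)"])
    show "of_real (c / 2) islimpt complex_of_real ` {0<..<c}"
      unfolding islimpt_sequential
    proof (intro exI[of _ "\<lambda>n. complex_of_real (c / 2 + c / 4 / real (Suc n))"] conjI allI)
      have "(\<lambda>n. c / 2 + c / 4 * inverse (real (Suc n))) \<longlonglongrightarrow> c / 2 + c / 4 * 0"
        by (intro tendsto_intros LIMSEQ_inverse_real_of_nat)
      hence "(\<lambda>n. c / 2 + c / 4 / real (Suc n)) \<longlonglongrightarrow> c / 2"
        by (simp only: divide_inverse[of "c / 4"] mult_zero_right add_0_right)
      thus "(\<lambda>n. complex_of_real (c / 2 + c / 4 / real (Suc n))) \<longlonglongrightarrow> of_real (c / 2)"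
        by (rule tendsto_of_real)
      show "complex_of_real (c / 2 + c / 4 / real (Suc n)) \<in> complex_of_real ` {0<..<c} - {of_real (c / 2)}" for n
      proof (intro DiffI imageI)
        have p: "c / 4 / real (Suc n) > 0" using c by simp
        have "c / 4 / real (Suc n) \<le> c / 4 / 1" using c by (intro divide_left_mono) auto
        hence "0 < c / 2 + c / 4 / real (Suc n) \<and> c / 2 + c / 4 / real (Suc n) < c" using p c by linarith
        thus "c / 2 + c / 4 / real (Suc n) \<in> {0<..<c}" by (simp only: greaterThanLessThan_iff)
        show "complex_of_real (c / 2 + c / 4 / real (Suc n)) \<notin> {of_real (c / 2)}"
          using p by (simp only: singleton_iff of_real_eq_iff)
      qed
    qed
    show "complex_of_real ` {0<..<c} \<subseteq> ?S" by auto
    show "of_real (c / 2) \<in> ?S" using c by simp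
    fix w assume "w \<in> complex_of_real ` {0<..<c}"
    then obtain a where a: "w = of_real a" "0 < a" "a < c" by auto
    have "D w = (\<integral>\<tau>. of_real (exp (a * \<tau>)) * G \<tau> \<partial>lborel)"
      unfolding D_def a(1) by (simp add: exp_of_real[symmetric])
    thus "D w = 0" using zero[OF a(2,3)] by simp
  qed (use z in auto)
  have "of_real (exp (c / 2 * \<tau>)) * G \<tau> = 0"
  proof (rule Fourier_unique)
    show "integrable lborel (\<lambda>\<tau>. of_real (exp (c / 2 * \<tau>)) * G \<tau>)" by (rule int) (use c in auto)
    show "continuous_on UNIV (\<lambda>\<tau>. of_real (exp (c / 2 * \<tau>)) * G \<tau>)" by (intro continuous_intros cont)
    fix y :: real
    have "iexp (y * x) * (of_real (exp (c / 2 * x)) * G x) = exp ((of_real (c / 2) + \<i> * of_real y) * of_real x) * G x" for x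
    proof -
      have "iexp (y * x) * of_real (exp (c / 2 * x)) = exp ((of_real (c / 2) + \<i> * of_real y) * of_real x)"
        unfolding exp_of_real[symmetric] exp_add[symmetric] by (rule arg_cong[where f = exp]) (simp add: algebra_simps)
      thus ?thesis by (simp only: mult.assoc[symmetric])
    qed
    hence "(\<integral>x. iexp (y * x) * (of_real (exp (c / 2 * x)) * G x) \<partial>lborel) = D (of_real (c / 2) + \<i> * of_real y)"
      by (simp only: D_def)
    also have "\<dots> = 0" by (rule Dz) (use c in simp)
    finally show "(\<integral>x. iexp (y * x) * (of_real (exp (c / 2 * x)) * G x) \<partial>lborel) = 0" .
  qed
  thus ?thesis by simp
qed

lemma H1_diag_eq_R_H_axis: "H1_diag (axis \<tau>) = R_H 0 (axis \<tau>)"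
proof -
  define G where "G \<tau> = hit (exp \<tau>) - \<i> * R_H 0 (axis \<tau>)" for \<tau>
  have "G \<tau> = 0"
  proof (rule Mellin_unique[where c = "1 / 3"])
    show "continuous_on UNIV G"
      unfolding G_def[abs_def]
      by (intro continuous_intros hit_exp_continuous
            continuous_on_compose2[OF holomorphic_on_imp_continuous_on[OF R_H_holomorphic]])
         (use axis_in_Hstrip in auto)
    fix a :: real assume a: "0 < a" "a < 1 / 3"
    note i = Mellin_hit_integrable[OF a] R_H_axis_Mellin(1)[OF a]
    have eq: "of_real (exp (a * \<tau>)) * G \<tau> = of_real (exp (a * \<tau>)) * hit (exp \<tau>) - of_real (exp (a * \<tau>)) * (\<i> * R_H 0 (axis \<tau>))" for \<tau>
      by (simp add: G_def right_diff_distrib)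
    show "integrable lborel (\<lambda>\<tau>. of_real (exp (a * \<tau>)) * G \<tau>)"
      unfolding eq by (rule Bochner_Integration.integrable_diff[OF i])
    show "(\<integral>\<tau>. of_real (exp (a * \<tau>)) * G \<tau> \<partial>lborel) = 0"
      unfolding eq Bochner_Integration.integral_diff[OF i] R_H_axis_Mellin(2)[OF a] by simp
  qed simp
  moreover have "hit (exp \<tau>) = \<i> * H1_diag (axis \<tau>)"
    by (simp add: hit_def H1_it_def)
  ultimately show ?thesis by (simp add: G_def)
qed

lemma H1_diag_eq_R_H:
  assumes "\<zeta> \<in> Hstrip"
  shows "H1_diag \<zeta> = R_H 0 \<zeta>"
proof -
  have "H1_diag \<zeta> - R_H 0 \<zeta> = 0"
  proof (rule analytic_continuation[where f = "\<lambda>\<zeta>. H1_diag \<zeta> - R_H 0 \<zeta>" and S = Hstrip and U = "range axis" and \<xi> = "axis 0"])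
    show "(\<lambda>\<zeta>. H1_diag \<zeta> - R_H 0 \<zeta>) holomorphic_on Hstrip"
      by (intro holomorphic_intros R_H_holomorphic holomorphic_on_subset[OF H1_diag_holomorphic]) auto
    show "connected Hstrip" by (rule convex_connected[OF Hstrip_convex])
    show "axis 0 islimpt range axis"
      unfolding islimpt_sequential
    proof (intro exI[of _ "\<lambda>n. axis (inverse (real (Suc n)))"] conjI allI)
      show "axis (inverse (real (Suc n))) \<in> range axis - {axis 0}" for n
        by (auto simp: complex_eq_iff simp del: of_nat_Suc)
      have "(\<lambda>n. axis (inverse (real (Suc n)))) \<longlonglongrightarrow> axis 0"
        by (intro tendsto_intros LIMSEQ_inverse_real_of_nat)
      thus "(\<lambda>n. axis (inverse (real (Suc n)))) \<longlonglongrightarrow> axis 0" .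
    qed
  qed (use assms Hstrip_open axis_in_Hstrip H1_diag_eq_R_H_axis in auto)
  thus ?thesis by simp
qed

section \<open>Truncated expansions and the passage from H1 to H2, J and Y\<close>

lemma H1_diag_expansion:
  assumes "\<zeta> \<in> Hstrip"
  shows "H1_diag \<zeta> = - (2 / (3 * of_real pi)) *
            (\<Sum>n<N. of_real (dcoef n) * exp (2 * (2 * of_nat n + 1) * of_real pi * \<i> / 3)
                     * of_real (s3 n) * gterm n \<zeta>) + R_H N \<zeta>"
proof (induction N)
  case 0
  show ?case using H1_diag_eq_R_H[OF assms] by simp
next
  case (Suc N)
  show ?case
    unfolding Suc.IH R_H_step[OF assms, of N] by (simp add: algebra_simps)
qed

text \<open>All angular factors of the theorem are polynomials in one cube root e of -1, up to
  constants, so the trigonometric comparison of the four expansions reduces to algebra with e^3 =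
  -1.\<close>

lemma cube_root_phase:
  fixes n :: nat
  defines "e \<equiv> exp (\<i> * of_real ((2 * real n + 1) * pi / 3))"
  shows "e ^ 3 = -1" and "e \<noteq> 0"
    and "exp ((2 * of_nat n + 1) * of_real pi * \<i> / 3) = e"
    and "exp (- (2 * of_nat n + 1) * of_real pi * \<i> / 3) = inverse e"
    and "exp (2 * (2 * of_nat n + 1) * of_real pi * \<i> / 3) = e\<^sup>2"
    and "exp (- 2 * (2 * of_nat n + 1) * of_real pi * \<i> / 3) = - e"
    and "of_real (s3 n) = (e + e\<^sup>2) / (2 * \<i>)"
proof -
  show nz: "e \<noteq> 0" by (simp add: e_def)
  show e3: "e ^ 3 = -1"
  proof -
    have "e ^ 3 = exp (\<i> * of_real pi + of_int (int n) * (of_real (2 * pi) * \<i>))"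
      unfolding e_def exp_of_nat_mult[symmetric]
      by (rule arg_cong[where f = exp]) (simp add: field_simps)
    also have "\<dots> = -1 * exp (of_int (int n) * (of_real (2 * pi) * \<i>))" by (simp add: exp_add)
    also have "exp (of_int (int n) * (of_real (2 * pi) * \<i>)) = 1"
      by (subst exp_eq_1) (auto intro!: exI[of _ "int n"])
    finally show ?thesis by simp
  qed
  have inv: "inverse e = - e\<^sup>2"
  proof -
    have "e * (- e\<^sup>2) = 1" using e3 by (simp add: power2_eq_square power3_eq_cube mult.assoc)
    thus ?thesis by (rule inverse_unique)
  qed
  show "exp ((2 * of_nat n + 1) * of_real pi * \<i> / 3) = e"
    unfolding e_def by (rule arg_cong[where f = exp]) simp
  show "exp (- (2 * of_nat n + 1) * of_real pi * \<i> / 3) = inverse e"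
    unfolding e_def exp_minus[symmetric] by (rule arg_cong[where f = exp]) (simp add: field_simps)
  show "exp (2 * (2 * of_nat n + 1) * of_real pi * \<i> / 3) = e\<^sup>2"
    unfolding e_def power2_eq_square exp_add[symmetric] by (rule arg_cong[where f = exp]) (simp add: field_simps)
  have "exp (- 2 * (2 * of_nat n + 1) * of_real pi * \<i> / 3) = inverse e * inverse e"
    unfolding e_def exp_minus[symmetric] exp_add[symmetric] by (rule arg_cong[where f = exp]) (simp add: field_simps)
  also have "\<dots> = e ^ 3 * e" unfolding inv by (simp add: power2_eq_square power3_eq_cube)
  finally show "exp (- 2 * (2 * of_nat n + 1) * of_real pi * \<i> / 3) = - e" unfolding e3 by simp
  have "of_real (s3 n) = sin (complex_of_real ((2 * real n + 1) * pi / 3))"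
    unfolding s3_def by (rule sin_of_real[symmetric])
  also have "\<dots> = (e - inverse e) / (2 * \<i>)"
    unfolding sin_exp_eq e_def exp_minus[symmetric] ..
  finally show "of_real (s3 n) = (e + e\<^sup>2) / (2 * \<i>)" unfolding inv by simp
qed

lemma gterm_add_i_pi:
  "gterm n (\<zeta> + \<i> * of_real pi) = gterm n \<zeta> / exp (\<i> * of_real ((2 * real n + 1) * pi / 3))"
proof -
  have "exp ((2 * of_nat n + 1) / 3 * (\<zeta> + \<i> * of_real pi)) =
      exp ((2 * of_nat n + 1) / 3 * \<zeta>) * exp (\<i> * of_real ((2 * real n + 1) * pi / 3))"
    unfolding exp_add[symmetric] by (rule arg_cong[where f = exp]) (simp add: field_simps)
  thus ?thesis by (simp add: gterm_def)
qed

lemma H2_diag_expansion: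
  assumes "- 3 * pi / 2 < Im \<zeta>" "Im \<zeta> < pi / 2"
  shows "H2_diag \<zeta> = - (2 / (3 * of_real pi)) *
            (\<Sum>n<N. of_real (dcoef n) * exp (- 2 * (2 * of_nat n + 1) * of_real pi * \<i> / 3)
                     * of_real (s3 n) * gterm n \<zeta>)
          - R_H N (\<zeta> + \<i> * of_real pi)"
proof -
  have S: "\<zeta> + \<i> * of_real pi \<in> Hstrip" using assms by simp
  have t: "of_real (dcoef n) * exp (2 * (2 * of_nat n + 1) * of_real pi * \<i> / 3) * of_real (s3 n) * gterm n (\<zeta> + \<i> * of_real pi)
      = - (of_real (dcoef n) * exp (- 2 * (2 * of_nat n + 1) * of_real pi * \<i> / 3) * of_real (s3 n) * gterm n \<zeta>)" for n
    unfolding gterm_add_i_pi cube_root_phase(5,6)[of n] using cube_root_phase(2)[of n]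
    by (simp add: field_simps power2_eq_square)
  show ?thesis
    unfolding H2_diag_eq H1_diag_expansion[OF S, of N] t sum_negf by simp
qed

lemma tw23_add_i_pi: "tw23 t (\<zeta> + \<i> * of_real pi) = tw23 t \<zeta> * exp (- 2 * of_real pi * \<i> / 3)"
proof -
  have "exp (- (2 / 3) * (\<zeta> + \<i> * of_real pi)) = exp (- (2 / 3) * \<zeta>) * exp (- 2 * of_real pi * \<i> / 3)"
    unfolding exp_add[symmetric] by (rule arg_cong[where f = exp]) (simp add: field_simps)
  thus ?thesis by (simp add: tw23_def)
qed

text \<open>A half-turn multiplies (t/\<nu>)^(2/3) by exp (- 2 \<pi> i / 3), so the first fraction
  of the turned kernel becomes the second fraction of the original one. This shared fraction cancels
  in the remainder of J and appears twice in that of Y.\<close>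

lemma kerH_add_i_pi:
  "exp (- (2 * of_nat N + 1) * of_real pi * \<i> / 3) * kerH N (\<zeta> + \<i> * of_real pi) t =
     1 / (1 + tw23 t \<zeta>) + exp (- (2 * of_nat N + 1) * of_real pi * \<i> / 3) / (1 + tw23 t \<zeta> * exp (- 2 * of_real pi * \<i> / 3))"
proof -
  have "exp (- 2 * of_real pi * \<i> / 3) * exp (2 * of_real pi * \<i> / 3) = (1 :: complex)"
    unfolding exp_add[symmetric] by simp
  hence tw: "tw23 t (\<zeta> + \<i> * of_real pi) * exp (2 * of_real pi * \<i> / 3) = tw23 t \<zeta>"
    unfolding tw23_add_i_pi mult.assoc by simp
  show ?thesis
    unfolding kerH_def tw unfolding tw23_add_i_pi cube_root_phase(3,4) using cube_root_phase(2)[of N]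
    by (simp add: distrib_left)
qed

lemma R_J_R_Y_eq:
  assumes "\<bar>Im \<zeta>\<bar> < pi / 2"
  shows "R_J N \<zeta> = (R_H N \<zeta> - R_H N (\<zeta> + \<i> * of_real pi)) / 2"
    and "R_Y N \<zeta> = (R_H N \<zeta> + R_H N (\<zeta> + \<i> * of_real pi)) / (2 * \<i>)"
proof -
  have S: "\<zeta> \<in> Hstrip" "\<zeta> + \<i> * of_real pi \<in> Hstrip" using assms by (auto simp: abs_less_iff)
  define x where "x = exp (- (2 * of_nat N + 1) * of_real pi * \<i> / 3)"
  define E where "E = exp ((2 * of_nat N + 1) / 3 * \<zeta>)"
  define c where "c = (-1) ^ N / (3 * of_real pi * E)"
  let ?f = "\<lambda>t. wt N t * kerH N \<zeta> t * H1_it t"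
  let ?g = "\<lambda>t. wt N t * kerH N (\<zeta> + \<i> * of_real pi) t * H1_it t"
  note fi = R_H_eq(3)[OF S(1), of N] and gi = R_H_eq(3)[OF S(2), of N]
  have xgi: "(\<lambda>t. x * ?g t) integrable_on {0<..}" by (rule integrable_on_mult_right[OF gi])
  have RH1: "R_H N \<zeta> = c * integral {0<..} ?f"
    by (simp add: R_H_def kerH_def c_def E_def)
  \<comment> \<open>The half-turn changes the prefactor by \<open>x\<close>, the very factor that
    \<open>kerH_add_i_pi\<close> wants in front of the turned kernel.\<close>
  have E2: "exp ((2 * of_nat N + 1) / 3 * (\<zeta> + \<i> * of_real pi)) = E / x"
    unfolding E_def x_def exp_diff[symmetric] by (rule arg_cong[where f = exp]) (simp add: field_simps)
  have x0: "x \<noteq> 0" by (simp add: x_def)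
  have "R_H N (\<zeta> + \<i> * of_real pi) = (-1) ^ N / (3 * of_real pi * (E / x)) * integral {0<..} ?g"
    unfolding R_H_def kerH_def E2 ..
  also have "\<dots> = c * (x * integral {0<..} ?g)" using x0 by (simp add: c_def)
  finally have RH2: "R_H N (\<zeta> + \<i> * of_real pi) = c * integral {0<..} (\<lambda>t. x * ?g t)"
    by simp
  have J: "wt N t * (exp ((2 * of_nat N + 1) * of_real pi * \<i> / 3)
            / (1 + tw23 t \<zeta> * exp (2 * of_real pi * \<i> / 3))
         - exp (- (2 * of_nat N + 1) * of_real pi * \<i> / 3)
            / (1 + tw23 t \<zeta> * exp (- 2 * of_real pi * \<i> / 3))) * H1_it t = ?f t - x * ?g t" for t
  proof -
    have "?f t - x * ?g t = wt N t * (kerH N \<zeta> t - x * kerH N (\<zeta> + \<i> * of_real pi) t) * H1_it t"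
      by (simp only: right_diff_distrib left_diff_distrib mult_ac)
    thus ?thesis unfolding x_def kerH_add_i_pi unfolding kerH_def by (simp only: add_diff_cancel_left' diff_diff_eq[symmetric] add_diff_cancel)
  qed
  have Y: "wt N t * (exp ((2 * of_nat N + 1) * of_real pi * \<i> / 3)
            / (1 + tw23 t \<zeta> * exp (2 * of_real pi * \<i> / 3))
         + exp (- (2 * of_nat N + 1) * of_real pi * \<i> / 3)
            / (1 + tw23 t \<zeta> * exp (- 2 * of_real pi * \<i> / 3))
         + 2 / (1 + tw23 t \<zeta>)) * H1_it t = ?f t + x * ?g t" for t
  proof -
    have "?f t + x * ?g t = wt N t * (kerH N \<zeta> t + x * kerH N (\<zeta> + \<i> * of_real pi) t) * H1_it t"
      by (simp only: distrib_left distrib_right mult_ac)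
    moreover have "2 / (1 + tw23 t \<zeta>) = 1 / (1 + tw23 t \<zeta>) + 1 / (1 + tw23 t \<zeta>)" by simp
    ultimately show ?thesis unfolding x_def kerH_add_i_pi unfolding kerH_def by (simp only: add_ac)
  qed
  have "R_J N \<zeta> = c / 2 * integral {0<..} (\<lambda>t. ?f t - x * ?g t)"
    unfolding R_J_def J by (simp add: c_def E_def)
  also have "\<dots> = c / 2 * (integral {0<..} ?f - integral {0<..} (\<lambda>t. x * ?g t))"
    by (simp only: Henstock_Kurzweil_Integration.integral_diff[OF fi xgi])
  finally show "R_J N \<zeta> = (R_H N \<zeta> - R_H N (\<zeta> + \<i> * of_real pi)) / 2"
    unfolding RH1 RH2 by (simp only: right_diff_distrib times_divide_eq_left diff_divide_distrib)
  have "R_Y N \<zeta> = c / (2 * \<i>) * integral {0<..} (\<lambda>t. ?f t + x * ?g t)"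
  proof -
    have "P / (6 * p * j * e) = P / (3 * p * e) / (2 * j)" for P p j e :: complex
      by (simp add: field_simps)
    thus ?thesis unfolding R_Y_def Y c_def E_def by (simp only:)
  qed
  also have "\<dots> = c / (2 * \<i>) * (integral {0<..} ?f + integral {0<..} (\<lambda>t. x * ?g t))"
    by (simp only: Henstock_Kurzweil_Integration.integral_add[OF fi xgi])
  finally show "R_Y N \<zeta> = (R_H N \<zeta> + R_H N (\<zeta> + \<i> * of_real pi)) / (2 * \<i>)"
    unfolding RH1 RH2 by (simp only: distrib_left times_divide_eq_left add_divide_distrib)
qed

lemma J_Y_diag_expansion:
  assumes \<zeta>: "\<bar>Im \<zeta>\<bar> < pi / 2"
  shows "J_diag \<zeta> = 1 / (3 * of_real pi) *
            (\<Sum>n<N. of_real (dcoef n) * of_real (s3 n) * gterm n \<zeta>) + R_J N \<zeta>"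
    and "Y_diag \<zeta> = - (2 / (3 * of_real pi)) *
            (\<Sum>n<N. of_real (dcoef n) * of_real ((s3 n)\<^sup>2) * gterm n \<zeta>) + R_Y N \<zeta>"
proof -
  define A where "A n = of_real (dcoef n) * exp (2 * (2 * of_nat n + 1) * of_real pi * \<i> / 3)
                     * of_real (s3 n) * gterm n \<zeta>" for n
  define B where "B n = of_real (dcoef n) * exp (- 2 * (2 * of_nat n + 1) * of_real pi * \<i> / 3)
                     * of_real (s3 n) * gterm n \<zeta>" for n
  have AB: "A n + B n = - (of_real (dcoef n) * of_real (s3 n) * gterm n \<zeta>)"
    "A n - B n = 2 * \<i> * (of_real (dcoef n) * of_real ((s3 n)\<^sup>2) * gterm n \<zeta>)" for n
  proof -
    define e where "e = exp (\<i> * of_real ((2 * real n + 1) * pi / 3))"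
    note c = cube_root_phase[of n, folded e_def]
    \<comment> \<open>The angular factors of H1 and H2 are e^2 and - e. Their sum times e + e^2 is
      e^4 - e^2 = - (e + e^2), so for J it acts as -1 on \<open>s3\<close>; their difference is 2i
      \<open>s3\<close>, which gives the square for Y.\<close>
    have p: "(e\<^sup>2 - e) * ((e + e\<^sup>2) / (2 * \<i>)) = - ((e + e\<^sup>2) / (2 * \<i>))"
    proof -
      have "(e\<^sup>2 - e) * (e + e\<^sup>2) = e ^ 3 * e - e\<^sup>2"
        by (simp add: power2_eq_square power3_eq_cube algebra_simps)
      also have "\<dots> = - (e + e\<^sup>2)" unfolding c(1) by simp
      finally show ?thesis by (simp only: times_divide_eq_right minus_divide_left)
    qed
    have m: "e\<^sup>2 + e = 2 * \<i> * ((e + e\<^sup>2) / (2 * \<i>))" by simp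
    have "A n + B n = of_real (dcoef n) * ((e\<^sup>2 - e) * of_real (s3 n)) * gterm n \<zeta>"
      unfolding A_def B_def c(5,6) by (simp add: algebra_simps)
    thus "A n + B n = - (of_real (dcoef n) * of_real (s3 n) * gterm n \<zeta>)"
      unfolding c(7) p by simp
    have "A n - B n = of_real (dcoef n) * ((e\<^sup>2 + e) * of_real (s3 n)) * gterm n \<zeta>"
      unfolding A_def B_def c(5,6) by (simp add: algebra_simps)
    also have "e\<^sup>2 + e = 2 * \<i> * of_real (s3 n)" unfolding c(7) by (rule m)
    finally show "A n - B n = 2 * \<i> * (of_real (dcoef n) * of_real ((s3 n)\<^sup>2) * gterm n \<zeta>)"
      by (simp add: power2_eq_square mult_ac)
  qed
  have S: "\<zeta> \<in> Hstrip" and b: "- 3 * pi / 2 < Im \<zeta>" "Im \<zeta> < pi / 2"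
    using \<zeta> by (auto simp: abs_less_iff)
  have H1: "H1_diag \<zeta> = - (2 / (3 * of_real pi)) * sum A {..<N} + R_H N \<zeta>"
    unfolding A_def[abs_def] by (rule H1_diag_expansion[OF S])
  have H2: "H2_diag \<zeta> = - (2 / (3 * of_real pi)) * sum B {..<N} - R_H N (\<zeta> + \<i> * of_real pi)"
    unfolding B_def[abs_def] by (rule H2_diag_expansion[OF b])
  have "J_diag \<zeta> = (H1_diag \<zeta> + H2_diag \<zeta>) / 2" by (simp add: H1_diag_def H2_diag_def)
  also have "\<dots> = - (1 / (3 * of_real pi)) * (\<Sum>n<N. A n + B n) + R_J N \<zeta>"
    unfolding H1 H2 R_J_R_Y_eq(1)[OF \<zeta>] sum.distrib by (simp add: field_simps)
  finally show "J_diag \<zeta> = 1 / (3 * of_real pi) *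
            (\<Sum>n<N. of_real (dcoef n) * of_real (s3 n) * gterm n \<zeta>) + R_J N \<zeta>"
    unfolding AB sum_negf by simp
  have "Y_diag \<zeta> = (H1_diag \<zeta> - H2_diag \<zeta>) / (2 * \<i>)" by (simp add: H1_diag_def H2_diag_def)
  also have "\<dots> = - (1 / (3 * of_real pi)) * ((\<Sum>n<N. A n - B n) / \<i>) + R_Y N \<zeta>"
  proof -
    have gen: "(- (2 / (3 * p)) * a + r - (- (2 / (3 * p)) * b - r')) / (2 * j) =
        - (1 / (3 * p)) * ((a - b) / j) + (r + r') / (2 * j)"
      if "p \<noteq> 0" "j \<noteq> 0" for p a b r r' j :: complex
      using that by (simp add: field_simps)
    show ?thesis
      unfolding H1 H2 R_J_R_Y_eq(2)[OF \<zeta>] sum_subtractf by (rule gen) simp_all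
  qed
  also have "(\<Sum>n<N. A n - B n) / \<i> = 2 * (\<Sum>n<N. of_real (dcoef n) * of_real ((s3 n)\<^sup>2) * gterm n \<zeta>)"
  proof -
    have "(\<Sum>n<N. A n - B n) = 2 * \<i> * (\<Sum>n<N. of_real (dcoef n) * of_real ((s3 n)\<^sup>2) * gterm n \<zeta>)"
      unfolding AB(2) by (rule sum_distrib_left[symmetric])
    moreover have "2 * \<i> * x / \<i> = 2 * x" for x by simp
    ultimately show ?thesis by (simp only:)
  qed
  also have "- (1 / (3 * of_real pi)) * (2 * x) = - (2 / (3 * of_real pi)) * x" for x :: complex
    by simp
  finally show "Y_diag \<zeta> = - (2 / (3 * of_real pi)) *
            (\<Sum>n<N. of_real (dcoef n) * of_real ((s3 n)\<^sup>2) * gterm n \<zeta>) + R_Y N \<zeta>" .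
qed

theorem theorem2:
  fixes N :: nat
  shows
  "(\<forall>n::nat.
      (\<lambda>t. of_real (t powr ((2 * real n - 2) / 3) * exp (- 2 * pi * t)) * (\<i> * H1_it t))
        integrable_on {0<..} \<and>
      complex_of_real (dcoef n) =
        (-1) ^ n / of_real (Gamma ((2 * real n + 1) / 3)) *
        integral {0<..} (\<lambda>t. of_real (t powr ((2 * real n - 2) / 3) * exp (- 2 * pi * t))
                               * (\<i> * H1_it t)))
   \<and> (\<forall>\<zeta>::complex. - pi / 2 < Im \<zeta> \<and> Im \<zeta> < 3 * pi / 2 \<longrightarrow>
        H1_diag \<zeta> =
          - (2 / (3 * of_real pi)) *
            (\<Sum>n<N. of_real (dcoef n) * exp (2 * (2 * of_nat n + 1) * of_real pi * \<i> / 3)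
                     * of_real (s3 n) * gterm n \<zeta>)
          + R_H N \<zeta>)
   \<and> (\<forall>\<zeta>::complex. - 3 * pi / 2 < Im \<zeta> \<and> Im \<zeta> < pi / 2 \<longrightarrow>
        H2_diag \<zeta> =
          - (2 / (3 * of_real pi)) *
            (\<Sum>n<N. of_real (dcoef n) * exp (- 2 * (2 * of_nat n + 1) * of_real pi * \<i> / 3)
                     * of_real (s3 n) * gterm n \<zeta>)
          - R_H N (\<zeta> + \<i> * of_real pi))
   \<and> (\<forall>\<zeta>::complex. \<bar>Im \<zeta>\<bar> < pi / 2 \<longrightarrow>
        J_diag \<zeta> =
          1 / (3 * of_real pi) *
            (\<Sum>n<N. of_real (dcoef n) * of_real (s3 n) * gterm n \<zeta>)
          + R_J N \<zeta>
      \<and> Y_diag \<zeta> =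
          - (2 / (3 * of_real pi)) *
            (\<Sum>n<N. of_real (dcoef n) * of_real ((s3 n)\<^sup>2) * gterm n \<zeta>)
          + R_Y N \<zeta>)"
proof (intro conjI allI impI)
  fix n :: nat
  show "(\<lambda>t. of_real (t powr ((2 * real n - 2) / 3) * exp (- 2 * pi * t)) * (\<i> * H1_it t))
        integrable_on {0<..}"
    by (rule dcoef_integral(1))
  show "complex_of_real (dcoef n) =
        (-1) ^ n / of_real (Gamma ((2 * real n + 1) / 3)) *
        integral {0<..} (\<lambda>t. of_real (t powr ((2 * real n - 2) / 3) * exp (- 2 * pi * t))
                               * (\<i> * H1_it t))"
    by (rule dcoef_integral(2))
next
  fix \<zeta> :: complex
  assume "- pi / 2 < Im \<zeta> \<and> Im \<zeta> < 3 * pi / 2"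
  hence "\<zeta> \<in> Hstrip" by simp
  thus "H1_diag \<zeta> = - (2 / (3 * of_real pi)) *
            (\<Sum>n<N. of_real (dcoef n) * exp (2 * (2 * of_nat n + 1) * of_real pi * \<i> / 3)
                     * of_real (s3 n) * gterm n \<zeta>) + R_H N \<zeta>"
    by (rule H1_diag_expansion)
next
  fix \<zeta> :: complex
  assume "- 3 * pi / 2 < Im \<zeta> \<and> Im \<zeta> < pi / 2"
  thus "H2_diag \<zeta> = - (2 / (3 * of_real pi)) *
            (\<Sum>n<N. of_real (dcoef n) * exp (- 2 * (2 * of_nat n + 1) * of_real pi * \<i> / 3)
                     * of_real (s3 n) * gterm n \<zeta>) - R_H N (\<zeta> + \<i> * of_real pi)"
    by (intro H2_diag_expansion) (elim conjE, assumption)+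
next
  fix \<zeta> :: complex
  assume \<zeta>: "\<bar>Im \<zeta>\<bar> < pi / 2"
  show "J_diag \<zeta> = 1 / (3 * of_real pi) *
            (\<Sum>n<N. of_real (dcoef n) * of_real (s3 n) * gterm n \<zeta>) + R_J N \<zeta>"
    by (rule J_Y_diag_expansion(1)[OF \<zeta>])
  show "Y_diag \<zeta> = - (2 / (3 * of_real pi)) *
            (\<Sum>n<N. of_real (dcoef n) * of_real ((s3 n)\<^sup>2) * gterm n \<zeta>) + R_Y N \<zeta>"
    by (rule J_Y_diag_expansion(2)[OF \<zeta>])
qed

end
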